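(* The dyadic partial field $\mathbb{D}=(\mathbb{Z}[\tfrac12],\langle -1,2\rangle)$ is the universal partial field of the matroid $P_8$; that is, $\mathbb{P}_{P_8}\cong\mathbb{D}$.
   Context: A partial field is a pair $(R,G)$ with $R$ a commutative ring with identity and $G$ a subgroup of $R^*$ with $-1\in G$; as a set it is $G\cup\{0\}$. A partial-field homomorphism is a map $\phi:\mathbb{P}_1\to\mathbb{P}_2$ with $\phi(1)=1$, $\phi(pq)=\phi(p)\phi(q)$, and $\phi(p)+\phi(q)=\phi(p+q)$ whenever $p,q,p+q\in\mathbb{P}_1$. An isomorphism is a bijective homomorphism such that $\phi(p)+\phi(q)\in\mathbb{P}_2$ if and only if $p+q\in\mathbb{P}_1$. $\langle S\rangle$ is the multiplicative group generated by the nonzero elements of $S$. $P_8=M[I\;A_8]$ is the rank-4 matroid on 8 elements represented over $\mathbb{Q}$ by $[I\;A_8]$, where $I$ is the $4\times 4$ identity matrix and $$A_8=\begin{bmatrix}0&1&1&2\\1&0&1&1\\1&1&0&1\\2&1&1&0\end{bmatrix}.$$ Universal partial field. Let $M=(E,\mathcal{B})$ be a matroid of rank $r$. For every $Z\in E^r$ introduce a symbol $[Z]$, and for every $Z\in E^r$ whose set of entries $\{Z\}$ is a basis, a symbol $\overline{[Z]}$. Let $I_M$ be the ideal, in the polynomial ring over $\mathbb{Z}$ in these symbols, generated by: (1) $[Z]$ for all $Z$ with $\{Z\}\notin\mathcal{B}$; (2) $[Z]-\mathrm{sgn}(\sigma)[Z^\sigma]$ for all $Z$ and permutations $\sigma$;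 (3) $[x_1,x_2,W][y_1,y_2,W]-[y_1,x_2,W][x_1,y_2,W]-[y_2,x_2,W][y_1,x_1,W]$ for all $x_1,x_2,y_1,y_2\in E$, $W\in E^{r-2}$; (4) $[Z]\overline{[Z]}-1$ for all $Z$ with $\{Z\}\in\mathcal{B}$. Let $\mathbb{B}_M$ be the quotient ring. For $B\in E^r$ with $\{B\}$ a basis, $A_{M,B}$ is the $\{B\}\times(E\setminus\{B\})$ matrix over $\mathbb{B}_M$ with $(A_{M,B})_{uv}=[B/u\to v]/[B]$, where $B/u\to v$ is $B$ with $u$ replaced by $v$; all its subdeterminants are zero or units. For an $X\times Y$ matrix $A$ all of whose subdeterminants are zero or units, $A'\preceq A$ means that $A'$ is obtained from $A$ by scaling rows or columns by units, deleting or permuting rows or columns, and pivoting (for $A_{xy}\neq0$, $A^{xy}$ is the $((X\setminus x)\cup y)\times((Y\setminus y)\cup x)$ matrix with $(A^{xy})_{yx}=A_{xy}^{-1}$, $(A^{xy})_{yv}=A_{xy}^{-1}A_{xv}$ for $v\neq x$, $(A^{xy})_{ux}=-A_{xy}^{-1}A_{uy}$ for $u\ne y$, $(A^{xy})_{uv}=A_{uv}-A_{xy}^{-1}A_{uy}A_{xv}$ otherwise). Put $\mathrm{Cr}(A)=\{p\mid\left[\begin{smallmatrix}1 & 1 \\ p & 1\end{smallmatrix}\right]\preceq A\}$ and $\mathrm{Cr}(M)=\mathrm{Cr}(A_{M,B})$ (independent of $B$). Let $R_M=\mathbb{Z}[\mathrm{Cr}(M)]\subseteq\mathbb{B}_M$.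 The universal partial field of $M$ is $\mathbb{P}_M=(R_M,\langle\mathrm{Cr}(M)\cup\{-1\}\rangle)$. *)

theory Defs
  imports
    "HOL-Library.Poly_Mapping"
    "HOL-Combinatorics.Permutations"
    "HOL-Algebra.QuotRing"
    "HOL-Algebra.Generated_Groups"
    "HOL-Algebra.Generated_Rings"
    "Jordan_Normal_Form.DL_Rank"
begin

section \<open>Matroids\<close>

record 'a matroid =
  ground :: "'a set"
  bases :: "'a set set"

definition is_matroid :: "'a matroid \<Rightarrow> bool" where
  "is_matroid M \<longleftrightarrow>
     finite (ground M) \<and> bases M \<subseteq> Pow (ground M) \<and> bases M \<noteq> {} \<and>
     (\<forall>I\<in>bases M. \<forall>J\<in>bases M. \<forall>x\<in>I - J. \<exists>y\<in>J - I. insert y (I - {x}) \<in> bases M)"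

definition matroid_rank :: "'a matroid \<Rightarrow> nat" where
  "matroid_rank M = (THE r. \<exists>I\<in>bases M. card I = r)"

text \<open>Independence of the columns indexed by \<open>X\<close> is independence as a family: parallel (equal)
  columns are dependent, hence the injectivity condition.\<close>

definition independent_columns :: "'k::field mat \<Rightarrow> nat set \<Rightarrow> bool" where
  "independent_columns A X \<longleftrightarrow>
     inj_on (col A) X \<and>
     \<not> LinearCombinations.module.lin_dep class_ring (module_vec TYPE('k) (dim_row A)) (col A ` X)"

definition column_matroid :: "'k::field mat \<Rightarrow> nat matroid" where
  "column_matroid A =
     \<lparr> ground = {..<dim_col A},
       bases = {X. X \<subseteq> {..<dim_col A} \<and> independent_columns A X \<and>
                   (\<forall>Y \<subseteq> {..<dim_col A}. independent_columns A Y \<longrightarrow> X \<subseteq> Y \<longrightarrow> Y = X)} \<rparr>"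

lemma (in vec_space) col_indep_mono:
  assumes "lin_indpt T" "S \<subseteq> T" shows "lin_indpt S"
  using assms unfolding lin_dep_def by blast

lemma independent_columns_mono:
  "independent_columns A Y \<Longrightarrow> X \<subseteq> Y \<Longrightarrow> independent_columns A X"
  unfolding independent_columns_def
  by (metis image_mono inj_on_subset vec_space.col_indep_mono)

lemma is_matroid_column_matroid: "is_matroid (column_matroid (A :: 'k::field mat))"
proof -
  interpret vec_space "TYPE('k)" "dim_row A" .
  let ?E = "{..<dim_col A}"
  let ?ind = "independent_columns A"
  have ind: "?ind X \<longleftrightarrow> inj_on (col A) X \<and> lin_indpt (col A ` X)" for X
    by (simp add: independent_columns_def)
  have C: "col A ` X \<subseteq> carrier_vec (dim_row A)" if "X \<subseteq> ?E" for X
    by auto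
  have fin: "finite X" if "X \<subseteq> ?E" for X
    using that by (rule finite_subset) simp
  have ins: "?ind (insert y X) \<longleftrightarrow> col A y \<notin> span (col A ` X)"
    if "?ind X" "X \<subseteq> ?E" "y \<notin> X" "y \<in> ?E" for X y
  proof (cases "col A y \<in> col A ` X")
    case True
    then have "\<not> ?ind (insert y X)" using that by (auto simp: ind)
    moreover have "col A y \<in> span (col A ` X)"
      using in_own_span[OF C[OF that(2)]] True by blast
    ultimately show ?thesis by blast
  next
    case False
    then show ?thesis
      using that lin_dep_iff_in_span[OF C[OF that(2)], of "col A y"]
      by (auto simp: ind)
  qed
  have basis_span: "col A z \<in> span (col A ` I)"
    if "I \<in> bases (column_matroid A)" "z \<in> ?E" for I z
  proof (cases "z \<in> I")
    case True
    then show ?thesis using that in_own_span[OF C, of I] by (auto simp: column_matroid_def)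
  next
    case False
    have I: "I \<subseteq> ?E" "?ind I" "\<forall>Y \<subseteq> ?E. ?ind Y \<longrightarrow> I \<subseteq> Y \<longrightarrow> Y = I"
      using that(1) by (auto simp: column_matroid_def)
    have "insert z I \<subseteq> ?E" "I \<subseteq> insert z I" "insert z I \<noteq> I"
      using I(1) that(2) False by auto
    then have "\<not> ?ind (insert z I)" using I(3) by metis
    then show ?thesis using ins[OF I(2,1) False that(2)] by simp
  qed
  have card_le: "card X \<le> card I"
    if "?ind X" "X \<subseteq> ?E" "I \<in> bases (column_matroid A)" for X I
  proof -
    have I: "I \<subseteq> ?E" "?ind I" using that by (auto simp: column_matroid_def)
    have "col A ` X \<subseteq> span (col A ` I)" using basis_span[OF that(3)] that(2) by auto
    moreover have "finite (col A ` X)" "finite (col A ` I)" "lin_indpt (col A ` X)"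
      using fin[OF that(2)] fin[OF I(1)] that(1) by (simp_all add: ind)
    ultimately have "\<exists>D. finite D \<and> D \<subseteq> carrier_vec (dim_row A) \<and> D \<subseteq> span (col A ` I) \<and>
        D \<inter> col A ` X = {} \<and> int (card D) \<le> int (card (col A ` I)) - int (card (col A ` X)) \<and>
        span (col A ` X \<union> D) = span (col A ` I)"
      by (intro replacement C[OF I(1)])
    then have "card (col A ` X) \<le> card (col A ` I)" by auto
    then show ?thesis using that(1) I(2) by (simp add: ind card_image)
  qed
  have basisI: "X \<in> bases (column_matroid A)"
    if "?ind X" "X \<subseteq> ?E" and max: "\<And>Y. ?ind Y \<Longrightarrow> Y \<subseteq> ?E \<Longrightarrow> card Y \<le> card X" for X
  proof -
    have "Y = X" if "?ind Y" "Y \<subseteq> ?E" "X \<subseteq> Y" for Y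
      using card_seteq[OF fin[OF that(2)] that(3)] max[OF that(1,2)] by simp
    then show ?thesis using that(1,2) unfolding column_matroid_def by simp
  qed
  have "bases (column_matroid A) \<noteq> {}"
  proof -
    let ?P = "\<lambda>X. ?ind X \<and> X \<subseteq> ?E"
    have "?P {}" by (auto simp: ind lin_dep_def)
    moreover have "card X < Suc (dim_col A)" if "?P X" for X
      using card_mono[of ?E X] that by simp
    ultimately have "\<exists>X. ?P X \<and> (\<forall>Y. ?P Y \<longrightarrow> card Y \<le> card X)"
      by (intro ex_has_greatest_nat[of ?P "{}" card "Suc (dim_col A)"]) simp_all
    then obtain X where "?P X" "\<forall>Y. ?P Y \<longrightarrow> card Y \<le> card X" by (elim exE conjE) simp
    then have "X \<in> bases (column_matroid A)" by (intro basisI) simp_all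
    then show ?thesis by blast
  qed
  moreover have "\<exists>y\<in>J - I. insert y (I - {x}) \<in> bases (column_matroid A)"
    if I: "I \<in> bases (column_matroid A)" and J: "J \<in> bases (column_matroid A)"
      and x: "x \<in> I - J" for I J x
  proof -
    have IE: "I \<subseteq> ?E" "?ind I" and JE: "J \<subseteq> ?E"
      using I J by (auto simp: column_matroid_def)
    have xE: "x \<in> ?E" using IE(1) x by blast
    let ?K = "I - {x}"
    have K: "?K \<subseteq> ?E" "?ind ?K"
      using IE(1) independent_columns_mono[OF IE(2), of ?K] by blast+
    have "\<exists>y\<in>J - I. ?ind (insert y ?K)"
    proof (rule ccontr)
      assume "\<not> ?thesis"
      then have *: "col A y \<in> span (col A ` ?K)" if "y \<in> J - I" for y
        using that ins[OF K(2) K(1), of y] JE by blast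
      have "col A y \<in> span (col A ` ?K)" if "y \<in> J" for y
      proof (cases "y \<in> I")
        case True
        then have "y \<in> ?K" using that x by auto
        then show ?thesis using in_own_span[OF C[OF K(1)]] by auto
      qed (use * that in auto)
      then have "col A ` J \<subseteq> span (col A ` ?K)" by (rule image_subsetI)
      then have "span (col A ` J) \<subseteq> span (col A ` ?K)"
        by (rule span_is_subset[OF _ span_is_submodule[OF C[OF K(1)]]])
      then have "col A x \<in> span (col A ` ?K)" by (rule subsetD[OF _ basis_span[OF J xE]])
      then have "\<not> ?ind (insert x ?K)" using ins[OF K(2,1) _ xE] by simp
      moreover have "insert x ?K = I" using x by auto
      ultimately show False using IE by simp
    qed
    then obtain y where y: "y \<in> J - I" "?ind (insert y ?K)" by blast
    have card: "card (insert y ?K) = card I"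
      using y x fin[OF IE(1)] card_Suc_Diff1[of I x] by (simp add: card_insert_if)
    have "insert y ?K \<in> bases (column_matroid A)"
    proof (rule basisI)
      show "?ind (insert y ?K)" by (rule y(2))
      show "insert y ?K \<subseteq> ?E" using y(1) JE K(1) by blast
      show "card Y \<le> card (insert y ?K)" if "?ind Y" "Y \<subseteq> ?E" for Y
        unfolding card by (rule card_le[OF that I])
    qed
    then show ?thesis using y by blast
  qed
  ultimately show ?thesis
    unfolding is_matroid_def by (simp add: column_matroid_def subset_iff)
qed

definition A8 :: "rat mat" where
  "A8 = mat_of_rows_list 4
     [[0, 1, 1, 2],
      [1, 0, 1, 1],
      [1, 1, 0, 1],
      [2, 1, 1, 0]]"

text \<open>The argument of \<open>column_matroid\<close> is the block matrix \<open>[I A8]\<close>.\<close>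

definition P8 :: "nat matroid" where
  "P8 = column_matroid (((1\<^sub>m 4)\<^sup>T @\<^sub>r A8\<^sup>T)\<^sup>T)"

lemma is_matroid_P8: "is_matroid P8"
  unfolding P8_def by (rule is_matroid_column_matroid)

lemma ground_P8: "ground P8 = {..<8}"
  by (simp add: P8_def column_matroid_def A8_def append_rows_def mat_of_rows_list_def)


section \<open>Partial fields\<close>

text \<open>The group is a set of elements of the ring; its operations are those of \<open>units_of\<close> the ring.\<close>

type_synonym 'r partial_field = "'r ring \<times> 'r set"

definition is_partial_field :: "'r partial_field \<Rightarrow> bool" where
  "is_partial_field = (\<lambda>(R, G). cring R \<and> subgroup G (units_of R) \<and> \<ominus>\<^bsub>R\<^esub> \<one>\<^bsub>R\<^esub> \<in> G)"

definition pf_set :: "'r partial_field \<Rightarrow> 'r set" where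
  "pf_set P = insert \<zero>\<^bsub>fst P\<^esub> (snd P)"

definition pf_hom :: "'r partial_field \<Rightarrow> 's partial_field \<Rightarrow> ('r \<Rightarrow> 's) \<Rightarrow> bool" where
  "pf_hom P Q \<phi> \<longleftrightarrow>
     \<phi> \<in> pf_set P \<rightarrow> pf_set Q \<and>
     \<phi> \<one>\<^bsub>fst P\<^esub> = \<one>\<^bsub>fst Q\<^esub> \<and>
     (\<forall>p\<in>pf_set P. \<forall>q\<in>pf_set P. \<phi> (p \<otimes>\<^bsub>fst P\<^esub> q) = \<phi> p \<otimes>\<^bsub>fst Q\<^esub> \<phi> q) \<and>
     (\<forall>p\<in>pf_set P. \<forall>q\<in>pf_set P. p \<oplus>\<^bsub>fst P\<^esub> q \<in> pf_set P \<longrightarrow>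
        \<phi> p \<oplus>\<^bsub>fst Q\<^esub> \<phi> q = \<phi> (p \<oplus>\<^bsub>fst P\<^esub> q))"

definition pf_iso :: "'r partial_field \<Rightarrow> 's partial_field \<Rightarrow> ('r \<Rightarrow> 's) \<Rightarrow> bool" where
  "pf_iso P Q \<phi> \<longleftrightarrow>
     pf_hom P Q \<phi> \<and> bij_betw \<phi> (pf_set P) (pf_set Q) \<and>
     (\<forall>p\<in>pf_set P. \<forall>q\<in>pf_set P.
        \<phi> p \<oplus>\<^bsub>fst Q\<^esub> \<phi> q \<in> pf_set Q \<longleftrightarrow> p \<oplus>\<^bsub>fst P\<^esub> q \<in> pf_set P)"

definition pf_isomorphic :: "'r partial_field \<Rightarrow> 's partial_field \<Rightarrow> bool" (infix \<open>\<cong>\<^sub>p\<^sub>f\<close> 50) where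
  "P \<cong>\<^sub>p\<^sub>f Q \<longleftrightarrow> is_partial_field P \<and> is_partial_field Q \<and> (\<exists>\<phi>. pf_iso P Q \<phi>)"

text \<open>\<open>subring_gen R S\<close> is \<open>\<int>[S]\<close> inside \<open>R\<close>, and \<open>mult_group_gen R S\<close> is \<open>\<langle>S\<rangle>\<close>, generated by the
  nonzero elements of \<open>S\<close>.\<close>

definition subring_gen :: "'r ring \<Rightarrow> 'r set \<Rightarrow> 'r ring" where
  "subring_gen R S = R\<lparr>carrier := generate_ring R S\<rparr>"

definition mult_group_gen :: "'r ring \<Rightarrow> 'r set \<Rightarrow> 'r set" where
  "mult_group_gen R S = generate (units_of R) (S - {\<zero>\<^bsub>R\<^esub>})"

definition dyadic :: "rat partial_field" where
  "dyadic = (let R = subring_gen class_ring {1/2} in (R, mult_group_gen R {-1, 2}))"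


section \<open>The bracket ring of a matroid\<close>

text \<open>\<open>Br Z\<close> is the symbol \<open>[Z]\<close>, and \<open>BrInv Z\<close> is the symbol \<open>[Z]\<close> with a bar.\<close>

datatype 'a bracket_symbol = Br "'a list" | BrInv "'a list"

type_synonym 'a bracket_poly = "('a bracket_symbol \<Rightarrow>\<^sub>0 nat) \<Rightarrow>\<^sub>0 int"

definition bvar :: "'a bracket_symbol \<Rightarrow> 'a bracket_poly" where
  "bvar s = Poly_Mapping.single (Poly_Mapping.single s 1) 1"

abbreviation br :: "'a list \<Rightarrow> 'a bracket_poly" where "br Z \<equiv> bvar (Br Z)"
abbreviation br_inv :: "'a list \<Rightarrow> 'a bracket_poly" where "br_inv Z \<equiv> bvar (BrInv Z)"

definition tuples :: "'a matroid \<Rightarrow> 'a list set" where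
  "tuples M = {Z. length Z = matroid_rank M \<and> set Z \<subseteq> ground M}"

definition basis_tuples :: "'a matroid \<Rightarrow> 'a list set" where
  "basis_tuples M = {Z \<in> tuples M. set Z \<in> bases M}"

definition bracket_symbols :: "'a matroid \<Rightarrow> 'a bracket_symbol set" where
  "bracket_symbols M = Br ` tuples M \<union> BrInv ` basis_tuples M"

text \<open>The type \<open>'a bracket_poly\<close> has a variable for every list, so the carrier is restricted to the
  polynomials in the symbols belonging to \<open>M\<close>.\<close>

definition bracket_poly_ring :: "'a matroid \<Rightarrow> 'a bracket_poly ring" where
  "bracket_poly_ring M =
     class_ring\<lparr>carrier := {p. \<forall>m\<in>Poly_Mapping.keys p. Poly_Mapping.keys m \<subseteq> bracket_symbols M}\<rparr>"

definition bracket_relations :: "'a matroid \<Rightarrow> 'a bracket_poly set" where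
  "bracket_relations M =
     {br Z | Z. Z \<in> tuples M \<and> set Z \<notin> bases M} \<union>
     {br Z - of_int (sign \<sigma>) * br (permute_list \<sigma> Z) | Z \<sigma>.
        Z \<in> tuples M \<and> \<sigma> permutes {..<matroid_rank M}} \<union>
     {br (x1 # x2 # W) * br (y1 # y2 # W)
        - br (y1 # x2 # W) * br (x1 # y2 # W)
        - br (y2 # x2 # W) * br (y1 # x1 # W) | x1 x2 y1 y2 W.
        {x1, x2, y1, y2} \<subseteq> ground M \<and> set W \<subseteq> ground M \<and> length W + 2 = matroid_rank M} \<union>
     {br Z * br_inv Z - 1 | Z. Z \<in> basis_tuples M}"

definition bracket_ideal :: "'a matroid \<Rightarrow> 'a bracket_poly set" where
  "bracket_ideal M = genideal (bracket_poly_ring M) (bracket_relations M)"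

definition bracket_ring :: "'a matroid \<Rightarrow> 'a bracket_poly set ring" where
  "bracket_ring M = bracket_poly_ring M Quot bracket_ideal M"

definition bracket :: "'a matroid \<Rightarrow> 'a list \<Rightarrow> 'a bracket_poly set" where
  "bracket M Z = bracket_ideal M +>\<^bsub>bracket_poly_ring M\<^esub> br Z"


section \<open>Labelled matrices and cross ratios\<close>

text \<open>An \<open>X \<times> Y\<close> matrix. Only the entries at labels in \<open>X \<times> Y\<close> are meaningful. The labels are
  unordered, so permuting rows or columns does not change the object.\<close>

record ('e, 'r) labelled_matrix =
  row_labels :: "'e set"
  col_labels :: "'e set"
  entry :: "'e \<Rightarrow> 'e \<Rightarrow> 'r"

definition scale_row :: "('r, 'm) ring_scheme \<Rightarrow> 'e \<Rightarrow> 'r \<Rightarrow> ('e, 'r) labelled_matrix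
    \<Rightarrow> ('e, 'r) labelled_matrix" where
  "scale_row R x c A =
     A\<lparr>entry := (\<lambda>u v. if u = x then c \<otimes>\<^bsub>R\<^esub> entry A u v else entry A u v)\<rparr>"

definition scale_col :: "('r, 'm) ring_scheme \<Rightarrow> 'e \<Rightarrow> 'r \<Rightarrow> ('e, 'r) labelled_matrix
    \<Rightarrow> ('e, 'r) labelled_matrix" where
  "scale_col R y c A =
     A\<lparr>entry := (\<lambda>u v. if v = y then c \<otimes>\<^bsub>R\<^esub> entry A u v else entry A u v)\<rparr>"

definition pivot :: "('r, 'm) ring_scheme \<Rightarrow> 'e \<Rightarrow> 'e \<Rightarrow> ('e, 'r) labelled_matrix
    \<Rightarrow> ('e, 'r) labelled_matrix" where
  "pivot R x y A =
     (let a = inv\<^bsub>R\<^esub> (entry A x y) in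
      \<lparr> row_labels = insert y (row_labels A - {x}),
        col_labels = insert x (col_labels A - {y}),
        entry = (\<lambda>u v.
          if u = y \<and> v = x then a
          else if u = y then a \<otimes>\<^bsub>R\<^esub> entry A x v
          else if v = x then \<ominus>\<^bsub>R\<^esub> (a \<otimes>\<^bsub>R\<^esub> entry A u y)
          else entry A u v \<ominus>\<^bsub>R\<^esub> a \<otimes>\<^bsub>R\<^esub> entry A u y \<otimes>\<^bsub>R\<^esub> entry A x v) \<rparr>)"

text \<open>\<open>matrix_minor R A A'\<close> is \<open>A' \<preceq> A\<close>.\<close>

inductive matrix_minor :: "('r, 'm) ring_scheme \<Rightarrow> ('e, 'r) labelled_matrix
    \<Rightarrow> ('e, 'r) labelled_matrix \<Rightarrow> bool" for R A where
  refl: "matrix_minor R A A"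
| scale_row: "\<lbrakk> matrix_minor R A A'; x \<in> row_labels A'; c \<in> Units R \<rbrakk>
    \<Longrightarrow> matrix_minor R A (scale_row R x c A')"
| scale_col: "\<lbrakk> matrix_minor R A A'; y \<in> col_labels A'; c \<in> Units R \<rbrakk>
    \<Longrightarrow> matrix_minor R A (scale_col R y c A')"
| delete_row: "\<lbrakk> matrix_minor R A A'; x \<in> row_labels A' \<rbrakk>
    \<Longrightarrow> matrix_minor R A (A'\<lparr>row_labels := row_labels A' - {x}\<rparr>)"
| delete_col: "\<lbrakk> matrix_minor R A A'; y \<in> col_labels A' \<rbrakk>
    \<Longrightarrow> matrix_minor R A (A'\<lparr>col_labels := col_labels A' - {y}\<rparr>)"
| pivot: "\<lbrakk> matrix_minor R A A'; x \<in> row_labels A'; y \<in> col_labels A'; entry A' x y \<noteq> \<zero>\<^bsub>R\<^esub> \<rbrakk>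
    \<Longrightarrow> matrix_minor R A (pivot R x y A')"

text \<open>The matrix \<open>[1 1; p 1]\<close> is unlabelled, so it is matched up to a choice of labels.\<close>

definition matrix_cross_ratios :: "('r, 'm) ring_scheme \<Rightarrow> ('e, 'r) labelled_matrix \<Rightarrow> 'r set" where
  "matrix_cross_ratios R A =
     {p. \<exists>A' x1 x2 y1 y2. matrix_minor R A A' \<and>
           x1 \<noteq> x2 \<and> row_labels A' = {x1, x2} \<and> y1 \<noteq> y2 \<and> col_labels A' = {y1, y2} \<and>
           entry A' x1 y1 = \<one>\<^bsub>R\<^esub> \<and> entry A' x1 y2 = \<one>\<^bsub>R\<^esub> \<and>
           entry A' x2 y1 = p \<and> entry A' x2 y2 = \<one>\<^bsub>R\<^esub>}"

definition bracket_matrix :: "'a matroid \<Rightarrow> 'a list \<Rightarrow> ('a, 'a bracket_poly set) labelled_matrix" where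
  "bracket_matrix M B =
     \<lparr> row_labels = set B,
       col_labels = ground M - set B,
       entry = (\<lambda>u v. bracket M (map (\<lambda>w. if w = u then v else w) B)
                        \<otimes>\<^bsub>bracket_ring M\<^esub> inv\<^bsub>bracket_ring M\<^esub> (bracket M B)) \<rparr>"

text \<open>The set of cross ratios does not depend on the basis \<open>B\<close>; an arbitrary one is chosen.\<close>

definition cross_ratios :: "'a matroid \<Rightarrow> 'a bracket_poly set set" where
  "cross_ratios M =
     matrix_cross_ratios (bracket_ring M) (bracket_matrix M (SOME B. B \<in> basis_tuples M))"


section \<open>The universal partial field\<close>

definition universal_partial_field :: "'a matroid \<Rightarrow> 'a bracket_poly set partial_field" where
  "universal_partial_field M =
     (let R = subring_gen (bracket_ring M) (cross_ratios M)
      in (R, mult_group_gen R (cross_ratios M \<union> {\<ominus>\<^bsub>bracket_ring M\<^esub> \<one>\<^bsub>bracket_ring M\<^esub>})))"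

end

(* Every bracket of P8 turns out to be c * det * (product of weights t_e), where det is the
   integer minor of [I A8]. First, [Z] = [B] * det(Z) for the minors of the bracket matrix of the
   standard basis B: the three-term relations propagate this from the tuples with at least three
   entries in B, because P8 has no parallel elements, so that any two distinct elements extend by
   two elements of B to a basis, whose bracket can be cancelled. The vanishing brackets of
   nonbases then force the bracket matrix to be a row and column scaling of A8, and also force 2
   to be a unit. Pivoting, deleting and scaling only produce scaled bracket matrices of other bases,
   in whose cross ratios the weights cancel, and all minors of [I A8] are 0 or +-2^k; so every cross
   ratio is 0 or +-2^k, while 2 and 1/2 do occur. Evaluating brackets at these minors gives a ring
   homomorphism from the bracket ring to the rationals, whose restriction is the isomorphism. *)
theory Submission
  imports Defs
begin

section \<open>Minors and the three-term relation\<close>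

text \<open>The obstacle is that \<open>bracket_ring\<close> has its operations on an explicit
  carrier, whereas determinants and long polynomial identities need a type of class
  \<open>comm_ring_1\<close>. The combinatorial work is therefore done for an arbitrary function
  \<open>b\<close> into such a type that obeys the four families of relations, and the carrier of
  the bracket ring of \<open>P8\<close> is made into a type near the end. The class demands 0
  \<noteq> 1, so the bracket ring must not collapse; evaluation at the integer minors shows this,
  and thus serves twice. The representation is rigid because seven of the nonzero entries of
  \<open>A8\<close>, all equal to 1, form a spanning tree of the bipartite graph of nonzero entries.
  Scaling fixes them; four vanishing minors express the other five by one parameter, and a fifth
  minor determines it. The generated rings are never described completely: only 0, the elements
  +-2^k and their sums matter, and a power of 2 turns these into integers. Evaluation is injective
  on such elements because it fixes integers; nothing is claimed about it elsewhere in the bracket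
  ring.\<close>

lemma det_minor_expand:
  fixes F :: "nat \<Rightarrow> nat \<Rightarrow> 'r::comm_ring_1"
  assumes "length rs = Suc n"
  shows "det (mat (Suc n) (Suc n) (\<lambda>(i, j). F (rs ! i) (k + j))) =
    (\<Sum>i<Suc n. (-1) ^ i * F (rs ! i) k *
        det (mat n n (\<lambda>(a, b). F ((take i rs @ drop (Suc i) rs) ! a) (Suc k + b))))"
proof -
  have "mat_delete (mat (Suc n) (Suc n) (\<lambda>(i, j). F (rs ! i) (k + j))) i 0
      = mat n n (\<lambda>(a, b). F ((take i rs @ drop (Suc i) rs) ! a) (Suc k + b))" if "i < Suc n" for i
    using that assms by (intro eq_matI) (auto simp: mat_delete_def nth_append)
  then show ?thesis
    by (subst laplace_expansion_column[of _ "Suc n" 0])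
      (auto intro!: sum.cong simp: cofactor_def)
qed

text \<open>\<open>C z\<close> is the column labelled \<open>z\<close>.\<close>

definition tuple_det :: "('a \<Rightarrow> nat \<Rightarrow> 'r::comm_ring_1) \<Rightarrow> 'a list \<Rightarrow> 'r" where
  "tuple_det C Z = det (mat (length Z) (length Z) (\<lambda>(i, j). C (Z ! j) i))"

text \<open>Laplace expansion by two columns: each summand is a 2 x 2 minor of \<open>w\<close>,
  \<open>x\<close> times the complementary minor of \<open>y\<close>, \<open>z\<close>. With
  \<open>y\<close> and \<open>z\<close> fixed, this is visibly an alternating form in
  \<open>w\<close> and \<open>x\<close>.\<close>

lemma tuple_det_4:
  "tuple_det C [w, x, y, z] =
     (C w 0 * C x 1 - C w 1 * C x 0) * (C y 2 * C z 3 - C y 3 * C z 2)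
   - (C w 0 * C x 2 - C w 2 * C x 0) * (C y 1 * C z 3 - C y 3 * C z 1)
   + (C w 0 * C x 3 - C w 3 * C x 0) * (C y 1 * C z 2 - C y 2 * C z 1)
   + (C w 1 * C x 2 - C w 2 * C x 1) * (C y 0 * C z 3 - C y 3 * C z 0)
   - (C w 1 * C x 3 - C w 3 * C x 1) * (C y 0 * C z 2 - C y 2 * C z 0)
   + (C w 2 * C x 3 - C w 3 * C x 2) * (C y 0 * C z 1 - C y 1 * C z 0)"
proof -
  define Z where "Z = [w, x, y, z]"
  \<comment> \<open>\<open>L rs k\<close> is the minor on the rows \<open>rs\<close> and the columns
    from \<open>k\<close> on. Expansion along the first column keeps this shape, with one row
    dropped and \<open>k\<close> increased, so it can be iterated as a rewrite rule down to
    \<open>L [] k\<close>.\<close>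
  define L where "L rs k = det (mat (length rs) (length rs) (\<lambda>(i, j). C (Z ! (k + j)) (rs ! i)))" for rs k
  have L0: "L [] k = 1" for k by (simp add: L_def)
  have L: "L (r # rs) k = (\<Sum>i<Suc (length rs). (-1) ^ i * C (Z ! k) ((r # rs) ! i) *
         L (take i (r # rs) @ drop (Suc i) (r # rs)) (Suc k))" for r rs k
  proof -
    have "length (take i (r # rs) @ drop (Suc i) (r # rs)) = length rs" if "i < Suc (length rs)" for i
      using that by simp
    then show ?thesis
      unfolding L_def using det_minor_expand[of "r # rs" "length rs" "\<lambda>i j. C (Z ! j) i" k]
      by (simp del: sum.lessThan_Suc cong: sum.cong_simp)
  qed
  have "tuple_det C Z = L [0, Suc 0, Suc (Suc 0), Suc (Suc (Suc 0))] 0"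
    unfolding tuple_det_def L_def Z_def
    by (rule arg_cong[of _ _ det], rule eq_matI) (auto simp: less_Suc_eq)
  then show ?thesis
    by (simp add: L L0 Z_def[symmetric]) (simp add: Z_def eval_nat_numeral algebra_simps)
qed
lemma tuple_det_permute:
  assumes "\<sigma> permutes {..<length Z}"
  shows "tuple_det C (permute_list \<sigma> Z) = of_int (sign \<sigma>) * tuple_det C Z"
proof -
  let ?n = "length Z"
  let ?A = "mat ?n ?n (\<lambda>(i, j). C (Z ! i) j)"
  have p: "\<sigma> permutes {0..<?n}" using assms by (simp add: atLeast0LessThan)
  have tr: "tuple_det C Y = det (mat (length Y) (length Y) (\<lambda>(i, j). C (Y ! i) j))" for Y
    unfolding tuple_det_def
    by (subst det_transpose[symmetric, of _ "length Y"], simp)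
      (rule arg_cong[of _ _ det], rule eq_matI, simp_all)
  have "tuple_det C (permute_list \<sigma> Z) = det (mat ?n ?n (\<lambda>(i, j). ?A $$ (\<sigma> i, j)))"
    unfolding tr using permutes_in_image[OF assms]
    by (intro arg_cong[of _ _ det] eq_matI) (simp_all add: permute_list_nth[OF assms])
  also have "\<dots> = of_int (sign \<sigma>) * tuple_det C Z"
    unfolding tr by (subst det_permute_rows[OF _ p]) simp_all
  finally show ?thesis .
qed

lemma tuple_det_not_distinct:
  assumes "\<not> distinct Z"
  shows "tuple_det C Z = 0"
proof -
  obtain i j where ij: "i < length Z" "j < length Z" "i \<noteq> j" "Z ! i = Z ! j"
    using assms by (auto simp: distinct_conv_nth)
  show ?thesis
    unfolding tuple_det_def
    by (rule det_identical_cols[OF _ ij(3,1,2)], simp, rule eq_vecI)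
      (simp_all add: ij)
qed

text \<open>Fixing the last two columns turns \<open>tuple_det\<close> into an alternating form whose coefficients
  \<open>q\<^sub>i\<^sub>j\<close> are \<open>2 \<times> 2\<close> minors, so its Pfaffian vanishes.\<close>

lemma pluecker_relation:
  "tuple_det C [x1, x2, w, w'] * tuple_det C [y1, y2, w, w']
   - tuple_det C [y1, x2, w, w'] * tuple_det C [x1, y2, w, w']
   - tuple_det C [y2, x2, w, w'] * tuple_det C [y1, x1, w, w'] = 0"
proof -
  \<comment> \<open>Up to the Laplace sign, \<open>qij\<close> is the minor of \<open>w\<close>,
    \<open>w'\<close> on the two rows other than i and j.\<close>
  obtain q01 q02 q03 q12 q13 q23 where q:
    "q01 = C w 2 * C w' 3 - C w 3 * C w' 2"
    "q02 = - (C w 1 * C w' 3 - C w 3 * C w' 1)"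
    "q03 = C w 1 * C w' 2 - C w 2 * C w' 1"
    "q12 = C w 0 * C w' 3 - C w 3 * C w' 0"
    "q13 = - (C w 0 * C w' 2 - C w 2 * C w' 0)"
    "q23 = C w 0 * C w' 1 - C w 1 * C w' 0" by blast
  have pfaffian: "q01 * q23 - q02 * q13 + q03 * q12 = 0"
    unfolding q by (simp add: algebra_simps)
  define f where "f u v = tuple_det C [u, v, w, w']" for u v
  have f: "f u v = (C u 0 * C v 1 - C u 1 * C v 0) * q01 + (C u 0 * C v 2 - C u 2 * C v 0) * q02
      + (C u 0 * C v 3 - C u 3 * C v 0) * q03 + (C u 1 * C v 2 - C u 2 * C v 1) * q12
      + (C u 1 * C v 3 - C u 3 * C v 1) * q13 + (C u 2 * C v 3 - C u 3 * C v 2) * q23" for u v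
    unfolding f_def tuple_det_4 q by (simp only: mult_minus_right diff_conv_add_uminus)
  \<comment> \<open>\<open>gi v\<close> is the coefficient of \<open>C u i\<close> in
    \<open>f u v\<close>, the form contracted with \<open>v\<close>.\<close>
  define g0 where "g0 v = C v 1 * q01 + C v 2 * q02 + C v 3 * q03" for v
  define g1 where "g1 v = - C v 0 * q01 + C v 2 * q12 + C v 3 * q13" for v
  define g2 where "g2 v = - C v 0 * q02 - C v 1 * q12 + C v 3 * q23" for v
  define g3 where "g3 v = - C v 0 * q03 - C v 1 * q13 - C v 2 * q23" for v
  note g = g0_def g1_def g2_def g3_def
  have fg: "f u v = C u 0 * g0 v + C u 1 * g1 v + C u 2 * g2 v + C u 3 * g3 v" for u v
    by (simp add: f g algebra_simps)
  \<comment> \<open>Each left side is, up to sign, the Pfaffian times a 2 x 2 minor of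
    \<open>y\<close>, \<open>w\<close>. Up to a scalar these are the coordinates of the exterior
    square of the form, contracted with \<open>y\<close> and \<open>w\<close>; the square vanishes
    with the Pfaffian.\<close>
  have minor:
    "g0 y * g1 w - g1 y * g0 w + f w y * q01 = 0"
    "g0 y * g2 w - g2 y * g0 w + f w y * q02 = 0"
    "g0 y * g3 w - g3 y * g0 w + f w y * q03 = 0"
    "g1 y * g2 w - g2 y * g1 w + f w y * q12 = 0"
    "g1 y * g3 w - g3 y * g1 w + f w y * q13 = 0"
    "g2 y * g3 w - g3 y * g2 w + f w y * q23 = 0" for w y
  proof -
    have "g0 y * g1 w - g1 y * g0 w + f w y * q01 = - ((q01 * q23 - q02 * q13 + q03 * q12) * (C y 2 * C w 3 - C y 3 * C w 2))"
      unfolding f g by (simp add: algebra_simps)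
    then show "g0 y * g1 w - g1 y * g0 w + f w y * q01 = 0" using pfaffian by simp
    have "g0 y * g2 w - g2 y * g0 w + f w y * q02 =  ((q01 * q23 - q02 * q13 + q03 * q12) * (C y 1 * C w 3 - C y 3 * C w 1))"
      unfolding f g by (simp add: algebra_simps)
    then show "g0 y * g2 w - g2 y * g0 w + f w y * q02 = 0" using pfaffian by simp
    have "g0 y * g3 w - g3 y * g0 w + f w y * q03 = - ((q01 * q23 - q02 * q13 + q03 * q12) * (C y 1 * C w 2 - C y 2 * C w 1))"
      unfolding f g by (simp add: algebra_simps)
    then show "g0 y * g3 w - g3 y * g0 w + f w y * q03 = 0" using pfaffian by simp
    have "g1 y * g2 w - g2 y * g1 w + f w y * q12 = - ((q01 * q23 - q02 * q13 + q03 * q12) * (C y 0 * C w 3 - C y 3 * C w 0))"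
      unfolding f g by (simp add: algebra_simps)
    then show "g1 y * g2 w - g2 y * g1 w + f w y * q12 = 0" using pfaffian by simp
    have "g1 y * g3 w - g3 y * g1 w + f w y * q13 =  ((q01 * q23 - q02 * q13 + q03 * q12) * (C y 0 * C w 2 - C y 2 * C w 0))"
      unfolding f g by (simp add: algebra_simps)
    then show "g1 y * g3 w - g3 y * g1 w + f w y * q13 = 0" using pfaffian by simp
    have "g2 y * g3 w - g3 y * g2 w + f w y * q23 = - ((q01 * q23 - q02 * q13 + q03 * q12) * (C y 0 * C w 1 - C y 1 * C w 0))"
      unfolding f g by (simp add: algebra_simps)
    then show "g2 y * g3 w - g3 y * g2 w + f w y * q23 = 0" using pfaffian by simp
  qed
  \<comment> \<open>Pairing the six coordinates with the 2 x 2 minors of \<open>x\<close> and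
    \<open>z\<close> reassembles the three-term relation.\<close>
  have "f x y * f z w - f z y * f x w - f w y * f z x
     = (C x 0 * C z 1 - C x 1 * C z 0) * (g0 y * g1 w - g1 y * g0 w + f w y * q01)
     + (C x 0 * C z 2 - C x 2 * C z 0) * (g0 y * g2 w - g2 y * g0 w + f w y * q02)
     + (C x 0 * C z 3 - C x 3 * C z 0) * (g0 y * g3 w - g3 y * g0 w + f w y * q03)
     + (C x 1 * C z 2 - C x 2 * C z 1) * (g1 y * g2 w - g2 y * g1 w + f w y * q12)
     + (C x 1 * C z 3 - C x 3 * C z 1) * (g1 y * g3 w - g3 y * g1 w + f w y * q13)
     + (C x 2 * C z 3 - C x 3 * C z 2) * (g2 y * g3 w - g3 y * g2 w + f w y * q23)" for x y z w
    unfolding fg[of x y] fg[of z w] fg[of z y] fg[of x w] f[of z x]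
    by (simp add: algebra_simps)
  then have "f x y * f z w - f z y * f x w - f w y * f z x = 0" for x y z w
    by (simp only: minor mult_zero_right add_0_left)
  then show ?thesis by (simp add: f_def)
qed

section \<open>The bases of \<open>P\<^sub>8\<close>\<close>

text \<open>Each exchange trades an element outside \<open>J\<close> for one of \<open>J\<close>, so
  \<open>card (I - J)\<close> decreases. It serves for the equicardinality of bases and for walking
  between bases by pivots.\<close>

lemma matroid_basis_exchange_induct [consumes 3, case_names base exchange]:
  assumes M: "is_matroid M" and I: "I \<in> bases M" and J: "J \<in> bases M" and P: "P I"
    and step: "\<And>I x y. I \<in> bases M \<Longrightarrow> P I \<Longrightarrow> x \<in> I - J \<Longrightarrow> y \<in> J - I \<Longrightarrow>
      insert y (I - {x}) \<in> bases M \<Longrightarrow> P (insert y (I - {x}))"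
  shows "P J"
proof -
  have ex: "\<exists>y\<in>B' - B. insert y (B - {x}) \<in> bases M"
    if "B \<in> bases M" "B' \<in> bases M" "x \<in> B - B'" for B B' x
    using M that unfolding is_matroid_def by blast
  have fin: "finite B" if "B \<in> bases M" for B
    using M that unfolding is_matroid_def by (meson PowD finite_subset subsetD)
  show ?thesis
    using I P
  proof (induction "card (I - J)" arbitrary: I)
    case 0
    then have "I \<subseteq> J" using fin by auto
    \<comment> \<open>An element of \<open>J - I\<close> would have to be exchanged for an element
      of \<open>I - J\<close>, which is empty.\<close>
    moreover have "J \<subseteq> I" using ex[OF J "0.prems"(1)] calculation by auto
    ultimately show ?case using 0 by simp
  next
    case (Suc k)
    then obtain x where x: "x \<in> I - J" by (metis card_eq_0_iff equals0I nat.distinct(1))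
    then obtain y where y: "y \<in> J - I" "insert y (I - {x}) \<in> bases M"
      using ex[OF Suc.prems(1) J] by blast
    have "insert y (I - {x}) - J = (I - J) - {x}" using y by auto
    then have "k = card (insert y (I - {x}) - J)" using Suc(2) x fin[OF Suc.prems(1)] by simp
    then show ?case using Suc(1) y step[OF Suc.prems x y] by blast
  qed
qed

lemma matroid_bases_card_eq:
  assumes "is_matroid M" "I \<in> bases M" "J \<in> bases M"
  shows "card I = card J"
proof -
  have "finite I" using assms unfolding is_matroid_def by (meson PowD finite_subset subsetD)
  with assms have "finite J \<and> card J = card I"
  proof (induction rule: matroid_basis_exchange_induct)
    case base
    then show ?case by simp
  next
    case (exchange K x y)
    then have "card (insert y (K - {x})) = card K" using card_Suc_Diff1[of K x] by simp
    then show ?case using exchange by simp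
  qed
  then show ?thesis by simp
qed

lemma matroid_rank_eq:
  assumes "is_matroid M" "I \<in> bases M"
  shows "matroid_rank M = card I"
  unfolding matroid_rank_def using assms matroid_bases_card_eq by blast

text \<open>Integer entries make finite checks executable, and \<open>of_int\<close> carries the
  minors into any commutative ring. Since \<open>A8\<close> is symmetric, its rows can be listed as
  its columns.\<close>

definition p8_column :: "nat \<Rightarrow> nat \<Rightarrow> int" where
  "p8_column z i = [[1,0,0,0], [0,1,0,0], [0,0,1,0], [0,0,0,1],
                    [0,1,1,2], [1,0,1,1], [1,1,0,1], [2,1,1,0]] ! z ! i"

definition p8_matrix :: "rat mat" where
  "p8_matrix = ((1\<^sub>m 4)\<^sup>T @\<^sub>r A8\<^sup>T)\<^sup>T"

lemma p8_matrix_carrier: "p8_matrix \<in> carrier_mat 4 8"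
  by (rule carrier_matI) (simp_all add: p8_matrix_def append_rows_def A8_def mat_of_rows_list_def)

lemma P8_eq: "P8 = column_matroid p8_matrix"
  by (simp add: P8_def p8_matrix_def)

lemma p8_matrix_index:
  assumes "i < 4" "z < 8"
  shows "p8_matrix $$ (i, z) = of_int (p8_column z i)"
proof -
  have "i \<in> {0, 1, 2, 3}" "z \<in> {0, 1, 2, 3, 4, 5, 6, 7}" using assms by auto
  then show ?thesis
    by (auto simp: p8_matrix_def append_rows_def A8_def mat_of_rows_list_def p8_column_def)
qed

text \<open>A nonzero determinant means full rank, and full rank means that the columns are pairwise
  distinct and linearly independent, which for a repetition-free list is independence as a
  family.\<close>

lemma p8_independent_iff:
  assumes Z: "length Z = 4" "set Z \<subseteq> {..<8}" "distinct Z"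
  shows "independent_columns p8_matrix (set Z) \<longleftrightarrow> tuple_det p8_column Z \<noteq> 0"
proof -
  interpret vec_space "TYPE(rat)" 4 .
  let ?A = "mat_of_cols 4 (map (col p8_matrix) Z)"
  have A: "?A \<in> carrier_mat 4 4" using Z by (simp add: mat_of_cols_def)
  have cols: "cols ?A = map (col p8_matrix) Z"
    using col_carrier_vec p8_matrix_carrier Z(2) by (intro cols_mat_of_cols) auto
  have "?A = map_mat of_int (mat 4 4 (\<lambda>(i, j). p8_column (Z ! j) i))"
    by (rule eq_matI)
      (use Z p8_matrix_carrier in \<open>auto simp: mat_of_cols_def p8_matrix_index subset_iff\<close>)
  then have "det ?A = of_int (tuple_det p8_column Z)"
    by (simp add: tuple_det_def Z(1))
  then have "tuple_det p8_column Z \<noteq> 0 \<longleftrightarrow> rank ?A = 4"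
    using det_rank_iff[OF A] by simp
  also have "\<dots> \<longleftrightarrow> distinct (cols ?A) \<and> lin_indpt (set (cols ?A))"
    using non_distinct_low_rank[OF A] full_rank_lin_indpt[OF A] lin_indpt_full_rank[OF A]
    by (metis less_irrefl)
  also have "\<dots> \<longleftrightarrow> independent_columns p8_matrix (set Z)"
    using p8_matrix_carrier Z(3) by (simp add: independent_columns_def cols distinct_map)
  finally show ?thesis by simp
qed

lemma p8_independent_card:
  assumes "independent_columns p8_matrix X" "X \<subseteq> {..<8}"
  shows "card X \<le> 4"
proof -
  interpret vec_space "TYPE(rat)" 4 .
  have "card (col p8_matrix ` X) \<le> dim"
    using assms p8_matrix_carrier finite_subset[OF assms(2)]
    by (intro li_le_dim(2)) (auto simp: independent_columns_def)
  then show ?thesis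
    using assms by (simp add: independent_columns_def card_image dim_is_n)
qed

lemma p8_basisI:
  assumes Z: "length Z = 4" "set Z \<subseteq> {..<8}" and nz: "tuple_det p8_column Z \<noteq> 0"
  shows "set Z \<in> bases P8"
proof -
  have d: "distinct Z" using tuple_det_not_distinct nz by blast
  then have ind: "independent_columns p8_matrix (set Z)" using p8_independent_iff Z nz by blast
  have "Y = set Z" if "Y \<subseteq> {..<8}" "independent_columns p8_matrix Y" "set Z \<subseteq> Y" for Y
  proof -
    have "card (set Z) = 4" using d Z(1) by (simp add: distinct_card)
    then show ?thesis
      using card_seteq[of Y "set Z"] that p8_independent_card[OF that(2,1)] finite_subset[OF that(1)]
      by simp
  qed
  then show ?thesis
    using Z ind p8_matrix_carrier by (simp add: P8_eq column_matroid_def)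
qed

lemma p8_standard_basis: "{0, 1, 2, 3} \<in> bases P8"
  using p8_basisI[of "[0, 1, 2, 3]"] by (simp add: tuple_det_4 p8_column_def)

lemma p8_rank: "matroid_rank P8 = 4"
  using matroid_rank_eq[OF is_matroid_P8 p8_standard_basis] by simp

lemma tuples_P8: "tuples P8 = {Z. length Z = 4 \<and> set Z \<subseteq> {..<8}}"
  by (simp add: tuples_def p8_rank ground_P8)

text \<open>Bases and nonbases can henceforth be recognised by computing an integer
  determinant.\<close>

lemma p8_basis_iff:
  assumes "Z \<in> tuples P8"
  shows "set Z \<in> bases P8 \<longleftrightarrow> tuple_det p8_column Z \<noteq> 0"
proof
  assume b: "set Z \<in> bases P8"
  have Z: "length Z = 4" "set Z \<subseteq> {..<8}" using assms by (auto simp: tuples_P8)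
  \<comment> \<open>A basis has 4 elements, so a tuple running through it has no repetition.\<close>
  have "card (set Z) = 4" using matroid_rank_eq[OF is_matroid_P8 b] p8_rank by simp
  then have "distinct Z" using Z by (simp add: card_distinct)
  moreover have "independent_columns p8_matrix (set Z)"
    using b by (simp add: P8_eq column_matroid_def)
  ultimately show "tuple_det p8_column Z \<noteq> 0" using p8_independent_iff Z by blast
qed (use assms p8_basisI in \<open>auto simp: tuples_P8\<close>)

section \<open>Brackets as minors\<close>

text \<open>The generators of the bracket ideal, imposed on values in a type of class
  \<open>comm_ring_1\<close>. The fourth family appears as invertibility, so no inverse has to be
  named.\<close>

locale bracket_evaluation =
  fixes M :: "'a matroid" and b :: "'a list \<Rightarrow> 'r::comm_ring_1"
  assumes matroid: "is_matroid M"
    and nonbasis: "Z \<in> tuples M \<Longrightarrow> set Z \<notin> bases M \<Longrightarrow> b Z = 0"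
    and alternating: "Z \<in> tuples M \<Longrightarrow> \<sigma> permutes {..<matroid_rank M} \<Longrightarrow>
      b Z = of_int (sign \<sigma>) * b (permute_list \<sigma> Z)"
    and three_term: "{x1, x2, y1, y2} \<subseteq> ground M \<Longrightarrow> set W \<subseteq> ground M \<Longrightarrow>
      length W + 2 = matroid_rank M \<Longrightarrow>
      b (x1 # x2 # W) * b (y1 # y2 # W) - b (y1 # x2 # W) * b (x1 # y2 # W)
        - b (y2 # x2 # W) * b (y1 # x1 # W) = 0"
    and basis_unit: "Z \<in> basis_tuples M \<Longrightarrow> b Z dvd 1"
begin

lemma permute_tuple:
  assumes "Z \<in> tuples M" "\<sigma> permutes {..<matroid_rank M}"
  shows "permute_list \<sigma> Z \<in> tuples M" "b (permute_list \<sigma> Z) = of_int (sign \<sigma>) * b Z"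
proof -
  show "permute_list \<sigma> Z \<in> tuples M" using assms by (auto simp: tuples_def)
  have "of_int (sign \<sigma>) * (of_int (sign \<sigma>) * x) = x" for x :: 'r
    by (simp flip: mult.assoc of_int_mult)
  then show "b (permute_list \<sigma> Z) = of_int (sign \<sigma>) * b Z"
    using alternating[OF assms] by simp
qed

lemma basis_tuple_distinct:
  assumes "Z \<in> basis_tuples M"
  shows "distinct Z"
  using assms matroid_rank_eq[OF matroid, of "set Z"]
  by (simp add: basis_tuples_def tuples_def card_distinct)

lemma not_distinct_zero:
  assumes "Z \<in> tuples M" "\<not> distinct Z"
  shows "b Z = 0"
  using assms nonbasis basis_tuple_distinct unfolding basis_tuples_def by blast

end

text \<open>Two independent columns, which span a coline in rank 4, are completed to a basis by unit
  vectors; all pairs are checked by computation.\<close>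

lemma p8_coline_basis:
  assumes "w < 8" "w' < 8" "w \<noteq> w'"
  shows "\<exists>x1<4. \<exists>x2<4. tuple_det p8_column [x1, x2, w, w'] \<noteq> 0"
proof -
  have "\<forall>w\<in>set [0..<8]. \<forall>w'\<in>set [0..<8]. w \<noteq> w' \<longrightarrow> (\<exists>x1\<in>set [0..<4]. \<exists>x2\<in>set [0..<4].
      tuple_det p8_column [x1, x2, w, w'] \<noteq> 0)"
    unfolding tuple_det_4 by code_simp
  then have "\<exists>x1\<in>set [0..<4]. \<exists>x2\<in>set [0..<4]. tuple_det p8_column [x1, x2, w, w'] \<noteq> 0"
    using assms by simp
  then obtain x1 x2 where "x1 < 4" "x2 < 4" "tuple_det p8_column [x1, x2, w, w'] \<noteq> 0"
    by (auto simp only: set_upt atLeastLessThan_iff)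
  then show ?thesis by blast
qed

lemma dvd_1_cancel:
  fixes a :: "'r::comm_ring_1"
  assumes "a dvd 1" "a * x = a * y"
  shows "x = y"
proof -
  obtain a' where "1 = a * a'" using assms(1) by (rule dvdE)
  then have "z = a' * (a * z)" for z by (metis mult.assoc mult.commute mult_1_left)
  then show ?thesis using assms(2) by metis
qed

section \<open>All brackets as minors of the standard bracket matrix\<close>

locale p8_bracket_evaluation = bracket_evaluation P8 b for b :: "nat list \<Rightarrow> 'r::comm_ring_1"
begin

definition "b0 = b [0, 1, 2, 3]"

definition "b0_inv = (SOME y. b0 * y = 1)"

lemma b0_inv: "b0 * b0_inv = 1"
proof -
  have "b0 dvd 1"
    using basis_unit[of "[0,1,2,3]"] p8_standard_basis
    by (simp add: b0_def basis_tuples_def tuples_P8)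
  then have "\<exists>y. b0 * y = 1" by (metis dvd_def)
  then show ?thesis unfolding b0_inv_def by (rule someI_ex)
qed

text \<open>The bracket matrix of the standard basis B with an identity block in front: the quotient
  [B/u -> z] / [B] is formed for \<open>z\<close> in B as well, where it yields unit
  vectors.\<close>

definition column :: "nat \<Rightarrow> nat \<Rightarrow> 'r" where
  "column z u = b0_inv * b (map (\<lambda>w. if w = u then z else w) [0, 1, 2, 3])"

definition represented :: "nat list \<Rightarrow> bool" where
  "represented Z \<longleftrightarrow> b Z = b0 * tuple_det column Z"

text \<open>Both sides are alternating, so reordering multiplies them by the same sign. Later
  arguments may therefore order the entries as they like.\<close>

lemma represented_mset:
  assumes "represented Z" "Z \<in> tuples P8" "mset Y = mset Z"
  shows "represented Y"
proof -
  obtain \<sigma> where \<sigma>: "\<sigma> permutes {..<length Z}" "permute_list \<sigma> Z = Y"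
    using mset_eq_permutation[OF assms(3)] by blast
  then show ?thesis
    using permute_tuple(2)[OF assms(2), of \<sigma>] tuple_det_permute[OF \<sigma>(1), of column] assms(1,2)
    by (simp add: represented_def tuples_P8 p8_rank)
qed

lemma represented_not_distinct:
  assumes "Z \<in> tuples P8" "\<not> distinct Z"
  shows "represented Z"
  using not_distinct_zero[OF assms] tuple_det_not_distinct[OF assms(2), of column]
  by (simp add: represented_def)

lemma column_unit:
  assumes "z < 4" "u < 4"
  shows "column z u = (if z = u then 1 else 0)"
proof (cases "z = u")
  case True
  then have "map (\<lambda>w. if w = u then z else w) [0, 1, 2, 3] = [0, 1, 2, 3]"
    by (intro map_idI) simp
  then show ?thesis
    using True b0_inv mult.commute[of b0 b0_inv] by (simp only: column_def b0_def[symmetric] if_True simp_thms)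
next
  case False
  let ?Z = "map (\<lambda>w. if w = u then z else w) [0, 1, 2, 3]"
  have "\<not> inj_on (\<lambda>w. if w = u then z else w) {..<4}"
    using assms False by (intro notI) (drule inj_onD[of _ _ u z], simp_all)
  moreover have "{..<4::nat} = set [0, 1, 2, 3]" by auto
  ultimately have "\<not> distinct ?Z" by (simp only: distinct_map not_False_eq_True simp_thms)
  moreover have "?Z \<in> tuples P8" using assms by (simp add: tuples_P8)
  ultimately have "b ?Z = 0" by (intro not_distinct_zero)
  then show ?thesis using False by (simp only: column_def mult_zero_right if_False)
qed

text \<open>If the last three entries are distinct, one element \<open>u\<close> of the standard
  basis is missing. Up to order the tuple is the standard basis with \<open>u\<close> replaced by
  \<open>y\<close>; there the claim is the definition of \<open>column y u\<close>, because three
  unit columns reduce the determinant to that entry. With a repetition both sides vanish.\<close>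

lemma represented_one:
  assumes "y < 8" "x2 < 4" "x3 < 4" "x4 < 4"
  shows "represented [y, x2, x3, x4]"
proof (cases "distinct [x2, x3, x4]")
  case True
  obtain u where u: "u < 4" "u \<notin> {x2, x3, x4}"
  proof -
    have "card {..<4::nat} \<le> card {x2, x3, x4}" if "{..<4} \<subseteq> {x2, x3, x4}"
      by (rule card_mono[OF _ that]) simp
    then have "\<not> {..<4} \<subseteq> {x2, x3, x4}" using True by auto
    then show ?thesis using that by blast
  qed
  let ?Z = "map (\<lambda>w. if w = u then y else w) [0, 1, 2, 3]"
  have "u \<in> {0, 1, 2, 3}" using u by auto
  then have "column y u = tuple_det column ?Z"
    by (elim insertE emptyE) (simp_all add: tuple_det_4 column_unit)
  then have "b0 * tuple_det column ?Z = b0 * b0_inv * b ?Z"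
    by (simp only: column_def mult.assoc)
  then have 1: "represented ?Z" by (simp only: represented_def b0_inv mult_1)
  have d: "distinct [u, x2, x3, x4]" using True u(2) by simp
  have "set [u, x2, x3, x4] \<subseteq> {..<4}" using assms u(1) by simp
  then have "set [u, x2, x3, x4] = {..<4}"
    using distinct_card[OF d] by (intro card_subset_eq) simp_all
  also have "\<dots> = set [0, 1, 2, 3]" by auto
  finally have "mset [u, x2, x3, x4] = mset [0, 1, 2, 3]"
    by (subst (asm) set_eq_iff_mset_eq_distinct[OF d]) simp_all
  then have "mset (map (\<lambda>w. if w = u then y else w) [u, x2, x3, x4]) = mset ?Z"
    by (simp only: mset_map)
  moreover have "map (\<lambda>w. if w = u then y else w) [u, x2, x3, x4] = [y, x2, x3, x4]"
    using u(2) by simp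
  ultimately have 2: "mset [y, x2, x3, x4] = mset ?Z" by (simp only:)
  have "?Z \<in> tuples P8" using assms by (simp add: tuples_P8)
  then show ?thesis by (rule represented_mset[OF 1 _ 2])
next
  case False
  then show ?thesis using assms by (intro represented_not_distinct) (auto simp: tuples_P8)
qed

text \<open>Every bracket of the three-term relation other than that of \<open>y1\<close>,
  \<open>y2\<close> has an entry below 4 in its first two places, so \<open>rep\<close> applies
  after reordering. Determinants obey the same relation, and \<open>x1\<close>, \<open>x2\<close>
  are chosen to make the factor to be cancelled a unit.\<close>

lemma represented_step:
  assumes w: "w < 8" "w' < 8"
    and rep: "\<And>y x. y < 8 \<Longrightarrow> x < 4 \<Longrightarrow> represented [y, x, w, w']"
    and y: "y1 < 8" "y2 < 8"
  shows "represented [y1, y2, w, w']"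
proof (cases "w = w'")
  case True
  then show ?thesis using assms by (intro represented_not_distinct) (auto simp: tuples_P8)
next
  case False
  then obtain x1 x2 where x: "x1 < 4" "x2 < 4" "tuple_det p8_column [x1, x2, w, w'] \<noteq> 0"
    using p8_coline_basis w by blast
  define d where "d p q = tuple_det column [p, q, w, w']" for p q
  have rep': "b [y, x, w, w'] = b0 * d y x" "b [x, y, w, w'] = b0 * d x y"
    if "y < 8" "x < 4" for x y
    using rep[OF that] represented_mset[OF rep[OF that], of "[x, y, w, w']"] that w
    by (auto simp: represented_def d_def tuples_P8 add_mset_commute)
  have "b [x1, x2, w, w'] dvd 1"
    using x w p8_basis_iff[of "[x1, x2, w, w']"]
    by (intro basis_unit) (auto simp: basis_tuples_def tuples_P8)
  moreover have "b [x1, x2, w, w'] * b [y1, y2, w, w'] = b [x1, x2, w, w'] * (b0 * d y1 y2)"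
  proof -
    have "b [x1, x2, w, w'] * b [y1, y2, w, w'] = b [y1, x2, w, w'] * b [x1, y2, w, w']
        + b [y2, x2, w, w'] * b [y1, x1, w, w']"
      using three_term[of x1 x2 y1 y2 "[w, w']"] x y w
      by (simp add: ground_P8 p8_rank algebra_simps)
    also have "\<dots> = b0 * b0 * (d y1 x2 * d x1 y2 + d y2 x2 * d y1 x1)"
      using x y by (simp add: rep' algebra_simps)
    also have "d y1 x2 * d x1 y2 + d y2 x2 * d y1 x1 = d x1 x2 * d y1 y2"
      using pluecker_relation[of column x1 x2 w w' y1 y2] by (simp add: d_def algebra_simps)
    also have "b0 * b0 * (d x1 x2 * d y1 y2) = b [x1, x2, w, w'] * (b0 * d y1 y2)"
      using x by (simp add: rep' ac_simps)
    finally show ?thesis .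
  qed
  ultimately show ?thesis unfolding represented_def d_def by (rule dvd_1_cancel)
qed

text \<open>Each use of \<open>represented_step\<close> frees one more entry from the standard
  basis; reordering first brings an entry still below 4 into the second place.\<close>

lemma represented_tuple:
  assumes "Z \<in> tuples P8"
  shows "represented Z"
proof -
  have 2: "represented [y1, y2, x3, x4]" if "y1 < 8" "y2 < 8" "x3 < 4" "x4 < 4" for y1 y2 x3 x4
    by (rule represented_step[OF _ _ represented_one]) (use that in simp_all)
  have 3: "represented [y1, y2, y3, x4]" if y: "y1 < 8" "y2 < 8" "y3 < 8" "x4 < 4" for y1 y2 y3 x4
  proof (rule represented_step[OF _ _ _ y(1,2)])
    fix y x assume "y < (8::nat)" "x < (4::nat)"
    then show "represented [y, x, y3, x4]"
      using y(3,4) by (intro represented_mset[OF 2[of y y3 x x4]]) (simp_all add: tuples_P8)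
  qed (use y in simp_all)
  have 4: "represented [y1, y2, y3, y4]" if y: "y1 < 8" "y2 < 8" "y3 < 8" "y4 < 8" for y1 y2 y3 y4
  proof (rule represented_step[OF _ _ _ y(1,2)])
    fix y x assume "y < (8::nat)" "x < (4::nat)"
    then show "represented [y, x, y3, y4]"
      using y(3,4) by (intro represented_mset[OF 3[of y y3 y4 x]])
        (simp_all add: tuples_P8 add_mset_commute)
  qed (use y in simp_all)
  have "length Z = Suc (Suc (Suc (Suc 0)))" using assms by (simp add: tuples_P8)
  then obtain y1 y2 y3 y4 where "Z = [y1, y2, y3, y4]" by (auto simp: length_Suc_conv)
  then show ?thesis using 4[of y1 y2 y3 y4] assms by (simp add: tuples_P8)
qed

end

section \<open>Uniqueness of the representation up to scaling\<close>

lemma dvd_1_mult: "a dvd 1 \<Longrightarrow> b dvd 1 \<Longrightarrow> a * b dvd (1 :: 'r::comm_ring_1)"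
  using mult_dvd_mono[of a 1 b 1] by simp

lemma dvd_1_factor:
  fixes u :: "'r::comm_ring_1"
  assumes "u dvd 1"
  obtains q where "z = u * q"
proof -
  have "u dvd z" using assms one_dvd dvd_trans by blast
  then show thesis using that by (auto elim: dvdE)
qed

text \<open>Scaling rows and columns makes all entries those of \<open>A8\<close> except for one parameter \<open>x\<close>,
  which the last relation forces to satisfy \<open>2 (1 + x) = (1 + x)\<^sup>2\<close>.\<close>

lemma A8_scaling:
  fixes a b c d e f g h i j k l :: "'r::comm_ring_1"
  assumes units: "a dvd 1" "b dvd 1" "c dvd 1" "d dvd 1" "e dvd 1" "f dvd 1" "h dvd 1" "k dvd 1"
    and E1: "d * i = f * g" and E2: "a * l = b * k" and E3: "a * e * i + b * f * h = c * e * h"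
    and E4: "d * h * l + e * g * k = e * h * j" and E5: "b * f * j + c * d * l = c * e * j"
  obtains r1 r2 r3 s4 s5 s6 s7 where
    "r1 dvd 1" "r2 dvd 1" "r3 dvd 1"
    "a = s5" "b = s6" "c = s7 * 2"
    "d = r1 * s4" "e = r1 * s6" "f = r1 * s7"
    "g = r2 * s4" "h = r2 * s5" "i = r2 * s7"
    "j = r3 * s4 * 2" "k = r3 * s5" "l = r3 * s6"
proof -
  \<comment> \<open>The letters are the nonzero entries of the matrix with rows (0,a,b,c),
    (d,0,e,f), (g,h,0,i), (j,k,l,0), which has the zero pattern of \<open>A8\<close>. The first row
    gets weight 1; the entries \<open>a\<close>, \<open>b\<close>, \<open>e\<close>,
    \<open>h\<close>, \<open>k\<close>, \<open>d\<close>, \<open>f\<close> along a spanning tree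
    then fix all other weights.\<close>
  obtain r1 where e: "e = b * r1" using units(2) by (rule dvd_1_factor)
  obtain r2 where h: "h = a * r2" using units(1) by (rule dvd_1_factor)
  obtain r3 where k: "k = a * r3" using units(1) by (rule dvd_1_factor)
  have r: "r1 dvd 1" "r2 dvd 1" "r3 dvd 1"
    using units(5,7,8) unfolding e h k by (metis dvd_mult_right)+
  obtain s4 where d: "d = r1 * s4" using r(1) by (rule dvd_1_factor)
  obtain s7 where f: "f = r1 * s7" using r(1) by (rule dvd_1_factor)
  have s: "s4 dvd 1" "s7 dvd 1" using units(4,6) unfolding d f by (metis dvd_mult_right)+
  \<comment> \<open>\<open>x\<close> is what remains of \<open>g\<close> once the weights are fixed.
    \<open>E1\<close> to \<open>E4\<close> express the entries \<open>i\<close>, \<open>l\<close>,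
    \<open>c\<close>, \<open>j\<close> by it.\<close>
  obtain x where g: "g = r2 * s4 * x" using dvd_1_mult[OF r(2) s(1)] by (rule dvd_1_factor)
  have i: "i = r2 * s7 * x"
    by (rule dvd_1_cancel[of "r1 * s4"])
      (use E1 r s in \<open>auto intro: dvd_1_mult simp: d f g ac_simps\<close>)
  have l: "l = r3 * b"
    by (rule dvd_1_cancel[OF units(1)]) (use E2 in \<open>simp add: k ac_simps\<close>)
  have c: "c = s7 * (1 + x)"
  proof (rule dvd_1_cancel[of "a * b * r1 * r2"])
    show "a * b * r1 * r2 dvd 1" using units r by (auto intro: dvd_1_mult)
    show "a * b * r1 * r2 * c = a * b * r1 * r2 * (s7 * (1 + x))"
      using E3 unfolding e f h i by (simp add: algebra_simps)
  qed
  have j: "j = r3 * s4 * (1 + x)"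
  proof (rule dvd_1_cancel[of "a * b * r1 * r2"])
    show "a * b * r1 * r2 dvd 1" using units r by (auto intro: dvd_1_mult)
    show "a * b * r1 * r2 * j = a * b * r1 * r2 * (r3 * s4 * (1 + x))"
      using E4 unfolding d e g h k l by (simp add: algebra_simps)
  qed
  \<comment> \<open>In \<open>E5\<close> a factor 1 + x can be cancelled because it divides the unit
    \<open>c\<close>.\<close>
  have "2 = 1 + x"
  proof (rule dvd_1_cancel[of "b * r1 * s7 * r3 * s4 * (1 + x)"])
    have "1 + x dvd 1" using units(3) unfolding c by (metis dvd_mult_right)
    then show "b * r1 * s7 * r3 * s4 * (1 + x) dvd 1"
      using units r s by (auto intro: dvd_1_mult)
    have "b * r1 * s7 * r3 * s4 * (1 + x) * 2 = b * f * j + c * d * l"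
      unfolding c d f j l by (simp add: algebra_simps)
    also have "\<dots> = b * r1 * s7 * r3 * s4 * (1 + x) * (1 + x)"
      unfolding E5 unfolding c e j by (simp add: algebra_simps)
    finally show "b * r1 * s7 * r3 * s4 * (1 + x) * 2 = b * r1 * s7 * r3 * s4 * (1 + x) * (1 + x)" .
  qed
  then have x: "x = 1" by (metis add_left_cancel one_add_one)
  show thesis
    by (rule that[of r1 r2 r3 a b s7 s4]) (use r in \<open>simp_all add: c d e f g h i j k l x ac_simps\<close>)
qed

lemma tuple_det_scaled:
  assumes "\<And>z i. z \<in> {x1, x2, x3, x4} \<Longrightarrow> i < 4 \<Longrightarrow> C z i = r i * t z * of_int (D z i)"
  shows "tuple_det C [x1, x2, x3, x4] =
    r 0 * r 1 * r 2 * r 3 * (t x1 * t x2 * t x3 * t x4) * of_int (tuple_det D [x1, x2, x3, x4])"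
  unfolding tuple_det_4 by (simp add: assms) (simp add: algebra_simps)

context p8_bracket_evaluation
begin

text \<open>The integer minor of the standard basis with one element replaced is a single entry of
  \<open>[I A8]\<close>, and it decides whether the replaced tuple is a basis.\<close>

lemma column_entry:
  assumes "z < 8" "u < 4"
  shows "p8_column z u \<noteq> 0 \<Longrightarrow> column z u dvd 1" "p8_column z u = 0 \<Longrightarrow> column z u = 0"
proof -
  let ?Z = "map (\<lambda>w. if w = u then z else w) [0, 1, 2, 3]"
  have Z: "?Z \<in> tuples P8" using assms by (simp add: tuples_P8)
  have "u \<in> {0, 1, 2, 3}" using assms by auto
  then have "tuple_det p8_column ?Z = p8_column z u"
    by (elim insertE emptyE) (simp_all add: tuple_det_4 p8_column_def)
  then have iff: "p8_column z u \<noteq> 0 \<longleftrightarrow> set ?Z \<in> bases P8" using p8_basis_iff[OF Z] by metis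
  show "p8_column z u = 0 \<Longrightarrow> column z u = 0"
    using iff nonbasis[OF Z] by (simp only: column_def mult_zero_right simp_thms)
  assume "p8_column z u \<noteq> 0"
  then have "b ?Z dvd 1" using iff Z by (intro basis_unit) (simp add: basis_tuples_def)
  moreover have "b0_inv dvd 1" using b0_inv by (metis dvd_triv_right)
  ultimately show "column z u dvd 1" unfolding column_def by (intro dvd_1_mult)
qed

lemma column_minor_zero:
  assumes "Z \<in> tuples P8" "tuple_det p8_column Z = 0"
  shows "tuple_det column Z = 0"
proof -
  have "b0 * tuple_det column Z = b0 * 0"
    using represented_tuple[OF assms(1)] p8_basis_iff[OF assms(1)] nonbasis[OF assms(1)] assms(2)
    by (simp add: represented_def)
  moreover have "b0 dvd 1" using b0_inv by (metis dvd_triv_left)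
  ultimately show ?thesis using dvd_1_cancel by blast
qed

lemma column_scaled:
  obtains r t where "\<And>z i. z < 8 \<Longrightarrow> i < 4 \<Longrightarrow> column z i = r i * t z * of_int (p8_column z i)"
proof -
  have unit: "column z i dvd 1" if "z < 8" "i < 4" "p8_column z i \<noteq> 0" for z i
    using column_entry(1) that by blast
  \<comment> \<open>The diagonal of \<open>A8\<close>.\<close>
  have zero: "column 4 0 = 0" "column 5 1 = 0" "column 6 2 = 0" "column 7 3 = 0"
    by (rule column_entry(2); simp add: p8_column_def)+
  \<comment> \<open>Five nonbases, in the order of \<open>E1\<close> to \<open>E5\<close> in
    \<open>A8_scaling\<close>. Unit columns reduce the first two to 2 x 2 minors and the other three
    to 3 x 3 minors of the non-identity block.\<close>
  have minors: "tuple_det column [0, 3, 4, 7] = 0" "tuple_det column [1, 2, 5, 6] = 0"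
    "tuple_det column [3, 5, 6, 7] = 0" "tuple_det column [0, 4, 5, 6] = 0"
    "tuple_det column [2, 4, 6, 7] = 0"
    by (rule column_minor_zero; simp add: tuples_P8 tuple_det_4 p8_column_def)+
  note expand = tuple_det_4 column_unit zero[simplified]
  obtain r1 r2 r3 s4 s5 s6 s7 where r: "r1 dvd 1" "r2 dvd 1" "r3 dvd 1"
    and eq: "column 5 0 = s5" "column 6 0 = s6" "column 7 0 = s7 * 2"
    "column 4 1 = r1 * s4" "column 6 1 = r1 * s6" "column 7 1 = r1 * s7"
    "column 4 2 = r2 * s4" "column 5 2 = r2 * s5" "column 7 2 = r2 * s7"
    "column 4 3 = r3 * s4 * 2" "column 5 3 = r3 * s5" "column 6 3 = r3 * s6"
  proof (rule A8_scaling[of "column 5 0" "column 6 0" "column 7 0" "column 4 1" "column 6 1"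
        "column 7 1" "column 5 2" "column 5 3" "column 7 2" "column 4 2" "column 6 3" "column 4 3"])
    show "column 4 1 * column 7 2 = column 7 1 * column 4 2"
      using minors(1) by (simp add: expand algebra_simps)
    show "column 5 0 * column 6 3 = column 6 0 * column 5 3"
      using minors(2) by (simp add: expand algebra_simps)
    show "column 5 0 * column 6 1 * column 7 2 + column 6 0 * column 7 1 * column 5 2
        = column 7 0 * column 6 1 * column 5 2"
      using minors(3) by (simp add: expand algebra_simps)
    show "column 4 1 * column 5 2 * column 6 3 + column 6 1 * column 4 2 * column 5 3
        = column 6 1 * column 5 2 * column 4 3"
      using minors(4) by (simp add: expand algebra_simps)
    show "column 6 0 * column 7 1 * column 4 3 + column 7 0 * column 4 1 * column 6 3
        = column 7 0 * column 6 1 * column 4 3"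
      using minors(5) by (simp add: expand algebra_simps)
  qed (rule unit; simp add: p8_column_def)+
  \<comment> \<open>On the unit columns the row weights are compensated by inverse column
    weights.\<close>
  obtain t1 t2 t3 where t: "1 = r1 * t1" "1 = r2 * t2" "1 = r3 * t3"
    using r by (elim dvdE)
  show thesis
  proof (rule that[of "\<lambda>i. [1, r1, r2, r3] ! i" "\<lambda>z. [1, t1, t2, t3, s4, s5, s6, s7] ! z"])
    fix z i :: nat assume "z < 8" "i < 4"
    then have "z \<in> {0, 1, 2, 3, 4, 5, 6, 7}" "i \<in> {0, 1, 2, 3}" by auto
    then show "column z i = [1, r1, r2, r3] ! i * [1, t1, t2, t3, s4, s5, s6, s7] ! z
        * of_int (p8_column z i)"
      by (elim insertE emptyE)
        (simp_all add: p8_column_def column_unit zero[simplified] eq[simplified] t[symmetric])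
  qed
qed

lemma bracket_eq_scaled_det:
  obtains c t where "\<And>x1 x2 x3 x4. {x1, x2, x3, x4} \<subseteq> {..<8} \<Longrightarrow>
    b [x1, x2, x3, x4] = c * (t x1 * t x2 * t x3 * t x4) * of_int (tuple_det p8_column [x1, x2, x3, x4])"
proof -
  obtain r t where rt: "\<And>z i. z < 8 \<Longrightarrow> i < 4 \<Longrightarrow> column z i = r i * t z * of_int (p8_column z i)"
    using column_scaled by blast
  show thesis
  proof (rule that[of "b0 * (r 0 * r 1 * r 2 * r 3)" t])
    fix x1 x2 x3 x4 :: nat assume x: "{x1, x2, x3, x4} \<subseteq> {..<8}"
    then have "tuple_det column [x1, x2, x3, x4] = r 0 * r 1 * r 2 * r 3 *
        (t x1 * t x2 * t x3 * t x4) * of_int (tuple_det p8_column [x1, x2, x3, x4])"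
      by (intro tuple_det_scaled) (auto intro!: rt)
    moreover have "[x1, x2, x3, x4] \<in> tuples P8" using x by (simp add: tuples_P8)
    ultimately show "b [x1, x2, x3, x4] = b0 * (r 0 * r 1 * r 2 * r 3) * (t x1 * t x2 * t x3 * t x4)
        * of_int (tuple_det p8_column [x1, x2, x3, x4])"
      using represented_tuple by (simp add: represented_def mult.assoc)
  qed
qed

lemma two_unit: "(2 :: 'r) dvd 1"
proof -
  obtain c t where "\<And>x1 x2 x3 x4. {x1, x2, x3, x4} \<subseteq> {..<8} \<Longrightarrow>
    b [x1, x2, x3, x4] = c * (t x1 * t x2 * t x3 * t x4) * of_int (tuple_det p8_column [x1, x2, x3, x4])"
    using bracket_eq_scaled_det by blast
  \<comment> \<open>The elements 0, 1, 2, 4 form a basis whose minor is the entry 2 of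
    \<open>A8\<close>, so 2 divides a unit.\<close>
  from this[of 0 1 2 4] have
    "b [0, 1, 2, 4] = c * (t 0 * t 1 * t 2 * t 4) * of_int (tuple_det p8_column [0, 1, 2, 4])" by simp
  moreover have "tuple_det p8_column [0, 1, 2, 4] = 2" by (simp add: tuple_det_4 p8_column_def)
  moreover have "b [0, 1, 2, 4] dvd 1"
    using calculation(2) p8_basis_iff[of "[0, 1, 2, 4]"]
    by (intro basis_unit) (simp add: basis_tuples_def tuples_P8)
  ultimately show ?thesis by (metis dvd_mult_right of_int_numeral)
qed

end

section \<open>Scaled bracket matrices and cross ratios\<close>

text \<open>Computed for the 70 increasing tuples; sorting a tuple costs at most a sign. The absence
  of odd prime factors is what keeps all cross ratios dyadic.\<close>

lemma tuple_det_p8_values: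
  assumes "Z \<in> tuples P8"
  shows "tuple_det p8_column Z \<in> {0, 1, -1, 2, -2, 4, -4}"
proof (cases "distinct Z")
  case True
  have "\<forall>w\<in>set [0..<8]. \<forall>x\<in>set [Suc w..<8]. \<forall>y\<in>set [Suc x..<8]. \<forall>z\<in>set [Suc y..<8].
      tuple_det p8_column [w, x, y, z] \<in> {0, 1, -1, 2, -2, 4, -4}"
    unfolding tuple_det_4 by code_simp
  then have vals: "tuple_det p8_column [w, x, y, z] \<in> {0, 1, -1, 2, -2, 4, -4}"
    if "w < x" "x < y" "y < z" "z < 8" for w x y z
    using that by (simp add: Ball_def)
  obtain w x y z where sZ: "sort Z = [w, x, y, z]"
  proof -
    define L where "L = sort Z"
    have "length L = Suc (Suc (Suc (Suc 0)))" using assms by (simp add: tuples_P8 L_def)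
    then show thesis using that unfolding L_def[symmetric] by (auto simp: length_Suc_conv)
  qed
  have "sorted_wrt (<) (sort Z)" using True by (simp add: strict_sorted_iff)
  moreover have "set (sort Z) \<subseteq> {..<8}" using assms by (simp add: tuples_P8)
  ultimately have "tuple_det p8_column (sort Z) \<in> {0, 1, -1, 2, -2, 4, -4}"
    unfolding sZ by (intro vals) simp_all
  moreover obtain \<sigma> where "\<sigma> permutes {..<length Z}" "permute_list \<sigma> Z = sort Z"
    using mset_eq_permutation[of "sort Z" Z] by auto
  then have "tuple_det p8_column (sort Z) = sign \<sigma> * tuple_det p8_column Z"
    using tuple_det_permute[of \<sigma> Z p8_column] by simp
  ultimately show ?thesis by (cases \<sigma> rule: sign_cases) auto
next
  case False
  then show ?thesis by (simp add: tuple_det_not_distinct)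
qed

text \<open>Denominators are cleared, so that the set makes sense without an inverse of 2. Where 2
  is a unit, it consists of the elements +-2^k for all integers k.\<close>

definition dyadic_units :: "'r::comm_ring_1 set" where
  "dyadic_units = {x. \<exists>m n. x * 2 ^ n = 2 ^ m \<or> x * 2 ^ n = - (2 ^ m)}"

abbreviation replace :: "'a \<Rightarrow> 'a \<Rightarrow> 'a list \<Rightarrow> 'a list" where
  "replace u v B \<equiv> map (\<lambda>w. if w = u then v else w) B"

section \<open>Exchange relations between bases\<close>

context bracket_evaluation
begin

lemma b_swap:
  assumes "x # y # W \<in> tuples M"
  shows "b (y # x # W) = - b (x # y # W)"
proof -
  let ?\<sigma> = "transpose 0 (1::nat)"
  have len: "length (x # y # W) = matroid_rank M" using assms by (simp add: tuples_def)
  then have p: "?\<sigma> permutes {..<matroid_rank M}" by (intro permutes_swap_id) auto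
  have p': "?\<sigma> permutes {..<length (x # y # W)}" using p len by simp
  have "permute_list ?\<sigma> (x # y # W) = y # x # W"
    by (rule nth_equalityI)
      (auto simp: permute_list_nth[OF p'] transpose_def nth_Cons simp del: One_nat_def split: nat.split)
  moreover have "sign ?\<sigma> = -1" by (simp add: sign_swap_id)
  ultimately show ?thesis using permute_tuple(2)[OF assms p] by simp
qed

text \<open>\<open>three_term\<close> concerns the first two places only. A single sign
  \<open>s\<close> moves \<open>x\<close> and \<open>u\<close> there for all relabellings
  \<open>g\<close> at once, so every product of two brackets picks up the same factor
  \<open>s * s\<close>.\<close>

lemma basis_tuple_front:
  assumes B: "B \<in> basis_tuples M" and xu: "x \<in> set B" "u \<in> set B" "x \<noteq> u"
  obtains s W where "s * s = 1" "set (x # u # W) = set B" "distinct (x # u # W)"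
    "length W + 2 = matroid_rank M"
    "\<And>g. (\<And>w. w \<in> set B \<Longrightarrow> g w \<in> ground M) \<Longrightarrow> b (map g B) = s * b (map g (x # u # W))"
proof -
  define W where "W = remove1 u (remove1 x B)"
  have "u \<in> set (remove1 x B)" using xu by (simp add: in_set_remove1)
  then have "mset (x # u # W) = mset B"
    using xu(1) unfolding W_def by (metis mset.simps(2) mset_remove1 insert_DiffM set_mset_mset)
  then obtain \<sigma> where \<sigma>: "\<sigma> permutes {..<length B}" "permute_list \<sigma> B = x # u # W"
    using mset_eq_permutation[of "x # u # W" B] by blast
  have len: "length B = matroid_rank M" using B by (simp add: basis_tuples_def tuples_def)
  define s :: 'r where "s = of_int (sign \<sigma>)"
  have s: "s * s = 1" by (simp add: s_def flip: of_int_mult)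
  have "b (map g B) = s * b (map g (x # u # W))" if "\<And>w. w \<in> set B \<Longrightarrow> g w \<in> ground M" for g
  proof -
    have "map g B \<in> tuples M" using that len by (auto simp: tuples_def)
    from permute_tuple(2)[OF this, of \<sigma>] have "b (map g (x # u # W)) = s * b (map g B)"
      using \<sigma> len by (simp add: permute_list_map s_def)
    then show ?thesis using s by (simp flip: mult.assoc)
  qed
  moreover have "distinct (x # u # W)" "set (x # u # W) = set B" "length (x # u # W) = length B"
    using \<sigma> basis_tuple_distinct[OF B] by (metis distinct_permute_list set_permute_list length_permute_list)+
  ultimately show thesis using that[of s W] s len by simp
qed

text \<open>The three-term relation as pivoting needs it: division by [B] and by [B/x -> y] turns it
  into the rule A_uv - A_uy A_xv / A_xy for the entries of the bracket matrix of the new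
  basis.\<close>

lemma exchange_relation:
  assumes B: "B \<in> basis_tuples M" and xu: "x \<in> set B" "u \<in> set B" "x \<noteq> u"
    and y: "y \<in> ground M - set B" and v: "v \<in> ground M"
  shows "b (replace u v (replace x y B)) * b B
    = b (replace x y B) * b (replace u v B) - b (replace u y B) * b (replace x v B)"
proof -
  obtain s W where s: "s * s = 1" and W: "set (x # u # W) = set B" "distinct (x # u # W)"
      "length W + 2 = matroid_rank M"
    and b: "\<And>g. (\<And>w. w \<in> set B \<Longrightarrow> g w \<in> ground M) \<Longrightarrow> b (map g B) = s * b (map g (x # u # W))"
    using basis_tuple_front[OF B xu] by metis
  have gr: "set B \<subseteq> ground M" using B by (simp add: basis_tuples_def tuples_def)
  have id: "replace p q W = W" if "p \<notin> set W" for p q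
    using that by (intro map_idI) auto
  \<comment> \<open>As \<open>y\<close> lies outside \<open>B\<close>, the second of two successive
    replacements cannot touch the new \<open>y\<close>.\<close>
  have yu: "y \<noteq> u" "y \<notin> set W" using y W(1) by auto
  have xW: "x \<notin> set W" "u \<notin> set W" using W(2) by auto
  have R: "b (replace x y B) = s * b (y # u # W)" "b (replace u v B) = s * b (x # v # W)"
    "b (replace u y B) = s * b (x # y # W)" "b (replace x v B) = s * b (v # u # W)"
    "b B = s * b (x # u # W)"
    using b[of "\<lambda>w. if w = x then y else w"] b[of "\<lambda>w. if w = u then v else w"]
      b[of "\<lambda>w. if w = u then y else w"] b[of "\<lambda>w. if w = x then v else w"] b[of "\<lambda>w. w"]
      y v gr xu(3) xW by (simp_all add: id subset_iff)
  have "b (replace u v (replace x y B)) = s * b (y # v # W)"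
    using b[of "(\<lambda>w. if w = u then v else w) \<circ> (\<lambda>w. if w = x then y else w)"] y v gr xu(3) xW yu(1)
    by (simp add: id subset_iff flip: map_map)
  then have "b (replace u v (replace x y B)) * b B = (s * s) * (b (y # v # W) * b (x # u # W))"
    unfolding R by (simp add: ac_simps)
  also have "b (y # v # W) * b (x # u # W)
      = b (y # u # W) * b (x # v # W) + b (v # u # W) * b (y # x # W)"
    using three_term[of x u y v W] W gr y v by (auto simp: algebra_simps)
  also have "b (y # x # W) = - b (x # y # W)"
    by (rule b_swap) (use W gr y in \<open>auto simp: tuples_def\<close>)
  finally show ?thesis unfolding R by (simp add: algebra_simps)
qed

text \<open>The case v = x of \<open>exchange_relation\<close>, in which [B/u -> x] vanishes because
  \<open>x\<close> occurs twice. It accounts for the minus sign in the new column of a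
  pivot.\<close>

lemma exchange_back:
  assumes B: "B \<in> basis_tuples M" and xu: "x \<in> set B" "u \<in> set B" "x \<noteq> u"
    and y: "y \<in> ground M - set B"
  shows "b (replace u x (replace x y B)) = - b (replace u y B)"
proof (rule dvd_1_cancel[OF basis_unit[OF B]])
  have x: "x \<in> ground M" using B xu by (auto simp: basis_tuples_def tuples_def)
  have "replace u x B \<in> tuples M" using B x by (auto simp: basis_tuples_def tuples_def)
  moreover have "\<not> distinct (replace u x B)"
    using xu inj_onD[of "\<lambda>w. if w = u then x else w" "set B" x u] by (auto simp: distinct_map)
  ultimately have "b (replace u x B) = 0" by (rule not_distinct_zero)
  moreover have "replace x x B = B" by (simp add: map_idI)
  ultimately show "b B * b (replace u x (replace x y B)) = b B * - b (replace u y B)"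
    using exchange_relation[OF B xu y x] by (simp add: mult.commute)
qed

end

text \<open>A bridge between the two notions of ring: \<open>\<iota>\<close> identifies a type of
  class \<open>comm_ring_1\<close> with the carrier of \<open>R\<close>. It is used for the bracket
  ring and, with the identity map, for the rationals.\<close>

locale ring_representation = cring R for R :: "'a ring" (structure) +
  fixes \<iota> :: "'t::comm_ring_1 \<Rightarrow> 'a"
  assumes bij: "bij_betw \<iota> UNIV (carrier R)"
    and zero: "\<iota> 0 = \<zero>" and one: "\<iota> 1 = \<one>"
    and add: "\<iota> (x + y) = \<iota> x \<oplus> \<iota> y" and mult: "\<iota> (x * y) = \<iota> x \<otimes> \<iota> y"
begin

lemma closed [simp]: "\<iota> x \<in> carrier R"
  using bij by (auto simp: bij_betw_def)

lemma eq_iff [simp]: "\<iota> x = \<iota> y \<longleftrightarrow> x = y"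
  using bij by (auto simp: bij_betw_def inj_on_def)

lemma eq_zero_iff [simp]: "\<iota> x = \<zero> \<longleftrightarrow> x = 0"
  using eq_iff[of x 0] by (simp add: zero)

lemma uminus: "\<iota> (- x) = \<ominus> \<iota> x"
proof -
  have "\<iota> (- x) \<oplus> \<iota> x = \<zero>" by (simp add: zero flip: add)
  then show ?thesis by (simp add: minus_equality)
qed

lemma minus: "\<iota> (x - y) = \<iota> x \<ominus> \<iota> y"
  using add[of x "- y"] by (simp add: a_minus_def uminus)

lemma inv_eq:
  assumes "x * y = 1"
  shows "inv (\<iota> x) = \<iota> y" "\<iota> x \<in> Units R"
proof -
  have "\<iota> x \<otimes> \<iota> y = \<one>" "\<iota> y \<otimes> \<iota> x = \<one>"
    using assms by (simp_all add: mult.commute one flip: mult)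
  then show "inv (\<iota> x) = \<iota> y" "\<iota> x \<in> Units R"
    by (auto intro: comm_inv_char simp: Units_def)
qed

lemma Units_iff: "\<iota> x \<in> Units R \<longleftrightarrow> x dvd 1"
proof
  assume "\<iota> x \<in> Units R"
  then obtain z where "z \<in> carrier R" "\<iota> x \<otimes> z = \<one>" by (auto simp: Units_def)
  moreover obtain y where "z = \<iota> y" using bij calculation(1) by (auto simp: bij_betw_def)
  ultimately have "x * y = 1" by (simp add: mult one flip: eq_iff)
  then show "x dvd 1" by (metis dvd_triv_left)
next
  assume "x dvd 1"
  then show "\<iota> x \<in> Units R" using inv_eq(2) by (auto elim!: dvdE)
qed

end

section \<open>Minors of bracket matrices\<close>

locale bracket_representation = ring_representation R \<iota> + bracket_evaluation M b
  for R :: "'a ring" (structure) and \<iota> :: "'t::comm_ring_1 \<Rightarrow> 'a" and M :: "'e matroid" and b :: "'e list \<Rightarrow> 't"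
begin

text \<open>Up to scaling, \<open>A\<close> is a submatrix of the bracket matrix of the basis \<open>B\<close>.\<close>

definition bracket_scaled :: "'e list \<Rightarrow> ('e, 'a) labelled_matrix \<Rightarrow> bool" where
  "bracket_scaled B A \<longleftrightarrow> B \<in> basis_tuples M \<and> row_labels A \<subseteq> set B \<and>
     col_labels A \<subseteq> ground M - set B \<and>
     (\<exists>r s. (\<forall>u\<in>row_labels A. r u dvd 1) \<and> (\<forall>v\<in>col_labels A. s v dvd 1) \<and>
        (\<forall>u\<in>row_labels A. \<forall>v\<in>col_labels A. entry A u v = \<iota> (r u * s v * b (replace u v B))))"

lemma bracket_scaledI:
  assumes "B \<in> basis_tuples M" "row_labels A \<subseteq> set B" "col_labels A \<subseteq> ground M - set B"
    and "\<And>u. u \<in> row_labels A \<Longrightarrow> r u dvd 1" "\<And>v. v \<in> col_labels A \<Longrightarrow> s v dvd 1"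
    and "\<And>u v. u \<in> row_labels A \<Longrightarrow> v \<in> col_labels A \<Longrightarrow>
      entry A u v = \<iota> (r u * s v * b (replace u v B))"
  shows "bracket_scaled B A"
  unfolding bracket_scaled_def using assms(1-3)
  by (intro conjI exI[of _ r] exI[of _ s] ballI assms(4-6))

lemma bracket_scaledE:
  assumes "bracket_scaled B A"
  obtains r s where "B \<in> basis_tuples M" "row_labels A \<subseteq> set B"
    "col_labels A \<subseteq> ground M - set B"
    "\<And>u. u \<in> row_labels A \<Longrightarrow> r u dvd 1" "\<And>v. v \<in> col_labels A \<Longrightarrow> s v dvd 1"
    "\<And>u v. u \<in> row_labels A \<Longrightarrow> v \<in> col_labels A \<Longrightarrow>
      entry A u v = \<iota> (r u * s v * b (replace u v B))"
proof -
  obtain r s where B: "B \<in> basis_tuples M" "row_labels A \<subseteq> set B" "col_labels A \<subseteq> ground M - set B"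
    and rs: "\<forall>u\<in>row_labels A. r u dvd 1" "\<forall>v\<in>col_labels A. s v dvd 1"
    "\<forall>u\<in>row_labels A. \<forall>v\<in>col_labels A. entry A u v = \<iota> (r u * s v * b (replace u v B))"
    using assms unfolding bracket_scaled_def by (elim conjE exE)
  show thesis
    by (rule that[of r s, OF B]) (use rs in \<open>blast+\<close>)
qed

text \<open>For unscaled bracket matrices, \<open>exchange_relation\<close> and
  \<open>exchange_back\<close> are the pivot formulas themselves. The scalings of \<open>A\<close>
  and the change from [B] to [B/x -> y] are absorbed by new weights.\<close>

lemma bracket_scaled_pivot:
  assumes A: "bracket_scaled B A" and xy: "x \<in> row_labels A" "y \<in> col_labels A"
    and nz: "entry A x y \<noteq> \<zero>"
  shows "bracket_scaled (replace x y B) (pivot R x y A)"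
proof -
  obtain r s where B: "B \<in> basis_tuples M" and sub: "row_labels A \<subseteq> set B"
    "col_labels A \<subseteq> ground M - set B"
    and r: "\<And>u. u \<in> row_labels A \<Longrightarrow> r u dvd 1" and s: "\<And>v. v \<in> col_labels A \<Longrightarrow> s v dvd 1"
    and e: "\<And>u v. u \<in> row_labels A \<Longrightarrow> v \<in> col_labels A \<Longrightarrow>
      entry A u v = \<iota> (r u * s v * b (replace u v B))"
    by (rule bracket_scaledE[OF A]) (rule that)
  have xB: "x \<in> set B" and yB: "y \<in> ground M - set B" using xy sub by auto
  define B' where "B' = replace x y B"
  define e0 where "e0 u v = b (replace u v B)" for u v
  define e1 where "e1 u v = b (replace u v B')" for u v
  have setB: "set B' = insert y (set B - {x})" using xB by (auto simp: B'_def)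
  have tup: "B' \<in> tuples M" using B yB by (auto simp: basis_tuples_def tuples_def B'_def)
  \<comment> \<open>Brackets of nonbases vanish, so a nonzero pivot entry makes \<open>B'\<close> a
    basis.\<close>
  have "b B' \<noteq> 0" using nz e[OF xy] by (auto simp: B'_def)
  then have B': "B' \<in> basis_tuples M"
    using nonbasis[OF tup] tup by (auto simp: basis_tuples_def)
  have e0xy: "e0 x y = b B'" by (simp add: e0_def B'_def)
  have e1y: "e1 y v = e0 x v" for v
    using yB unfolding e0_def e1_def B'_def by (intro arg_cong[of _ _ b]) auto
  have e0xx: "e0 x x = b B" unfolding e0_def by (simp add: map_idI)
  obtain \<beta> where "1 = b B' * \<beta>" using basis_unit[OF B'] by (rule dvdE)
  then have \<beta>: "b B' * \<beta> = 1" ..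
  obtain \<beta>0 where "1 = b B * \<beta>0" using basis_unit[OF B] by (rule dvdE)
  then have \<beta>0: "b B * \<beta>0 = 1" ..
  obtain rx where "1 = r x * rx" using r[OF xy(1)] by (rule dvdE)
  then have rx: "r x * rx = 1" ..
  obtain sy where "1 = s y * sy" using s[OF xy(2)] by (rule dvdE)
  then have sy: "s y * sy = 1" ..
  define a where "a = rx * sy * \<beta>"
  have "r x * s y * e0 x y * a = (r x * rx) * (s y * sy) * (b B' * \<beta>)"
    by (simp only: a_def e0xy ac_simps)
  then have inv: "inv (entry A x y) = \<iota> a"
    unfolding e[OF xy] by (intro inv_eq) (simp only: rx sy \<beta> mult_1 e0_def)
  have unit: "b B dvd 1" "rx dvd 1" "sy dvd 1" "\<beta> dvd 1" "\<beta>0 dvd 1"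
    by (rule dvdI[OF \<beta>0[symmetric]])
      (metis dvd_triv_right rx, metis dvd_triv_right sy, metis dvd_triv_right \<beta>,
        metis dvd_triv_right \<beta>0)
  \<comment> \<open>Comparing the four kinds of pivoted entries with brackets over \<open>B'\<close>
    leads to these weights: 1 / (s y [B']) for the new row, 1 / (r x [B]) for the new column, and an
    additional factor [B] / [B'] on every other row.\<close>
  define r' where "r' u = (if u = y then sy * \<beta> else r u * b B * \<beta>)" for u
  define s' where "s' v = (if v = x then rx * \<beta>0 else s v)" for v
  have main: "entry (pivot R x y A) u v = \<iota> (r' u * s' v * e1 u v)"
    if u: "u \<in> row_labels (pivot R x y A)" and v: "v \<in> col_labels (pivot R x y A)" for u v
  proof -
    consider "u = y" "v = x" | "u = y" "v \<in> col_labels A" "v \<noteq> y" "v \<noteq> x"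
      | "u \<in> row_labels A" "u \<noteq> x" "u \<noteq> y" "v = x"
      | "u \<in> row_labels A" "u \<noteq> x" "u \<noteq> y" "v \<in> col_labels A" "v \<noteq> y" "v \<noteq> x"
      using u v xB yB sub by (auto simp: pivot_def Let_def)
    then show ?thesis
    proof cases
      case 1
      have "r' u * s' v * e1 u v = a * (b B * \<beta>0)"
        unfolding 1 e1y e0xx by (simp add: a_def r'_def s'_def ac_simps)
      then show ?thesis using 1 \<beta>0 by (simp add: pivot_def Let_def inv)
    next
      case 2
      have "r' u * s' v * e1 u v = sy * \<beta> * s v * e0 x v"
        unfolding 2(1) e1y using 2 by (simp add: r'_def s'_def)
      also have "\<dots> = (r x * rx) * (sy * \<beta> * s v * e0 x v)" by (simp only: rx mult_1)
      also have "\<dots> = a * (r x * s v * e0 x v)" by (simp only: a_def ac_simps)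
      finally show ?thesis
        using 2 e[OF xy(1) 2(2)] by (simp add: pivot_def Let_def inv mult e0_def)
    next
      case 3
      have "e1 u x = - e0 u y"
        unfolding e0_def e1_def B'_def by (rule exchange_back[OF B xB _ _ yB]) (use 3 sub in auto)
      then have "r' u * s' v * e1 u v = - ((b B * \<beta>0) * (r u * \<beta> * rx * e0 u y))"
        using 3 by (simp add: r'_def s'_def ac_simps)
      also have "\<dots> = - ((s y * sy) * (r u * \<beta> * rx * e0 u y))" by (simp only: \<beta>0 sy)
      also have "\<dots> = - (a * (r u * s y * e0 u y))" by (simp only: a_def ac_simps)
      finally show ?thesis
        using 3 e[OF 3(1) xy(2)] by (simp add: pivot_def Let_def inv mult uminus e0_def)
    next
      case 4
      have ex: "e1 u v * b B = b B' * e0 u v - e0 u y * e0 x v"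
        unfolding e0_def e1_def B'_def by (rule exchange_relation[OF B xB _ _ yB]) (use 4 sub in auto)
      have "r' u * s' v * e1 u v = r u * s v * \<beta> * (e1 u v * b B)"
        using 4 by (simp add: r'_def s'_def ac_simps)
      also have "\<dots> = (b B' * \<beta>) * (r u * s v * e0 u v) - r u * s v * \<beta> * e0 u y * e0 x v"
        unfolding ex by (simp only: right_diff_distrib ac_simps)
      also have "r u * s v * \<beta> * e0 u y * e0 x v
          = (r x * rx) * (s y * sy) * (r u * s v * \<beta> * e0 u y * e0 x v)"
        by (simp only: rx sy mult_1)
      also have "\<dots> = a * (r u * s y * e0 u y) * (r x * s v * e0 x v)"
        by (simp only: a_def ac_simps)
      also have "(b B' * \<beta>) * (r u * s v * e0 u v) = r u * s v * e0 u v"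
        by (simp only: \<beta> mult_1)
      finally show ?thesis
        using 4 e[OF 4(1) xy(2)] e[OF xy(1) 4(4)] e[OF 4(1,4)]
        by (simp add: pivot_def Let_def inv mult minus e0_def)
    qed
  qed
  show ?thesis
    unfolding B'_def[symmetric]
  proof (rule bracket_scaledI[OF B'])
    show "row_labels (pivot R x y A) \<subseteq> set B'" "col_labels (pivot R x y A) \<subseteq> ground M - set B'"
      using sub xB yB setB B by (auto simp: pivot_def Let_def basis_tuples_def tuples_def)
    show "r' u dvd 1" if "u \<in> row_labels (pivot R x y A)" for u
      using that unit r by (auto simp: pivot_def Let_def r'_def intro!: dvd_1_mult)
    show "s' v dvd 1" if "v \<in> col_labels (pivot R x y A)" for v
      using that unit s by (auto simp: pivot_def Let_def s'_def intro!: dvd_1_mult)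
  qed (use main in \<open>simp only: e1_def\<close>)
qed

end

context bracket_representation
begin

lemma bracket_scaled_scale_row:
  assumes A: "bracket_scaled B A" and c: "c \<in> Units R"
  shows "bracket_scaled B (scale_row R x c A)"
proof -
  obtain r s where B: "B \<in> basis_tuples M" "row_labels A \<subseteq> set B"
      "col_labels A \<subseteq> ground M - set B"
    and r: "\<And>u. u \<in> row_labels A \<Longrightarrow> r u dvd 1"
    and s: "\<And>v. v \<in> col_labels A \<Longrightarrow> s v dvd 1"
    and e: "\<And>u v. u \<in> row_labels A \<Longrightarrow> v \<in> col_labels A \<Longrightarrow>
      entry A u v = \<iota> (r u * s v * b (replace u v B))"
    by (rule bracket_scaledE[OF A]) (rule that)
  have "c \<in> carrier R" using c by (rule Units_closed)
  then obtain c' where c': "c = \<iota> c'" using bij by (auto simp: bij_betw_def)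
  define r' where "r' u = (if u = x then c' * r u else r u)" for u
  show ?thesis
  proof (rule bracket_scaledI[of _ _ r' s])
    show "r' u dvd 1" if "u \<in> row_labels (scale_row R x c A)" for u
      using that r[of u] c by (cases "u = x") (simp_all add: r'_def c' Units_iff scale_row_def dvd_1_mult)
    show "entry (scale_row R x c A) u v = \<iota> (r' u * s v * b (replace u v B))"
      if "u \<in> row_labels (scale_row R x c A)" "v \<in> col_labels (scale_row R x c A)" for u v
      using that e[of u v] by (cases "u = x") (simp_all add: scale_row_def r'_def c' mult.assoc flip: mult)
  qed (use B s in \<open>simp_all add: scale_row_def\<close>)
qed

lemma bracket_scaled_scale_col:
  assumes A: "bracket_scaled B A" and c: "c \<in> Units R"
  shows "bracket_scaled B (scale_col R y c A)"
proof -
  obtain r s where B: "B \<in> basis_tuples M" "row_labels A \<subseteq> set B"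
      "col_labels A \<subseteq> ground M - set B"
    and r: "\<And>u. u \<in> row_labels A \<Longrightarrow> r u dvd 1"
    and s: "\<And>v. v \<in> col_labels A \<Longrightarrow> s v dvd 1"
    and e: "\<And>u v. u \<in> row_labels A \<Longrightarrow> v \<in> col_labels A \<Longrightarrow>
      entry A u v = \<iota> (r u * s v * b (replace u v B))"
    by (rule bracket_scaledE[OF A]) (rule that)
  have "c \<in> carrier R" using c by (rule Units_closed)
  then obtain c' where c': "c = \<iota> c'" using bij by (auto simp: bij_betw_def)
  define s' where "s' v = (if v = y then c' * s v else s v)" for v
  show ?thesis
  proof (rule bracket_scaledI[of _ _ r s'])
    show "s' v dvd 1" if "v \<in> col_labels (scale_col R y c A)" for v
      using that s[of v] c by (cases "v = y") (simp_all add: s'_def c' Units_iff scale_col_def dvd_1_mult)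
    show "entry (scale_col R y c A) u v = \<iota> (r u * s' v * b (replace u v B))"
      if "u \<in> row_labels (scale_col R y c A)" "v \<in> col_labels (scale_col R y c A)" for u v
      using that e[of u v] by (cases "v = y") (simp_all add: scale_col_def s'_def c' ac_simps flip: mult)
  qed (use B r in \<open>simp_all add: scale_col_def\<close>)
qed

lemma bracket_scaled_submatrix:
  assumes A: "bracket_scaled B A"
    and sub: "row_labels A' \<subseteq> row_labels A" "col_labels A' \<subseteq> col_labels A" "entry A' = entry A"
  shows "bracket_scaled B A'"
proof -
  obtain r s where B: "B \<in> basis_tuples M" "row_labels A \<subseteq> set B"
      "col_labels A \<subseteq> ground M - set B"
    and r: "\<And>u. u \<in> row_labels A \<Longrightarrow> r u dvd 1"
    and s: "\<And>v. v \<in> col_labels A \<Longrightarrow> s v dvd 1"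
    and e: "\<And>u v. u \<in> row_labels A \<Longrightarrow> v \<in> col_labels A \<Longrightarrow>
      entry A u v = \<iota> (r u * s v * b (replace u v B))"
    by (rule bracket_scaledE[OF A]) (rule that)
  show ?thesis
  proof (rule bracket_scaledI[OF B(1)])
    show "row_labels A' \<subseteq> set B" using sub(1) B(2) by (rule subset_trans)
    show "col_labels A' \<subseteq> ground M - set B" using sub(2) B(3) by (rule subset_trans)
    show "r u dvd 1" if "u \<in> row_labels A'" for u using subsetD[OF sub(1) that] by (rule r)
    show "s v dvd 1" if "v \<in> col_labels A'" for v using subsetD[OF sub(2) that] by (rule s)
    show "entry A' u v = \<iota> (r u * s v * b (replace u v B))"
      if "u \<in> row_labels A'" "v \<in> col_labels A'" for u v
      unfolding sub(3) by (rule e[OF subsetD[OF sub(1) that(1)] subsetD[OF sub(2) that(2)]])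
  qed
qed

text \<open>Only pivoting changes the basis; scaling alters the weights, and deletion the label
  sets.\<close>

lemma bracket_scaled_minor:
  assumes "matrix_minor R A A'" "bracket_scaled B A"
  shows "\<exists>B. bracket_scaled B A'"
  using assms
proof (induction rule: matrix_minor.induct)
  case (scale_row A' x c)
  then show ?case using bracket_scaled_scale_row by blast
next
  case (scale_col A' y c)
  then show ?case using bracket_scaled_scale_col by blast
next
  case (delete_row A' x)
  then obtain B where "bracket_scaled B A'" by blast
  then have "bracket_scaled B (A'\<lparr>row_labels := row_labels A' - {x}\<rparr>)"
    by (rule bracket_scaled_submatrix) auto
  then show ?case ..
next
  case (delete_col A' y)
  then obtain B where "bracket_scaled B A'" by blast
  then have "bracket_scaled B (A'\<lparr>col_labels := col_labels A' - {y}\<rparr>)"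
    by (rule bracket_scaled_submatrix) auto
  then show ?case ..
next
  case (pivot A' x y)
  then show ?case using bracket_scaled_pivot by blast
qed blast

text \<open>The basis behind \<open>cross_ratios\<close> is chosen arbitrarily; a chain of
  exchanges, each carried out as a pivot, leads to a prescribed one without losing any row or
  column.\<close>

lemma bracket_scaled_basis_change:
  assumes A: "bracket_scaled B A" "row_labels A = set B" "col_labels A = ground M - set B"
    and J: "J \<in> bases M"
  obtains A' B' where "matrix_minor R A A'" "bracket_scaled B' A'" "set B' = J"
    "row_labels A' = J" "col_labels A' = ground M - J"
proof -
  let ?P = "\<lambda>I. \<exists>A' B'. matrix_minor R A A' \<and> bracket_scaled B' A' \<and> set B' = I \<and>
    row_labels A' = I \<and> col_labels A' = ground M - I"
  have B: "B \<in> basis_tuples M" using A(1) by (simp add: bracket_scaled_def)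
  then have I: "set B \<in> bases M" by (simp add: basis_tuples_def)
  have "?P (set B)" by (rule exI[of _ A], rule exI[of _ B]) (simp add: A matrix_minor.refl)
  with matroid I J have "?P J"
  proof (induction rule: matroid_basis_exchange_induct)
    case (exchange I x y)
    then obtain A' B' where A': "matrix_minor R A A'" "bracket_scaled B' A'" "set B' = I"
      "row_labels A' = I" "col_labels A' = ground M - I" by blast
    have sub: "I \<subseteq> ground M" "J \<subseteq> ground M"
      using matroid exchange(1) J unfolding is_matroid_def by auto
    have xy: "x \<in> row_labels A'" "y \<in> col_labels A'"
      using exchange(2,3) sub A'(4,5) by auto
    have setB: "set (replace x y B') = insert y (I - {x})" using exchange(2) A'(3) by auto
    obtain r s where r: "r x dvd 1" and s: "s y dvd 1"
      and e: "entry A' x y = \<iota> (r x * s y * b (replace x y B'))"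
      and B': "B' \<in> basis_tuples M"
      using A'(2) by (rule bracket_scaledE) (rule that; use xy in simp)
    have "replace x y B' \<in> basis_tuples M"
      using B' exchange(4) setB sub exchange(3) A'(3)
      by (auto simp: basis_tuples_def tuples_def simp del: set_map)
    then have "r x * s y * b (replace x y B') dvd 1"
      using r s basis_unit by (intro dvd_1_mult)
    then have "r x * s y * b (replace x y B') \<noteq> 0" by (metis dvd_0_left_iff zero_neq_one)
    then have nz: "entry A' x y \<noteq> \<zero>" unfolding e by simp
    show ?case
    proof (intro exI conjI)
      show "matrix_minor R A (pivot R x y A')" using A'(1) xy nz by (rule matrix_minor.pivot)
      show "bracket_scaled (replace x y B') (pivot R x y A')"
        using A'(2) xy nz by (rule bracket_scaled_pivot)
      show "set (replace x y B') = insert y (I - {x})" by (rule setB)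
      show "row_labels (pivot R x y A') = insert y (I - {x})"
        by (simp add: pivot_def Let_def A'(4))
      show "col_labels (pivot R x y A') = ground M - insert y (I - {x})"
        using exchange(2,3) sub by (auto simp: pivot_def Let_def A'(5))
    qed
  qed
  then show thesis by (elim exE conjE) (rule that)
qed

end

section \<open>Cross ratios of 2 x 2 submatrices\<close>

lemma matrix_minor_delete_rows:
  assumes "matrix_minor R A A'" "finite D" "D \<subseteq> row_labels A'"
  shows "matrix_minor R A (A'\<lparr>row_labels := row_labels A' - D\<rparr>)"
  using assms(2,3)
proof induction
  case empty
  then show ?case using assms(1) by simp
next
  case (insert x D)
  let ?A = "A'\<lparr>row_labels := row_labels A' - D\<rparr>"
  have "matrix_minor R A (?A\<lparr>row_labels := row_labels ?A - {x}\<rparr>)"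
    by (rule matrix_minor.delete_row) (use insert in simp_all)
  moreover have "row_labels A' - insert x D = row_labels ?A - {x}" by auto
  ultimately show ?case by simp
qed

lemma matrix_minor_delete_cols:
  assumes "matrix_minor R A A'" "finite D" "D \<subseteq> col_labels A'"
  shows "matrix_minor R A (A'\<lparr>col_labels := col_labels A' - D\<rparr>)"
  using assms(2,3)
proof induction
  case empty
  then show ?case using assms(1) by simp
next
  case (insert x D)
  let ?A = "A'\<lparr>col_labels := col_labels A' - D\<rparr>"
  have "matrix_minor R A (?A\<lparr>col_labels := col_labels ?A - {x}\<rparr>)"
    by (rule matrix_minor.delete_col) (use insert in simp_all)
  moreover have "col_labels A' - insert x D = col_labels ?A - {x}" by auto
  ultimately show ?case by simp
qed

text \<open>Three scalings normalise the submatrix: \<open>a\<close> makes the entry at (x1, y1)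
  equal to 1, then \<open>c\<close> that at (x1, y2), then \<open>d\<close> that at (x2, y2). The
  entry at (x2, y1) becomes e12 e21 / (e11 e22).\<close>

lemma (in ring_representation) cross_ratio_of_minor:
  assumes A': "matrix_minor R A A'" "finite (row_labels A')" "finite (col_labels A')"
    and x: "x1 \<in> row_labels A'" "x2 \<in> row_labels A'" "x1 \<noteq> x2"
    and y: "y1 \<in> col_labels A'" "y2 \<in> col_labels A'" "y1 \<noteq> y2"
    and e: "entry A' x1 y1 = \<iota> e11" "entry A' x1 y2 = \<iota> e12"
      "entry A' x2 y1 = \<iota> e21" "entry A' x2 y2 = \<iota> e22"
    and unit: "e11 dvd 1" "e12 dvd 1" "e22 dvd 1"
    and p: "p * (e11 * e22) = e12 * e21"
  shows "\<iota> p \<in> matrix_cross_ratios R A"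
proof -
  obtain a where "1 = e11 * a" using unit(1) by (rule dvdE)
  then have a: "a * e11 = 1" by (simp add: mult.commute)
  have "a dvd 1" by (rule dvdI[OF a[symmetric]])
  then have "a * e12 dvd 1" using unit(2) by (rule dvd_1_mult)
  then obtain c where "1 = a * e12 * c" by (rule dvdE)
  then have c: "c * (a * e12) = 1" by (simp add: mult.commute)
  have "c dvd 1" by (rule dvdI[OF c[symmetric]])
  then have "c * e22 dvd 1" using unit(3) by (rule dvd_1_mult)
  then obtain d where "1 = c * e22 * d" by (rule dvdE)
  then have d: "d * (c * e22) = 1" by (simp add: mult.commute)
  have "d dvd 1" by (rule dvdI[OF d[symmetric]])
  have "d * e21 = p"
  proof -
    have "d * e21 = (a * e11) * (c * (a * e12)) * (d * e21)" by (simp only: a c mult_1)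
    also have "\<dots> = d * c * a * a * e11 * (e12 * e21)" by (simp only: ac_simps)
    also have "\<dots> = (d * (c * e22)) * (a * e11) * (a * e11) * p"
      unfolding p[symmetric] by (simp only: ac_simps)
    finally show ?thesis by (simp only: a d mult_1)
  qed
  define A1 where "A1 = A'\<lparr>row_labels := {x1, x2}\<rparr>"
  define A2 where "A2 = A1\<lparr>col_labels := {y1, y2}\<rparr>"
  have "row_labels A' - (row_labels A' - {x1, x2}) = {x1, x2}"
    "col_labels A' - (col_labels A' - {y1, y2}) = {y1, y2}" using x y by auto
  then have "matrix_minor R A A1"
    using matrix_minor_delete_rows[OF A'(1), of "row_labels A' - {x1, x2}"] A'(2)
    by (simp add: A1_def)
  from matrix_minor_delete_cols[OF this, of "col_labels A' - {y1, y2}"]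
  have "matrix_minor R A A2"
    using A'(3) \<open>col_labels A' - (col_labels A' - {y1, y2}) = {y1, y2}\<close>
    by (simp add: A1_def A2_def)
  then have "matrix_minor R A (scale_row R x1 (\<iota> a) A2)"
    using \<open>a dvd 1\<close> by (intro matrix_minor.scale_row) (simp_all add: A2_def A1_def Units_iff)
  then have "matrix_minor R A (scale_col R y2 (\<iota> c) (scale_row R x1 (\<iota> a) A2))"
    using \<open>c dvd 1\<close>
    by (intro matrix_minor.scale_col) (simp_all add: A2_def A1_def Units_iff scale_row_def)
  then have minor: "matrix_minor R A
      (scale_row R x2 (\<iota> d) (scale_col R y2 (\<iota> c) (scale_row R x1 (\<iota> a) A2)))"
      (is "matrix_minor R A ?A")
    using \<open>d dvd 1\<close>
    by (intro matrix_minor.scale_row)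
      (simp_all add: A2_def A1_def Units_iff scale_row_def scale_col_def)
  have "row_labels ?A = {x1, x2}" "col_labels ?A = {y1, y2}"
    by (simp_all add: A2_def A1_def scale_row_def scale_col_def)
  moreover have "entry ?A x1 y1 = \<iota> (a * e11)" "entry ?A x1 y2 = \<iota> (c * (a * e12))"
      "entry ?A x2 y1 = \<iota> (d * e21)" "entry ?A x2 y2 = \<iota> (d * (c * e22))"
    using x(3) y(3) by (simp_all add: A2_def A1_def scale_row_def scale_col_def e mult)
  ultimately show ?thesis
    unfolding matrix_cross_ratios_def mem_Collect_eq a c d \<open>d * e21 = p\<close> one
    using minor x(3) y(3)
    by (intro exI[of _ ?A] exI[of _ x1] exI[of _ x2] exI[of _ y1] exI[of _ y2] conjI)
qed

lemma dyadic_unitsI: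
  fixes p :: "'r::comm_ring_1"
  assumes "p * of_int m = of_int n" "\<bar>m\<bar> = 2 ^ k" "\<bar>n\<bar> = 2 ^ l"
  shows "p \<in> dyadic_units"
proof -
  have "m = 2 ^ k \<or> m = - (2 ^ k)" "n = 2 ^ l \<or> n = - (2 ^ l)" using assms(2,3) by linarith+
  moreover from this(1) have "p * 2 ^ k = of_int n \<or> p * 2 ^ k = of_int (- n)"
    unfolding assms(1)[symmetric] of_int_minus by (elim disjE) simp_all
  ultimately have "p * 2 ^ k = 2 ^ l \<or> p * 2 ^ k = - (2 ^ l)"
    by (elim disjE) simp_all
  then show ?thesis unfolding dyadic_units_def by blast
qed

context p8_bracket_evaluation
begin

lemma bracket_eq_scaled_det_tuple:
  obtains c t where "\<And>Z. Z \<in> tuples P8 \<Longrightarrow>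
    b Z = c * prod_list (map t Z) * of_int (tuple_det p8_column Z)"
proof -
  obtain c t where ct: "\<And>x1 x2 x3 x4. {x1, x2, x3, x4} \<subseteq> {..<8} \<Longrightarrow>
    b [x1, x2, x3, x4] = c * (t x1 * t x2 * t x3 * t x4) * of_int (tuple_det p8_column [x1, x2, x3, x4])"
    using bracket_eq_scaled_det by blast
  show thesis
  proof (rule that[of c t])
    fix Z assume Z: "Z \<in> tuples P8"
    then have "length Z = Suc (Suc (Suc (Suc 0)))" by (simp add: tuples_P8)
    then obtain y1 y2 y3 y4 where "Z = [y1, y2, y3, y4]" by (auto simp: length_Suc_conv)
    then show "b Z = c * prod_list (map t Z) * of_int (tuple_det p8_column Z)"
      using Z ct[of y1 y2 y3 y4] by (simp add: tuples_P8 mult.assoc)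
  qed
qed

text \<open>Both products contain the weights of \<open>y1\<close>, \<open>y2\<close>,
  \<open>x1\<close>, \<open>x2\<close> once and those of the rest of \<open>B\<close> twice. The
  common factor \<open>\<kappa>\<close> collects them, so a quotient of the products depends on
  integer minors only.\<close>

lemma replaced_products:
  assumes B: "B \<in> basis_tuples P8" and x: "x1 \<in> set B" "x2 \<in> set B" "x1 \<noteq> x2"
    and y: "y1 < 8" "y2 < 8"
  defines "d \<equiv> \<lambda>u v. tuple_det p8_column (replace u v B)"
  obtains \<kappa> where
    "b (replace x1 y1 B) * b (replace x2 y2 B) = \<kappa> * of_int (d x1 y1 * d x2 y2)"
    "b (replace x1 y2 B) * b (replace x2 y1 B) = \<kappa> * of_int (d x1 y2 * d x2 y1)"
proof -
  obtain c t where ct: "\<And>Z. Z \<in> tuples P8 \<Longrightarrow>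
    b Z = c * prod_list (map t Z) * of_int (tuple_det p8_column Z)"
    using bracket_eq_scaled_det_tuple by blast
  define P where "P = (\<Prod>w\<in>set B - {x1, x2}. t w)"
  have prod: "prod_list (map t (replace u v B)) = t v * (t u' * P)"
    if "u \<in> set B" "u' \<in> set B" "u \<noteq> u'" "{u, u'} = {x1, x2}" for u u' v
  proof -
    have "prod_list (map t (replace u v B)) = (\<Prod>w\<in>set B. t (if w = u then v else w))"
      using basis_tuple_distinct[OF B] by (simp add: prod.distinct_set_conv_list comp_def)
    also have "\<dots> = t v * (\<Prod>w\<in>set B - {u}. t (if w = u then v else w))"
      using that(1) by (simp add: prod.remove)
    also have "(\<Prod>w\<in>set B - {u}. t (if w = u then v else w)) = (\<Prod>w\<in>set B - {u}. t w)"
      by (rule prod.cong) auto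
    also have "\<dots> = t u' * (\<Prod>w\<in>set B - {u} - {u'}. t w)"
      by (rule prod.remove) (use that in auto)
    also have "set B - {u} - {u'} = set B - {x1, x2}" using that(4) by auto
    finally show ?thesis by (simp only: P_def)
  qed
  have tup: "replace u v B \<in> tuples P8" if "v < 8" for u v
    using B that by (auto simp: basis_tuples_def tuples_P8)
  have 1: "b (replace x1 v B) = c * (t v * (t x2 * P)) * of_int (d x1 v)"
    "b (replace x2 v B) = c * (t v * (t x1 * P)) * of_int (d x2 v)" if "v < 8" for v
    by (simp_all only: ct[OF tup[OF that]] prod[OF x HOL.refl]
        prod[OF x(2) x(1) x(3)[symmetric] insert_commute] d_def)
  show thesis
    by (rule that[of "c * (t y1 * (t x2 * P)) * (c * (t y2 * (t x1 * P)))"])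
      (use y in \<open>simp_all add: 1 ac_simps\<close>)
qed

end

locale p8_bracket_representation = bracket_representation R \<iota> P8 b + p8_bracket_evaluation b
  for R :: "'a ring" (structure) and \<iota> :: "'t::comm_ring_1 \<Rightarrow> 'a" and b :: "nat list \<Rightarrow> 't"
begin

lemma cross_ratio_dyadic:
  assumes A: "bracket_scaled B0 A" and p: "p \<in> matrix_cross_ratios R A"
  shows "\<exists>q \<in> insert 0 dyadic_units. p = \<iota> q"
proof -
  obtain A' x1 x2 y1 y2 where A': "matrix_minor R A A'" "x1 \<noteq> x2" "row_labels A' = {x1, x2}"
      "y1 \<noteq> y2" "col_labels A' = {y1, y2}"
    and e: "entry A' x1 y1 = \<one>" "entry A' x1 y2 = \<one>" "entry A' x2 y1 = p" "entry A' x2 y2 = \<one>"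
    using p unfolding matrix_cross_ratios_def by (elim CollectE exE conjE)
  obtain B where B: "bracket_scaled B A'" using bracket_scaled_minor[OF A'(1) A] ..
  obtain r s where Bt: "B \<in> basis_tuples P8" and sub: "row_labels A' \<subseteq> set B"
    "col_labels A' \<subseteq> ground P8 - set B"
    and rs: "\<And>u v. u \<in> row_labels A' \<Longrightarrow> v \<in> col_labels A' \<Longrightarrow>
      entry A' u v = \<iota> (r u * s v * b (replace u v B))"
    by (rule bracket_scaledE[OF B]) (rule that)
  define d where "d u v = tuple_det p8_column (replace u v B)" for u v
  have x: "x1 \<in> set B" "x2 \<in> set B" and y: "y1 < 8" "y2 < 8"
    using sub A'(3,5) by (auto simp: ground_P8)
  obtain \<kappa> where \<kappa>: "b (replace x1 y1 B) * b (replace x2 y2 B) = \<kappa> * of_int (d x1 y1 * d x2 y2)"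
    "b (replace x1 y2 B) * b (replace x2 y1 B) = \<kappa> * of_int (d x1 y2 * d x2 y1)"
    by (rule replaced_products[OF Bt x A'(2) y]) (rule that, simp_all only: d_def)
  define q where "q = r x2 * s y1 * b (replace x2 y1 B)"
  have pq: "p = \<iota> q" using rs[of x2 y1] e(3) A'(3,5) by (simp add: q_def)
  have "\<iota> (r x1 * s y1 * b (replace x1 y1 B)) = \<iota> 1" "\<iota> (r x1 * s y2 * b (replace x1 y2 B)) = \<iota> 1"
    "\<iota> (r x2 * s y2 * b (replace x2 y2 B)) = \<iota> 1"
    using rs[of x1 y1] rs[of x1 y2] rs[of x2 y2] e A'(3,5) by (simp_all add: one)
  then have 1: "r x1 * s y1 * b (replace x1 y1 B) = 1" "r x1 * s y2 * b (replace x1 y2 B) = 1"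
    "r x2 * s y2 * b (replace x2 y2 B) = 1" by (simp_all only: eq_iff)
  \<comment> \<open>\<open>K\<close> gathers all weights: the product of the diagonal entries is
    \<open>K\<close> times an integer and equals 1, and the product of the other two entries is
    \<open>K\<close> times an integer and equals \<open>q\<close>. So \<open>q\<close> is a quotient
    of products of integer minors.\<close>
  define K where "K = r x1 * r x2 * s y1 * s y2 * \<kappa>"
  have "K * of_int (d x1 y1 * d x2 y2)
      = (r x1 * s y1 * b (replace x1 y1 B)) * (r x2 * s y2 * b (replace x2 y2 B))"
    unfolding K_def mult.assoc \<kappa>(1)[symmetric] by (simp only: ac_simps)
  then have K1: "K * of_int (d x1 y1 * d x2 y2) = 1" by (simp only: 1 mult_1)
  have "K * of_int (d x1 y2 * d x2 y1)
      = (r x1 * s y2 * b (replace x1 y2 B)) * (r x2 * s y1 * b (replace x2 y1 B))"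
    unfolding K_def mult.assoc \<kappa>(2)[symmetric] by (simp only: ac_simps)
  then have Kq: "K * of_int (d x1 y2 * d x2 y1) = q" by (simp only: 1 mult_1 q_def)
  have q: "q * of_int (d x1 y1 * d x2 y2) = of_int (d x1 y2 * d x2 y1)"
    using K1 unfolding Kq[symmetric] by (metis mult.assoc mult.commute mult_1)
  have vals: "d u v = 0 \<or> (\<exists>k. \<bar>d u v\<bar> = 2 ^ k)" if "v < 8" for u v
  proof -
    have "replace u v B \<in> tuples P8"
      using Bt that by (auto simp: basis_tuples_def tuples_P8)
    from tuple_det_p8_values[OF this] have "d u v = 0 \<or> \<bar>d u v\<bar> \<in> {2 ^ 0, 2 ^ 1, 2 ^ 2}"
      by (auto simp: d_def)
    then show ?thesis by blast
  qed
  have vals2: "d u v * d u' v' = 0 \<or> (\<exists>k. \<bar>d u v * d u' v'\<bar> = 2 ^ k)" if "v < 8" "v' < 8" for u v u' v'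
    using vals[OF that(1), of u] vals[OF that(2), of u'] by (auto simp: abs_mult simp flip: power_add)
  have "d x1 y1 * d x2 y2 \<noteq> 0" using K1 by (metis mult_zero_right of_int_0 zero_neq_one)
  then obtain k where k: "\<bar>d x1 y1 * d x2 y2\<bar> = 2 ^ k" using vals2[OF y] by blast
  show ?thesis
  proof (cases "d x1 y2 * d x2 y1 = 0")
    case True
    then have "q = 0" using Kq by (simp only: of_int_0 mult_zero_right)
    then show ?thesis using pq by blast
  next
    case False
    then obtain l where "\<bar>d x1 y2 * d x2 y1\<bar> = 2 ^ l" using vals2[OF y(2,1)] by blast
    then have "q \<in> dyadic_units" using dyadic_unitsI[OF q k] by blast
    then show ?thesis using pq by blast
  qed
qed

text \<open>Rows 0, 1 and columns 6, 7 of \<open>[I A8]\<close> form the submatrix [1 2; 1 1] with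
  cross ratio 2; interchanging its rows gives the inverse.\<close>

lemma two_cross_ratio:
  assumes A: "bracket_scaled B A" "row_labels A = set B" "col_labels A = ground P8 - set B"
    and h: "2 * h = 1"
  shows "\<iota> 2 \<in> matrix_cross_ratios R A" "\<iota> h \<in> matrix_cross_ratios R A"
proof -
  obtain A' B' where A': "matrix_minor R A A'" "bracket_scaled B' A'" "set B' = {0, 1, 2, 3}"
    "row_labels A' = {0, 1, 2, 3}" "col_labels A' = ground P8 - {0, 1, 2, 3}"
    by (rule bracket_scaled_basis_change[OF A p8_standard_basis]) (rule that)
  obtain r s where Bt: "B' \<in> basis_tuples P8"
    and r: "\<And>u. u \<in> row_labels A' \<Longrightarrow> r u dvd 1" and s: "\<And>v. v \<in> col_labels A' \<Longrightarrow> s v dvd 1"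
    and rs: "\<And>u v. u \<in> row_labels A' \<Longrightarrow> v \<in> col_labels A' \<Longrightarrow>
      entry A' u v = \<iota> (r u * s v * b (replace u v B'))"
    by (rule bracket_scaledE[OF A'(2)]) (rule that)
  have fin: "finite (row_labels A')" "finite (col_labels A')" by (simp_all add: A'(4,5) ground_P8)
  have labels: "0 \<in> row_labels A'" "1 \<in> row_labels A'" "6 \<in> col_labels A'" "7 \<in> col_labels A'"
    by (simp_all add: A'(4,5) ground_P8)
  define d where "d u v = tuple_det p8_column (replace u v B')" for u v
  \<comment> \<open>Only the set of entries of \<open>B'\<close> is known. Their order contributes a
    sign, which occurs twice in each product of two minors.\<close>
  have "mset B' = mset [0, 1, 2, 3]"
    by (rule set_eq_iff_mset_eq_distinct[THEN iffD1])
      (use basis_tuple_distinct[OF Bt] A'(3) in simp_all)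
  then obtain \<sigma> where \<sigma>: "\<sigma> permutes {..<length [0, 1, 2, 3 :: nat]}" "permute_list \<sigma> [0, 1, 2, 3] = B'"
    by (rule mset_eq_permutation)
  have d: "d u v = sign \<sigma> * tuple_det p8_column (replace u v [0, 1, 2, 3])" for u v
    using tuple_det_permute[of \<sigma> "replace u v [0, 1, 2, 3]" p8_column] \<sigma>
      permute_list_map[OF \<sigma>(1), of "\<lambda>w. if w = u then v else w"]
    by (simp add: d_def)
  have "d 0 6 = sign \<sigma>" "d 0 7 = sign \<sigma> * 2" "d 1 6 = sign \<sigma>" "d 1 7 = sign \<sigma>"
    unfolding d by (simp_all add: tuple_det_4 p8_column_def)
  moreover have "sign \<sigma> * sign \<sigma> = 1" by simp
  ultimately have dd: "d 0 6 * d 1 7 = 1" "d 0 7 * d 1 6 = 2"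
    and nz: "d 0 6 \<noteq> 0" "d 0 7 \<noteq> 0" "d 1 6 \<noteq> 0" "d 1 7 \<noteq> 0" by auto
  have unit: "b (replace u v B') dvd 1" if "v < 8" "d u v \<noteq> 0" for u v
  proof -
    have "replace u v B' \<in> tuples P8" using Bt that(1) by (auto simp: basis_tuples_def tuples_P8)
    then show ?thesis using that(2) p8_basis_iff unfolding d_def
      by (intro basis_unit) (simp add: basis_tuples_def del: set_map)
  qed
  define e where "e u v = r u * s v * b (replace u v B')" for u v
  have eu: "e 0 6 dvd 1" "e 0 7 dvd 1" "e 1 6 dvd 1" "e 1 7 dvd 1"
    unfolding e_def using labels r s nz by (auto intro!: dvd_1_mult unit)
  have eA: "entry A' 0 6 = \<iota> (e 0 6)" "entry A' 0 7 = \<iota> (e 0 7)"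
    "entry A' 1 6 = \<iota> (e 1 6)" "entry A' 1 7 = \<iota> (e 1 7)"
    unfolding e_def using labels by (auto intro!: rs)
  have xy: "0 \<in> set B'" "1 \<in> set B'" "(0::nat) \<noteq> 1" "(6::nat) < 8" "(7::nat) < 8"
    using A'(3) by simp_all
  obtain \<kappa> where \<kappa>: "b (replace 0 6 B') * b (replace 1 7 B') = \<kappa> * of_int (d 0 6 * d 1 7)"
    "b (replace 0 7 B') * b (replace 1 6 B') = \<kappa> * of_int (d 0 7 * d 1 6)"
    by (rule replaced_products[OF Bt xy]) (rule that, simp_all only: d_def)
  define K where "K = r 0 * r 1 * s 6 * s 7 * \<kappa>"
  have "e 0 6 * e 1 7 = r 0 * r 1 * s 6 * s 7 * (b (replace 0 6 B') * b (replace 1 7 B'))"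
    unfolding e_def by (simp only: ac_simps)
  then have e1: "e 0 6 * e 1 7 = K" unfolding \<kappa> dd K_def by simp
  have "e 0 7 * e 1 6 = r 0 * r 1 * s 6 * s 7 * (b (replace 0 7 B') * b (replace 1 6 B'))"
    unfolding e_def by (simp only: ac_simps)
  then have e2: "e 0 7 * e 1 6 = 2 * K" unfolding \<kappa> dd K_def by (simp add: ac_simps)
  have neq: "(0::nat) \<noteq> 1" "(6::nat) \<noteq> 7" by simp_all
  show "\<iota> 2 \<in> matrix_cross_ratios R A"
    by (rule cross_ratio_of_minor[OF A'(1) fin labels(1,2) neq(1) labels(3,4) neq(2) eA eu(1,2,4)])
      (simp only: e1 e2)
  have "h * (e 1 6 * e 0 7) = (2 * h) * K" unfolding mult.commute[of "e 1 6"] e2 by (simp only: ac_simps)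
  then have "h * (e 1 6 * e 0 7) = e 1 7 * e 0 6" unfolding h mult.commute[of "e 1 7"] e1 by simp
  then show "\<iota> h \<in> matrix_cross_ratios R A"
    by (rule cross_ratio_of_minor[OF A'(1) fin labels(2,1) neq(1)[symmetric] labels(3,4) neq(2)
        eA(3,4,1,2) eu(3,4,2)])
qed

end

section \<open>Dyadic partial fields\<close>

lemma dyadic_units_one: "1 \<in> dyadic_units"
  unfolding dyadic_units_def by (intro CollectI exI[of _ 0] disjI1) simp

lemma dyadic_units_minus_one: "-1 \<in> dyadic_units"
  unfolding dyadic_units_def by (intro CollectI exI[of _ 0] disjI2) simp

lemma dyadic_units_two: "2 \<in> dyadic_units"
  unfolding dyadic_units_def by (intro CollectI exI[of _ 1] exI[of _ 0] disjI1) simp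

lemma dyadic_units_half: "2 * h = 1 \<Longrightarrow> h \<in> dyadic_units"
  unfolding dyadic_units_def
  by (intro CollectI exI[of _ 0] exI[of _ 1] disjI1) (simp add: mult.commute)

lemma dyadic_unitsE:
  assumes "x \<in> dyadic_units"
  obtains \<epsilon> m n where "\<epsilon> = 1 \<or> \<epsilon> = -1" "x * 2 ^ n = \<epsilon> * 2 ^ m"
proof -
  obtain m n where "x * 2 ^ n = 2 ^ m \<or> x * 2 ^ n = - (2 ^ m)"
    using assms unfolding dyadic_units_def by (elim CollectE exE)
  then have "x * 2 ^ n = 1 * 2 ^ m \<or> x * 2 ^ n = -1 * 2 ^ m" by simp
  then show thesis by (elim disjE) (rule that[of 1 n m], simp_all, rule that[of "-1" n m], simp_all)
qed

lemma dyadic_units_mult: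
  assumes "x \<in> dyadic_units" "y \<in> dyadic_units"
  shows "x * y \<in> dyadic_units"
proof -
  obtain \<epsilon> m n where x: "\<epsilon> = 1 \<or> \<epsilon> = -1" "x * 2 ^ n = \<epsilon> * 2 ^ m"
    using assms(1) by (rule dyadic_unitsE)
  obtain \<delta> k l where y: "\<delta> = 1 \<or> \<delta> = -1" "y * 2 ^ l = \<delta> * 2 ^ k"
    using assms(2) by (rule dyadic_unitsE)
  have "x * y * 2 ^ (n + l) = (x * 2 ^ n) * (y * 2 ^ l)" by (simp only: power_add ac_simps)
  also have "\<dots> = \<epsilon> * \<delta> * 2 ^ (m + k)" unfolding x(2) y(2) by (simp only: power_add ac_simps)
  finally have "x * y * 2 ^ (n + l) = 2 ^ (m + k) \<or> x * y * 2 ^ (n + l) = - (2 ^ (m + k))"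
    using x(1) y(1) by (elim disjE) simp_all
  then show ?thesis unfolding dyadic_units_def by blast
qed

lemma dyadic_units_eq:
  fixes h x :: "'r::comm_ring_1"
  assumes h: "2 * h = 1" and "x \<in> dyadic_units"
  obtains \<epsilon> m n where "\<epsilon> = 1 \<or> \<epsilon> = -1" "x = \<epsilon> * 2 ^ m * h ^ n"
proof -
  obtain \<epsilon> m n where x: "\<epsilon> = 1 \<or> \<epsilon> = -1" "x * 2 ^ n = \<epsilon> * 2 ^ m"
    using assms(2) by (rule dyadic_unitsE)
  have "x = x * (2 * h) ^ n" by (simp add: h)
  also have "\<dots> = x * 2 ^ n * h ^ n" by (simp only: power_mult_distrib mult.assoc)
  finally show thesis using that[OF x(1), of m n] by (simp only: x(2))
qed

lemma dyadic_units_inverse: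
  fixes h x :: "'r::comm_ring_1"
  assumes h: "2 * h = 1" and x: "x \<in> dyadic_units"
  obtains y where "y \<in> dyadic_units" "x * y = 1"
proof -
  obtain \<epsilon> m n where \<epsilon>: "\<epsilon> = 1 \<or> \<epsilon> = -1" and eq: "x = \<epsilon> * 2 ^ m * h ^ n"
    using h x by (rule dyadic_units_eq)
  let ?y = "\<epsilon> * 2 ^ n * h ^ m"
  have "x * ?y = (\<epsilon> * \<epsilon>) * (2 * h) ^ m * (2 * h) ^ n"
    unfolding eq by (simp only: power_mult_distrib ac_simps)
  then have 1: "x * ?y = 1" using \<epsilon> by (elim disjE) (simp_all add: h)
  have "?y * 2 ^ m = \<epsilon> * 2 ^ n * (2 * h) ^ m" by (simp only: power_mult_distrib ac_simps)
  then have "?y * 2 ^ m = 2 ^ n \<or> ?y * 2 ^ m = - (2 ^ n)" using \<epsilon> by (elim disjE) (simp_all add: h)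
  then have "?y \<in> dyadic_units" unfolding dyadic_units_def by blast
  then show thesis using 1 by (rule that)
qed

context ring_representation
begin

text \<open>Applies to both partial fields, because bounds on the generators suffice:
  \<open>h\<close> brings every dyadic unit into the generated ring, 2 and -1 generate the group of
  dyadic units, and all nonzero generators are themselves dyadic units.\<close>

lemma dyadic_partial_field:
  assumes h: "2 * h = 1"
    and C: "C \<subseteq> \<iota> ` insert 0 dyadic_units" "\<iota> h \<in> C"
    and C': "C' \<subseteq> \<iota> ` insert 0 dyadic_units" "\<iota> 2 \<in> C'" "\<iota> (-1) \<in> C'"
  defines "S \<equiv> subring_gen R C"
  shows "is_partial_field (S, mult_group_gen S C')"
    and "pf_set (S, mult_group_gen S C') = \<iota> ` insert 0 dyadic_units"
proof -
  define K where "K = generate_ring R C"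
  have CR: "C \<subseteq> carrier R" using C(1) by auto
  have S: "S = R\<lparr>carrier := K\<rparr>" by (simp add: S_def subring_gen_def K_def)
  have sub: "subring K R" unfolding K_def using CR by (rule generate_ring_is_subring)
  have KR: "K \<subseteq> carrier R" using sub by (rule subringE(1))
  have S_cring: "cring S"
    unfolding S using subcring_iff[OF KR] subcringI'[OF sub] by blast
  interpret S: cring S by (rule S_cring)
  have KT: "\<iota> (x * y) \<in> K" if "\<iota> x \<in> K" "\<iota> y \<in> K" for x y
    unfolding mult using sub that by (rule subringE(6))
  have Kpow: "\<iota> (x ^ n) \<in> K" if "\<iota> x \<in> K" for x n
    by (induction n) (use sub that KT in \<open>simp_all add: one subringE(3)\<close>)
  have K1: "\<iota> 1 \<in> K" unfolding one using sub by (rule subringE(3))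
  have Km1: "\<iota> (-1) \<in> K" unfolding uminus using sub K1 by (rule subringE(5))
  have "\<iota> (1 + 1) \<in> K" unfolding add using sub K1 K1 by (rule subringE(7))
  then have K2: "\<iota> 2 \<in> K" by simp
  have Kh: "\<iota> h \<in> K" unfolding K_def using C(2) by (rule generate_ring.incl)
  have DK: "\<iota> x \<in> K" if x: "x \<in> dyadic_units" for x
  proof -
    obtain \<epsilon> m n where \<epsilon>: "\<epsilon> = 1 \<or> \<epsilon> = -1" and eq: "x = \<epsilon> * 2 ^ m * h ^ n"
      using h x by (rule dyadic_units_eq)
    have "\<iota> \<epsilon> \<in> K" using \<epsilon> K1 Km1 by (elim disjE) simp_all
    then show ?thesis unfolding eq by (intro KT Kpow K2 Kh)
  qed
  \<comment> \<open>Units are taken in the generated ring \<open>S\<close> and not in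
    \<open>R\<close>, so the inverse has to lie in \<open>K\<close> too.\<close>
  have unit: "\<iota> x \<in> Units S" and inv: "\<exists>y\<in>dyadic_units. inv\<^bsub>units_of S\<^esub> (\<iota> x) = \<iota> y"
    if x: "x \<in> dyadic_units" for x
  proof -
    obtain y where y: "y \<in> dyadic_units" "x * y = 1" using h x by (rule dyadic_units_inverse)
    have 1: "\<iota> x \<otimes>\<^bsub>S\<^esub> \<iota> y = \<one>\<^bsub>S\<^esub>" "\<iota> y \<otimes>\<^bsub>S\<^esub> \<iota> x = \<one>\<^bsub>S\<^esub>"
      using y(2) by (simp_all add: S one mult.commute[of y x] flip: mult)
    have car: "\<iota> x \<in> carrier S" "\<iota> y \<in> carrier S" using DK x y(1) by (simp_all add: S)
    have u: "\<iota> x \<in> Units S" unfolding Units_def using car 1 by blast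
    have i: "inv\<^bsub>S\<^esub> (\<iota> x) = \<iota> y" using car 1 by (rule S.inv_char)
    show "\<iota> x \<in> Units S" by (rule u)
    show "\<exists>y\<in>dyadic_units. inv\<^bsub>units_of S\<^esub> (\<iota> x) = \<iota> y"
      using y(1) i u by (auto simp: S.units_of_inv)
  qed
  interpret U: comm_group "units_of S" by (rule S.units_comm_group)
  have multU: "\<iota> x \<otimes>\<^bsub>units_of S\<^esub> \<iota> y = \<iota> (x * y)" for x y
    by (simp add: units_of_def S mult)
  have sgD: "subgroup (\<iota> ` dyadic_units) (units_of S)"
  proof (rule U.subgroupI)
    show "\<iota> ` dyadic_units \<subseteq> carrier (units_of S)" using unit by (auto simp: units_of_def)
    show "\<iota> ` dyadic_units \<noteq> {}" using dyadic_units_one by blast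
    show "inv\<^bsub>units_of S\<^esub> a \<in> \<iota> ` dyadic_units" if "a \<in> \<iota> ` dyadic_units" for a
      using that inv by auto
    show "a \<otimes>\<^bsub>units_of S\<^esub> a' \<in> \<iota> ` dyadic_units"
      if "a \<in> \<iota> ` dyadic_units" "a' \<in> \<iota> ` dyadic_units" for a a'
      using that by (auto simp: multU intro!: imageI dyadic_units_mult)
  qed
  let ?C = "C' - {\<zero>\<^bsub>S\<^esub>}"
  have C0: "?C \<subseteq> \<iota> ` dyadic_units" using C'(1) by (auto simp: S zero)
  then have CU: "?C \<subseteq> carrier (units_of S)" using unit by (auto simp: units_of_def)
  define G where "G = generate (units_of S) ?C"
  have G: "mult_group_gen S C' = G" by (simp add: mult_group_gen_def G_def)
  have sgG: "subgroup G (units_of S)" unfolding G_def using CU by (rule U.generate_is_subgroup)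
  have "G \<subseteq> \<iota> ` dyadic_units" unfolding G_def using C0 sgD by (rule U.generate_subgroup_incl)
  moreover have "\<iota> x \<in> G" if x: "x \<in> dyadic_units" for x
  proof -
    obtain \<epsilon> m n where \<epsilon>: "\<epsilon> = 1 \<or> \<epsilon> = -1" and eq: "x = \<epsilon> * 2 ^ m * h ^ n"
      using h x by (rule dyadic_units_eq)
    have GT: "\<iota> (x * y) \<in> G" if "\<iota> x \<in> G" "\<iota> y \<in> G" for x y
      using subgroup.m_closed[OF sgG that] by (simp only: multU)
    have G1: "\<iota> 1 \<in> G" using subgroup.one_closed[OF sgG] by (simp add: units_of_def S one)
    have Gpow: "\<iota> (x ^ n) \<in> G" if "\<iota> x \<in> G" for x n
      by (induction n) (use that GT G1 in simp_all)
    \<comment> \<open>\<open>mult_group_gen\<close> discards zero, so 2 counts as a generator only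
      after it is known to be nonzero.\<close>
    have "(2 :: 't) \<noteq> 0" using h by (metis mult_zero_left zero_neq_one)
    then have G2: "\<iota> 2 \<in> G" unfolding G_def using C'(2) by (intro generate.incl) (simp add: S)
    have Gm1: "\<iota> (-1) \<in> G" unfolding G_def using C'(3) by (intro generate.incl) (simp add: S)
    have "inv\<^bsub>units_of S\<^esub> (\<iota> 2) = \<iota> h"
    proof (rule U.inv_equality)
      show "\<iota> h \<otimes>\<^bsub>units_of S\<^esub> \<iota> 2 = \<one>\<^bsub>units_of S\<^esub>"
        using h unfolding multU by (simp add: units_of_def S one mult.commute)
    qed (use unit[OF dyadic_units_two] unit[OF dyadic_units_half[OF h]] in
        \<open>simp_all add: units_of_def\<close>)
    then have Gh: "\<iota> h \<in> G" using subgroup.m_inv_closed[OF sgG G2] by simp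
    have "\<iota> \<epsilon> \<in> G" using \<epsilon> G1 Gm1 by (elim disjE) simp_all
    then show ?thesis unfolding eq by (intro GT Gpow G2 Gh)
  qed
  ultimately have GD: "G = \<iota> ` dyadic_units" by (intro subset_antisym image_subsetI)
  have "\<ominus>\<^bsub>S\<^esub> \<one>\<^bsub>S\<^esub> = \<iota> (-1)"
  proof (rule S.minus_equality)
    show "\<iota> (-1) \<oplus>\<^bsub>S\<^esub> \<one>\<^bsub>S\<^esub> = \<zero>\<^bsub>S\<^esub>" by (simp add: S flip: one zero add)
  qed (use K1 Km1 in \<open>simp_all add: S one\<close>)
  then show "is_partial_field (S, mult_group_gen S C')"
    using S_cring sgG dyadic_units_minus_one unfolding is_partial_field_def G GD by auto
  show "pf_set (S, mult_group_gen S C') = \<iota> ` insert 0 dyadic_units"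
    unfolding pf_set_def snd_conv G GD by (simp add: S zero)
qed

end

lemma dyadic_units_of_int:
  fixes x :: "'r::comm_ring_1"
  assumes "x \<in> insert 0 dyadic_units"
  obtains n a where "x * 2 ^ n = of_int a"
proof (cases "x = 0")
  case True
  then show thesis using that[of 0 0] by simp
next
  case False
  then have "x \<in> dyadic_units" using assms by simp
  then obtain \<epsilon> :: 'r and m n where "\<epsilon> = 1 \<or> \<epsilon> = -1" "x * 2 ^ n = \<epsilon> * 2 ^ m" by (rule dyadic_unitsE)
  then show thesis using that[of n "2 ^ m"] that[of n "- (2 ^ m)"] by (elim disjE) simp_all
qed

text \<open>The source may be larger than Z[1/2]; the element \<open>h\<close> only ensures that it
  contains an inverse of 2.\<close>

locale dyadic_hom =
  fixes \<Phi> :: "'t::comm_ring_1 \<Rightarrow> rat" and h :: 't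
  assumes add: "\<Phi> (x + y) = \<Phi> x + \<Phi> y" and mult: "\<Phi> (x * y) = \<Phi> x * \<Phi> y" and one: "\<Phi> 1 = 1"
    and h: "2 * h = 1"
begin

lemma zero: "\<Phi> 0 = 0"
  using add[of 0 0] by simp

lemma uminus: "\<Phi> (- x) = - \<Phi> x"
  using add[of x "- x"] zero by (simp add: eq_neg_iff_add_eq_0 add.commute)

lemma of_nat: "\<Phi> (of_nat n) = of_nat n"
  by (induction n) (simp_all add: zero one add)

lemma of_int: "\<Phi> (of_int a) = of_int a"
  by (cases a) (simp_all add: of_nat uminus flip: of_nat_Suc)

lemma two: "\<Phi> 2 = 2"
  using of_int[of 2] by simp

lemma pow: "\<Phi> (x ^ n) = \<Phi> x ^ n"
  by (induction n) (simp_all add: one mult)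

lemma two_power_cancel: "x * 2 ^ n = y * 2 ^ n \<Longrightarrow> x = (y :: 't)"
proof -
  have u: "(2 :: 't) ^ n * h ^ n = 1" using h by (simp flip: power_mult_distrib)
  assume "x * 2 ^ n = y * 2 ^ n"
  then have "x * (2 ^ n * h ^ n) = y * (2 ^ n * h ^ n)" by (simp flip: mult.assoc)
  then show "x = y" by (simp only: u mult_1_right)
qed

text \<open>A common power of 2 turns \<open>x\<close> and \<open>y\<close> into integers, which
  \<open>\<Phi>\<close> fixes and which are distinguished in the rationals. The power is cancelled
  by means of \<open>h\<close>.\<close>

lemma dyadic_inj:
  assumes x: "x * 2 ^ n = of_int a" and y: "y * 2 ^ m = of_int c" and eq: "\<Phi> x = \<Phi> y"
  shows "x = y"
proof -
  have xa: "\<Phi> x * 2 ^ n = of_int a" and yc: "\<Phi> y * 2 ^ m = of_int c"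
    using arg_cong[OF x, of \<Phi>] arg_cong[OF y, of \<Phi>] by (simp_all add: mult pow two of_int)
  have "rat_of_int (a * 2 ^ m) = \<Phi> x * 2 ^ n * 2 ^ m" by (simp add: xa)
  also have "\<dots> = \<Phi> y * 2 ^ m * 2 ^ n" unfolding eq by (simp only: ac_simps)
  also have "\<dots> = rat_of_int (c * 2 ^ n)" by (simp add: yc)
  finally have ac: "a * 2 ^ m = c * 2 ^ n" by (simp only: of_int_eq_iff)
  have "x * 2 ^ (n + m) = (x * 2 ^ n) * 2 ^ m" by (simp only: power_add mult.assoc)
  also have "\<dots> = of_int (a * 2 ^ m)" by (simp add: x)
  also have "\<dots> = (y * 2 ^ m) * 2 ^ n" by (simp add: ac y)
  also have "\<dots> = y * 2 ^ (n + m)" by (simp only: power_add ac_simps)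
  finally show ?thesis by (rule two_power_cancel)
qed

lemma dyadic_units_image:
  assumes "x \<in> insert 0 dyadic_units"
  shows "\<Phi> x \<in> insert 0 dyadic_units"
proof (cases "x = 0")
  case False
  then have "x \<in> dyadic_units" using assms by simp
  then obtain \<epsilon> :: 't and m n where \<epsilon>: "\<epsilon> = 1 \<or> \<epsilon> = -1" and "x * 2 ^ n = \<epsilon> * 2 ^ m" by (rule dyadic_unitsE)
  from this(2) have "\<Phi> x * 2 ^ n = \<Phi> \<epsilon> * 2 ^ m" by (metis mult pow two)
  then have "\<Phi> x * 2 ^ n = 2 ^ m \<or> \<Phi> x * 2 ^ n = - (2 ^ m)"
    using \<epsilon> by (elim disjE) (simp_all add: one uminus)
  then show ?thesis unfolding dyadic_units_def by blast
qed (simp add: zero)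

lemma dyadic_units_lift:
  assumes "q \<in> insert 0 dyadic_units"
  obtains x where "x \<in> insert 0 dyadic_units" "\<Phi> x = q"
proof (cases "q = 0")
  case True
  then show thesis using that[of 0] by (simp add: zero)
next
  case False
  then have q: "q \<in> dyadic_units" using assms by simp
  have "2 * (1 / 2 :: rat) = 1" by simp
  then obtain \<epsilon> m n where \<epsilon>: "\<epsilon> = 1 \<or> \<epsilon> = -1" and eq: "q = \<epsilon> * 2 ^ m * (1 / 2) ^ n"
    using q by (rule dyadic_units_eq)
  define \<delta> :: 't where "\<delta> = (if \<epsilon> = 1 then 1 else -1)"
  have \<delta>: "\<Phi> \<delta> = \<epsilon>" "\<delta> \<in> dyadic_units"
    using \<epsilon> by (auto simp: \<delta>_def one uminus dyadic_units_one dyadic_units_minus_one)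
  have "2 * \<Phi> h = 1" using arg_cong[OF h, of \<Phi>] by (simp add: mult two one)
  then have "\<Phi> h = 1 / 2" by simp
  then have lift: "\<Phi> (\<delta> * 2 ^ m * h ^ n) = q" by (simp only: mult pow two \<delta> eq)
  have pow': "y ^ k \<in> dyadic_units" if "y \<in> dyadic_units" for y :: 't and k
    by (induction k) (simp_all add: dyadic_units_one dyadic_units_mult that)
  have "\<delta> * 2 ^ m * h ^ n \<in> dyadic_units"
    by (intro dyadic_units_mult pow' \<delta> dyadic_units_two dyadic_units_half h)
  then show thesis by (intro that[OF _ lift] insertI2)
qed

text \<open>Meant for a sum \<open>x\<close> of two elements of the partial field, for the harder
  direction of the condition on sums in an isomorphism: the image has a dyadic preimage, and
  \<open>dyadic_inj\<close> identifies it with \<open>x\<close>.\<close>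

lemma dyadic_units_reflect:
  assumes x: "x * 2 ^ n = of_int a" and "\<Phi> x \<in> insert 0 dyadic_units"
  shows "x \<in> insert 0 dyadic_units"
proof -
  obtain y where y: "y \<in> insert 0 dyadic_units" "\<Phi> y = \<Phi> x"
    using assms(2) by (rule dyadic_units_lift)
  obtain m c where "y * 2 ^ m = of_int c" using y(1) by (rule dyadic_units_of_int)
  then have "y = x" using x y(2) by (rule dyadic_inj)
  then show ?thesis using y(1) by simp
qed

end

lemma (in ring_representation) dyadic_pf_iso:
  fixes \<Phi> :: "'t \<Rightarrow> rat" and Q :: "rat partial_field"
  assumes "dyadic_hom \<Phi> h"
    and P: "pf_set P = \<iota> ` insert 0 dyadic_units" "fst P = R\<lparr>carrier := K\<rparr>"
    and Q: "pf_set Q = insert 0 dyadic_units" "fst Q = class_ring\<lparr>carrier := L\<rparr>"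
  shows "\<exists>\<phi>. pf_iso P Q \<phi>"
proof
  interpret hom: dyadic_hom \<Phi> h by fact
  let ?D = "insert 0 dyadic_units :: 't set"
  define \<phi> where "\<phi> p = \<Phi> (inv_into UNIV \<iota> p)" for p
  have inj: "inj \<iota>" using bij by (rule bij_betw_imp_inj_on)
  have \<phi>: "\<phi> (\<iota> x) = \<Phi> x" for x by (simp add: \<phi>_def inv_f_f[OF inj])
  have ops: "\<one>\<^bsub>fst P\<^esub> = \<iota> 1" "\<And>x y. \<iota> x \<otimes>\<^bsub>fst P\<^esub> \<iota> y = \<iota> (x * y)"
    "\<And>x y. \<iota> x \<oplus>\<^bsub>fst P\<^esub> \<iota> y = \<iota> (x + y)"
    "\<one>\<^bsub>fst Q\<^esub> = 1" "\<And>x y. x \<otimes>\<^bsub>fst Q\<^esub> y = x * y" "\<And>x y. x \<oplus>\<^bsub>fst Q\<^esub> y = x + y"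
    by (simp_all add: P(2) Q(2) one mult add)
  have in_P: "\<iota> x \<in> pf_set P \<longleftrightarrow> x \<in> ?D" for x
    unfolding P(1) by (rule inj_image_mem_iff[OF inj])
  \<comment> \<open>A sum of two elements of \<open>?D\<close> need not lie in \<open>?D\<close>,
    but it still has a power of 2 as denominator.\<close>
  have reflect: "x + y \<in> ?D" if x: "x \<in> ?D" and y: "y \<in> ?D" and "\<Phi> (x + y) \<in> insert 0 dyadic_units" for x y
  proof -
    obtain n a where x: "x * 2 ^ n = of_int a" using x by (rule dyadic_units_of_int)
    obtain m c where y: "y * 2 ^ m = of_int c" using y by (rule dyadic_units_of_int)
    have "(x + y) * 2 ^ (n + m) = (x * 2 ^ n) * 2 ^ m + (y * 2 ^ m) * 2 ^ n"
      by (simp only: power_add distrib_right ac_simps)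
    also have "\<dots> = of_int (a * 2 ^ m + c * 2 ^ n)" by (simp add: x y)
    finally show ?thesis using that(3) by (rule hom.dyadic_units_reflect)
  qed
  have image: "\<Phi> x \<in> pf_set Q" if "x \<in> ?D" for x
    unfolding Q(1) using that by (rule hom.dyadic_units_image)
  show "pf_iso P Q \<phi>"
    unfolding pf_iso_def pf_hom_def
  proof (intro conjI)
    show "\<phi> \<in> pf_set P \<rightarrow> pf_set Q"
    proof
      fix p assume "p \<in> pf_set P"
      then obtain x where "p = \<iota> x" "x \<in> ?D" unfolding P(1) by (rule imageE)
      then show "\<phi> p \<in> pf_set Q" using image by (simp only: \<phi>)
    qed
    show "\<phi> \<one>\<^bsub>fst P\<^esub> = \<one>\<^bsub>fst Q\<^esub>" by (simp only: ops \<phi> hom.one)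
    show "\<forall>p\<in>pf_set P. \<forall>q\<in>pf_set P. \<phi> (p \<otimes>\<^bsub>fst P\<^esub> q) = \<phi> p \<otimes>\<^bsub>fst Q\<^esub> \<phi> q"
      unfolding P(1) by (simp only: ball_simps ops \<phi> hom.mult) simp
    show "\<forall>p\<in>pf_set P. \<forall>q\<in>pf_set P. p \<oplus>\<^bsub>fst P\<^esub> q \<in> pf_set P \<longrightarrow>
        \<phi> p \<oplus>\<^bsub>fst Q\<^esub> \<phi> q = \<phi> (p \<oplus>\<^bsub>fst P\<^esub> q)"
      unfolding P(1) by (simp only: ball_simps ops \<phi> hom.add) simp
    show "bij_betw \<phi> (pf_set P) (pf_set Q)"
    proof (rule bij_betw_imageI)
      show "inj_on \<phi> (pf_set P)"
      proof (rule inj_onI)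
        fix p q assume "p \<in> pf_set P" "q \<in> pf_set P" and eq: "\<phi> p = \<phi> q"
        obtain x where p: "p = \<iota> x" "x \<in> ?D" using \<open>p \<in> pf_set P\<close> unfolding P(1) by (rule imageE)
        obtain y where q: "q = \<iota> y" "y \<in> ?D" using \<open>q \<in> pf_set P\<close> unfolding P(1) by (rule imageE)
        obtain n a where x: "x * 2 ^ n = of_int a" using p(2) by (rule dyadic_units_of_int)
        obtain m c where y: "y * 2 ^ m = of_int c" using q(2) by (rule dyadic_units_of_int)
        have "\<Phi> x = \<Phi> y" using eq by (simp only: p(1) q(1) \<phi>)
        then have "x = y" by (rule hom.dyadic_inj[OF x y])
        then show "p = q" by (simp only: p q)
      qed
      show "\<phi> ` pf_set P = pf_set Q"
      proof (intro subset_antisym subsetI)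
        fix q assume "q \<in> \<phi> ` pf_set P"
        then obtain x where "q = \<phi> (\<iota> x)" "x \<in> ?D" unfolding P(1) image_image by (rule imageE)
        then show "q \<in> pf_set Q" using image by (simp only: \<phi>)
      next
        fix q assume "q \<in> pf_set Q"
        then obtain x where "x \<in> ?D" "\<Phi> x = q" unfolding Q(1) by (rule hom.dyadic_units_lift)
        then show "q \<in> \<phi> ` pf_set P" using \<phi>[of x] in_P[of x] by (metis imageI)
      qed
    qed
    show "\<forall>p\<in>pf_set P. \<forall>q\<in>pf_set P.
        \<phi> p \<oplus>\<^bsub>fst Q\<^esub> \<phi> q \<in> pf_set Q \<longleftrightarrow> p \<oplus>\<^bsub>fst P\<^esub> q \<in> pf_set P"
    proof (intro ballI)
      fix p q assume "p \<in> pf_set P" "q \<in> pf_set P"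
      obtain x where p: "p = \<iota> x" "x \<in> ?D" using \<open>p \<in> pf_set P\<close> unfolding P(1) by (rule imageE)
      obtain y where q: "q = \<iota> y" "y \<in> ?D" using \<open>q \<in> pf_set P\<close> unfolding P(1) by (rule imageE)
      have "\<Phi> (x + y) \<in> pf_set Q \<longleftrightarrow> x + y \<in> ?D"
        using reflect[OF p(2) q(2)] image[of "x + y"] unfolding Q(1) by (rule iffI)
      then show "\<phi> p \<oplus>\<^bsub>fst Q\<^esub> \<phi> q \<in> pf_set Q \<longleftrightarrow> p \<oplus>\<^bsub>fst P\<^esub> q \<in> pf_set P"
        by (simp only: p(1) q(1) ops \<phi> in_P hom.add)
    qed
  qed
qed

section \<open>The bracket ring\<close>

lemma cring_class_ring: "cring (class_ring :: 'r::comm_ring_1 ring)"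
proof (rule cringI)
  show "abelian_group (class_ring :: 'r ring)"
    by (rule abelian_groupI) (auto simp: add.assoc add.commute intro: exI[of _ "- x" for x])
  show "comm_monoid (class_ring :: 'r ring)"
    by (rule comm_monoidI) (auto simp: mult.assoc mult.commute)
qed (simp add: distrib_right)

lemma poly_mapping_sum_single:
  "p = (\<Sum>m\<in>Poly_Mapping.keys p. Poly_Mapping.single m (Poly_Mapping.lookup p m))"
proof (rule poly_mapping_eqI)
  fix m
  have "(\<Sum>k\<in>Poly_Mapping.keys p. Poly_Mapping.lookup p k when k = m) = Poly_Mapping.lookup p m"
    by (simp add: when_def in_keys_iff)
  then show "Poly_Mapping.lookup p m =
      Poly_Mapping.lookup (\<Sum>m\<in>Poly_Mapping.keys p. Poly_Mapping.single m (Poly_Mapping.lookup p m)) m"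
    by (simp add: lookup_sum lookup_single)
qed

section \<open>Evaluation of integer polynomials\<close>

definition eval_monom :: "('s \<Rightarrow> 'r::comm_ring_1) \<Rightarrow> ('s \<Rightarrow>\<^sub>0 nat) \<Rightarrow> 'r" where
  "eval_monom f m = (\<Prod>x\<in>Poly_Mapping.keys m. f x ^ Poly_Mapping.lookup m x)"

definition eval_poly :: "('s \<Rightarrow> 'r::comm_ring_1) \<Rightarrow> (('s \<Rightarrow>\<^sub>0 nat) \<Rightarrow>\<^sub>0 int) \<Rightarrow> 'r" where
  "eval_poly f p = (\<Sum>m\<in>Poly_Mapping.keys p. of_int (Poly_Mapping.lookup p m) * eval_monom f m)"

text \<open>A common finite index set lets the evaluations of two arguments and of their sum be
  compared term by term.\<close>

lemma eval_monom_superset: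
  "finite X \<Longrightarrow> Poly_Mapping.keys m \<subseteq> X \<Longrightarrow>
    eval_monom f m = (\<Prod>x\<in>X. f x ^ Poly_Mapping.lookup m x)"
  unfolding eval_monom_def by (rule prod.mono_neutral_left) (auto simp: in_keys_iff)

lemma eval_poly_superset:
  "finite X \<Longrightarrow> Poly_Mapping.keys p \<subseteq> X \<Longrightarrow>
    eval_poly f p = (\<Sum>m\<in>X. of_int (Poly_Mapping.lookup p m) * eval_monom f m)"
  unfolding eval_poly_def by (rule sum.mono_neutral_left) (auto simp: in_keys_iff)

lemma eval_monom_add: "eval_monom f (m + n) = eval_monom f m * eval_monom f n"
proof -
  let ?X = "Poly_Mapping.keys m \<union> Poly_Mapping.keys n"
  have "Poly_Mapping.keys (m + n) \<subseteq> ?X" by (rule keys_add)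
  then show ?thesis
    by (simp add: eval_monom_superset[of ?X] lookup_add power_add prod.distrib)
qed

lemma eval_poly_add: "eval_poly f (p + q) = eval_poly f p + eval_poly f q"
proof -
  let ?X = "Poly_Mapping.keys p \<union> Poly_Mapping.keys q"
  have "Poly_Mapping.keys (p + q) \<subseteq> ?X" by (rule keys_add)
  then show ?thesis
    by (simp add: eval_poly_superset[of ?X] lookup_add distrib_right sum.distrib)
qed

lemma eval_poly_single: "eval_poly f (Poly_Mapping.single m c) = of_int c * eval_monom f m"
  by (cases "c = 0") (simp_all add: eval_poly_def)

lemma eval_poly_sum: "eval_poly f (sum g X) = (\<Sum>x\<in>X. eval_poly f (g x))"
  by (induction X rule: infinite_finite_induct) (simp_all add: eval_poly_add, simp_all add: eval_poly_def)

text \<open>Both factors are written as sums of monomials, so the support of the product, where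
  terms may cancel, need not be described.\<close>

lemma eval_poly_mult: "eval_poly f (p * q) = eval_poly f p * eval_poly f q"
proof -
  let ?s = "\<lambda>p m. Poly_Mapping.single m (Poly_Mapping.lookup p m)"
  have "p * q = (\<Sum>m\<in>Poly_Mapping.keys p. ?s p m) * (\<Sum>n\<in>Poly_Mapping.keys q. ?s q n)"
    by (simp only: poly_mapping_sum_single[symmetric])
  also have "\<dots> = (\<Sum>m\<in>Poly_Mapping.keys p. \<Sum>n\<in>Poly_Mapping.keys q.
      Poly_Mapping.single (m + n) (Poly_Mapping.lookup p m * Poly_Mapping.lookup q n))"
    by (simp add: sum_product mult_single)
  also have "eval_poly f \<dots> = (\<Sum>m\<in>Poly_Mapping.keys p. \<Sum>n\<in>Poly_Mapping.keys q.
      (of_int (Poly_Mapping.lookup p m) * eval_monom f m)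
        * (of_int (Poly_Mapping.lookup q n) * eval_monom f n))"
    by (simp add: eval_poly_sum eval_poly_single eval_monom_add ac_simps)
  also have "\<dots> = eval_poly f p * eval_poly f q"
    by (simp add: eval_poly_def sum_product)
  finally show ?thesis .
qed

lemma eval_poly_one: "eval_poly f 1 = 1"
  using eval_poly_single[of f 0 1] by (simp add: eval_monom_def)

lemma eval_poly_bvar: "eval_poly f (bvar s) = f s"
  by (simp add: bvar_def eval_poly_single eval_monom_def)

lemma eval_poly_uminus: "eval_poly f (- p) = - eval_poly f p"
  by (simp add: eval_poly_def sum_negf)

lemma eval_poly_minus: "eval_poly f (p - q) = eval_poly f p - eval_poly f q"
  using eval_poly_add[of f p "- q"] by (simp add: eval_poly_uminus)

lemma eval_poly_of_int:
  fixes f :: "'s \<Rightarrow> 'r::comm_ring_1"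
  shows "eval_poly f (of_int a) = of_int a"
proof -
  have "(of_int a :: ('s \<Rightarrow>\<^sub>0 nat) \<Rightarrow>\<^sub>0 int) = Poly_Mapping.single 0 a" by (simp flip: single_of_int)
  moreover have "eval_poly f (Poly_Mapping.single 0 a) = of_int a"
    by (simp add: eval_poly_single eval_monom_def)
  ultimately show ?thesis by (simp only:)
qed

section \<open>The bracket ring as a quotient\<close>

definition bracket_polys :: "'a matroid \<Rightarrow> 'a bracket_poly set" where
  "bracket_polys M = {p. \<forall>m\<in>Poly_Mapping.keys p. Poly_Mapping.keys m \<subseteq> bracket_symbols M}"

lemma bracket_poly_ring_eq: "bracket_poly_ring M = class_ring\<lparr>carrier := bracket_polys M\<rparr>"
  by (simp add: bracket_poly_ring_def bracket_polys_def)

lemma bracket_polys_closed: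
  "0 \<in> bracket_polys M" "1 \<in> bracket_polys M" "of_int a \<in> bracket_polys M"
  "p \<in> bracket_polys M \<Longrightarrow> - p \<in> bracket_polys M"
  "p \<in> bracket_polys M \<Longrightarrow> q \<in> bracket_polys M \<Longrightarrow> p + q \<in> bracket_polys M"
  "p \<in> bracket_polys M \<Longrightarrow> q \<in> bracket_polys M \<Longrightarrow> p - q \<in> bracket_polys M"
  "p \<in> bracket_polys M \<Longrightarrow> q \<in> bracket_polys M \<Longrightarrow> p * q \<in> bracket_polys M"
  "s \<in> bracket_symbols M \<Longrightarrow> bvar s \<in> bracket_polys M"
proof -
  show "0 \<in> bracket_polys M" by (simp add: bracket_polys_def)
  show int: "of_int a \<in> bracket_polys M" for a
    by (cases "a = 0") (simp_all add: bracket_polys_def flip: single_of_int)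
  show "1 \<in> bracket_polys M" using int[of 1] by simp
  show um: "- p \<in> bracket_polys M" if "p \<in> bracket_polys M" for p
    using that by (simp add: bracket_polys_def)
  show pl: "p + q \<in> bracket_polys M" if "p \<in> bracket_polys M" "q \<in> bracket_polys M" for p q
    using that keys_add[of p q] unfolding bracket_polys_def by blast
  show "p - q \<in> bracket_polys M" if "p \<in> bracket_polys M" "q \<in> bracket_polys M" for p q
    using pl[OF that(1) um[OF that(2)]] by simp
  show "p * q \<in> bracket_polys M" if pq: "p \<in> bracket_polys M" "q \<in> bracket_polys M" for p q
    unfolding bracket_polys_def
  proof (intro CollectI ballI)
    fix k assume "k \<in> Poly_Mapping.keys (p * q)"
    then obtain m n where k: "k = m + n" and mn: "m \<in> Poly_Mapping.keys p" "n \<in> Poly_Mapping.keys q"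
      using keys_mult[of p q] by blast
    have "Poly_Mapping.keys m \<subseteq> bracket_symbols M" "Poly_Mapping.keys n \<subseteq> bracket_symbols M"
      using mn pq unfolding bracket_polys_def by blast+
    then show "Poly_Mapping.keys k \<subseteq> bracket_symbols M"
      unfolding k using keys_add[of m n] by blast
  qed
  show "bvar s \<in> bracket_polys M" if "s \<in> bracket_symbols M"
    using that by (simp add: bracket_polys_def bvar_def)
qed

lemma (in cring) cring_restrict_carrier:
  assumes "H \<subseteq> carrier R" "\<one> \<in> H" "\<And>h. h \<in> H \<Longrightarrow> \<ominus> h \<in> H"
    "\<And>g h. g \<in> H \<Longrightarrow> h \<in> H \<Longrightarrow> g \<otimes> h \<in> H" "\<And>g h. g \<in> H \<Longrightarrow> h \<in> H \<Longrightarrow> g \<oplus> h \<in> H"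
  shows "cring (R\<lparr>carrier := H\<rparr>)"
proof -
  have "subring H R" by (rule subringI[OF assms])
  then show ?thesis using subcring_iff[OF assms(1)] subcringI' by blast
qed

lemma cring_bracket_poly_ring: "cring (bracket_poly_ring M)"
proof -
  have "abelian_group (class_ring :: 'a bracket_poly ring)"
    by (rule ring.is_abelian_group[OF cring.axioms(1)[OF cring_class_ring]])
  then have neg: "\<ominus>\<^bsub>class_ring\<^esub> p = - p" for p :: "'a bracket_poly"
    by (rule abelian_group.minus_equality) simp_all
  show ?thesis
    unfolding bracket_poly_ring_eq
    by (rule cring.cring_restrict_carrier[OF cring_class_ring])
      (simp_all add: bracket_polys_closed neg)
qed

lemma bracket_relations_subset: "bracket_relations M \<subseteq> bracket_polys M"
proof -
  have br: "br Z \<in> bracket_polys M" if "Z \<in> tuples M" for Z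
    using that by (intro bracket_polys_closed(8)) (simp add: bracket_symbols_def)
  have br_inv: "br_inv Z \<in> bracket_polys M" if "Z \<in> basis_tuples M" for Z
    using that by (intro bracket_polys_closed(8)) (simp add: bracket_symbols_def)
  have perm: "permute_list \<sigma> Z \<in> tuples M"
    if "Z \<in> tuples M" "\<sigma> permutes {..<matroid_rank M}" for Z \<sigma>
    using that by (simp add: tuples_def)
  have tup: "x # y # W \<in> tuples M"
    if "x \<in> ground M" "y \<in> ground M" "set W \<subseteq> ground M" "length W + 2 = matroid_rank M" for x y W
    using that by (simp add: tuples_def)
  have basis: "Z \<in> tuples M" if "Z \<in> basis_tuples M" for Z using that by (simp add: basis_tuples_def)
  show ?thesis
    unfolding bracket_relations_def
    by (auto intro!: bracket_polys_closed br br_inv perm tup dest: basis)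
qed

lemma ideal_bracket_ideal: "ideal (bracket_ideal M) (bracket_poly_ring M)"
  unfolding bracket_ideal_def
  by (rule ring.genideal_ideal[OF cring.axioms(1)[OF cring_bracket_poly_ring]])
    (simp add: bracket_poly_ring_eq bracket_relations_subset)

lemma cring_bracket_ring: "cring (bracket_ring M)"
  unfolding bracket_ring_def
  by (rule ideal.quotient_is_cring[OF ideal_bracket_ideal cring_bracket_poly_ring])

text \<open>The kernel of the evaluation is an ideal that contains the generators of
  \<open>bracket_ideal\<close>.\<close>

lemma eval_poly_bracket_ideal:
  assumes "\<And>p. p \<in> bracket_relations M \<Longrightarrow> eval_poly f p = (0 :: 'r::comm_ring_1)" "p \<in> bracket_ideal M"
  shows "eval_poly f p = 0"
proof -
  let ?K = "{p \<in> bracket_polys M. eval_poly f p = 0}"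
  interpret P: cring "bracket_poly_ring M" by (rule cring_bracket_poly_ring)
  have C: "ring (class_ring :: 'r ring)" by (rule cring.axioms(1)[OF cring_class_ring])
  have "eval_poly f \<in> Ring.ring_hom (bracket_poly_ring M) class_ring"
    by (rule ring_hom_memI) (simp_all add: bracket_poly_ring_eq eval_poly_add eval_poly_mult eval_poly_one)
  then have h: "ring_hom_ring (bracket_poly_ring M) class_ring (eval_poly f)"
    by (rule ring_hom_ringI2[OF P.ring_axioms C])
  have "a_kernel (bracket_poly_ring M) class_ring (eval_poly f) = ?K"
    by (simp add: a_kernel_def' bracket_poly_ring_eq)
  then have "ideal ?K (bracket_poly_ring M)" using ring_hom_ring.kernel_is_ideal[OF h] by simp
  moreover have "bracket_relations M \<subseteq> ?K" using bracket_relations_subset assms(1) by auto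
  ultimately have "bracket_ideal M \<subseteq> ?K" unfolding bracket_ideal_def by (rule P.genideal_minimal)
  then show ?thesis using assms(2) by blast
qed

lemma bracket_coset_hom:
  assumes "p \<in> bracket_polys M" "q \<in> bracket_polys M"
  defines "\<pi> \<equiv> \<lambda>p. bracket_ideal M +>\<^bsub>bracket_poly_ring M\<^esub> p"
  shows "\<pi> (p + q) = \<pi> p \<oplus>\<^bsub>bracket_ring M\<^esub> \<pi> q" "\<pi> (p * q) = \<pi> p \<otimes>\<^bsub>bracket_ring M\<^esub> \<pi> q"
    "\<pi> 1 = \<one>\<^bsub>bracket_ring M\<^esub>" "\<pi> p \<in> carrier (bracket_ring M)"
proof -
  have hom: "\<pi> \<in> Ring.ring_hom (bracket_poly_ring M) (bracket_ring M)"
    unfolding \<pi>_def bracket_ring_def by (rule ideal.rcos_ring_hom[OF ideal_bracket_ideal])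
  show "\<pi> (p + q) = \<pi> p \<oplus>\<^bsub>bracket_ring M\<^esub> \<pi> q"
    using ring_hom_add[OF hom, of p q] assms(1,2) by (simp add: bracket_poly_ring_eq)
  show "\<pi> (p * q) = \<pi> p \<otimes>\<^bsub>bracket_ring M\<^esub> \<pi> q"
    using ring_hom_mult[OF hom, of p q] assms(1,2) by (simp add: bracket_poly_ring_eq)
  show "\<pi> 1 = \<one>\<^bsub>bracket_ring M\<^esub>"
    using ring_hom_one[OF hom] by (simp add: bracket_poly_ring_eq)
  show "\<pi> p \<in> carrier (bracket_ring M)"
    using ring_hom_closed[OF hom, of p] assms(1) by (simp add: bracket_poly_ring_eq)
qed

lemma bracket_coset_relation:
  assumes "p \<in> bracket_relations M"
  shows "bracket_ideal M +>\<^bsub>bracket_poly_ring M\<^esub> p = \<zero>\<^bsub>bracket_ring M\<^esub>"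
proof -
  interpret P: cring "bracket_poly_ring M" by (rule cring_bracket_poly_ring)
  have "p \<in> bracket_ideal M"
    using P.genideal_self[of "bracket_relations M"] bracket_relations_subset[of M] assms
    by (auto simp: bracket_ideal_def bracket_poly_ring_eq)
  then show ?thesis
    using P.a_rcos_zero[OF ideal_bracket_ideal] by (simp add: bracket_ring_def FactRing_def)
qed

lemma bracket_ring_cosetE:
  assumes "X \<in> carrier (bracket_ring M)"
  obtains p where "p \<in> bracket_polys M" "X = bracket_ideal M +>\<^bsub>bracket_poly_ring M\<^esub> p"
  using assms by (auto simp: bracket_ring_def FactRing_def A_RCOSETS_def RCOSETS_def a_r_coset_def
      bracket_poly_ring_eq)

text \<open>The choice of a representative is harmless once \<open>f\<close> satisfies the bracket
  relations, as the next lemma shows.\<close>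

definition coset_eval :: "('a bracket_symbol \<Rightarrow> 'r::comm_ring_1) \<Rightarrow> 'a bracket_poly set \<Rightarrow> 'r" where
  "coset_eval f X = eval_poly f (SOME p. p \<in> X)"

lemma coset_eval:
  assumes f: "\<And>p. p \<in> bracket_relations M \<Longrightarrow> eval_poly f p = 0" and p: "p \<in> bracket_polys M"
  shows "coset_eval f (bracket_ideal M +>\<^bsub>bracket_poly_ring M\<^esub> p) = eval_poly f p"
proof -
  let ?X = "bracket_ideal M +>\<^bsub>bracket_poly_ring M\<^esub> p"
  have X: "?X = {i + p | i. i \<in> bracket_ideal M}"
    by (auto simp: a_r_coset_def' bracket_poly_ring_eq)
  have "0 \<in> bracket_ideal M"
    using additive_subgroup.zero_closed[OF ideal.axioms(1)[OF ideal_bracket_ideal]]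
    by (simp add: bracket_poly_ring_eq)
  then have pX: "p \<in> ?X" unfolding X by force
  define q where "q = (SOME q. q \<in> ?X)"
  have "q \<in> ?X" unfolding q_def using pX by (rule someI)
  then obtain i where "q = i + p" and i: "i \<in> bracket_ideal M"
    unfolding X by (elim CollectE exE conjE)
  then have "eval_poly f q = eval_poly f i + eval_poly f p" by (simp only: eval_poly_add)
  also have "eval_poly f i = 0" by (rule eval_poly_bracket_ideal[OF _ i]) (rule f)
  finally have "eval_poly f q = eval_poly f p" by (simp only: add_0_left)
  then show ?thesis unfolding coset_eval_def q_def .
qed

text \<open>The representation \<open>[I A8]\<close> over the rationals, regarded as a point at
  which all bracket relations hold.\<close>

definition p8_eval :: "nat bracket_symbol \<Rightarrow> rat" where
  "p8_eval s = (case s of Br Z \<Rightarrow> of_int (tuple_det p8_column Z)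
     | BrInv Z \<Rightarrow> inverse (of_int (tuple_det p8_column Z)))"

lemma p8_eval_relations:
  assumes "p \<in> bracket_relations P8"
  shows "eval_poly p8_eval p = 0"
proof -
  note ev = eval_poly_bvar eval_poly_minus eval_poly_mult eval_poly_of_int eval_poly_one
  show ?thesis
    using assms unfolding bracket_relations_def
  proof (elim UnE CollectE exE conjE)
    fix Z assume "p = br Z" "Z \<in> tuples P8" "set Z \<notin> bases P8"
    then show ?thesis using p8_basis_iff[of Z] by (simp add: ev p8_eval_def)
  next
    fix Z \<sigma> assume p: "p = br Z - of_int (sign \<sigma>) * br (permute_list \<sigma> Z)"
      and "Z \<in> tuples P8" "\<sigma> permutes {..<matroid_rank P8}"
    then have "tuple_det p8_column (permute_list \<sigma> Z) = sign \<sigma> * tuple_det p8_column Z"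
      using tuple_det_permute[of \<sigma> Z p8_column] by (simp add: tuples_P8 p8_rank)
    then have "sign \<sigma> * tuple_det p8_column (permute_list \<sigma> Z) = tuple_det p8_column Z"
      by (simp flip: mult.assoc)
    then show ?thesis by (simp add: ev p8_eval_def p flip: of_int_mult)
  next
    fix x1 x2 y1 y2 W assume p: "p = br (x1 # x2 # W) * br (y1 # y2 # W)
        - br (y1 # x2 # W) * br (x1 # y2 # W) - br (y2 # x2 # W) * br (y1 # x1 # W)"
      and "length W + 2 = matroid_rank P8"
    then have "length W = Suc (Suc 0)" by (simp add: p8_rank)
    then obtain w w' where W: "W = [w, w']" by (auto simp: length_Suc_conv)
    show ?thesis
      using pluecker_relation[of p8_column x1 x2 w w' y1 y2]
      unfolding p W by (simp add: ev p8_eval_def flip: of_int_mult of_int_diff)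
  next
    fix Z assume p: "p = br Z * br_inv Z - 1" and "Z \<in> basis_tuples P8"
    then have "tuple_det p8_column Z \<noteq> 0" using p8_basis_iff[of Z] by (simp add: basis_tuples_def)
    then show ?thesis by (simp add: ev p8_eval_def p)
  qed
qed

lemmas coset_eval_P8 = coset_eval[of P8 p8_eval, OF p8_eval_relations]

text \<open>As a type of its own, the carrier of the quotient becomes accessible to the results for
  class \<open>comm_ring_1\<close>.\<close>

typedef p8_bracket = "carrier (bracket_ring P8)"
  using cring.cring_simprules(2)[OF cring_bracket_ring] by blast

instantiation p8_bracket :: comm_ring_1
begin

definition "0 = Abs_p8_bracket \<zero>\<^bsub>bracket_ring P8\<^esub>"
definition "1 = Abs_p8_bracket \<one>\<^bsub>bracket_ring P8\<^esub>"
definition "x + y = Abs_p8_bracket (Rep_p8_bracket x \<oplus>\<^bsub>bracket_ring P8\<^esub> Rep_p8_bracket y)"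
definition "x * y = Abs_p8_bracket (Rep_p8_bracket x \<otimes>\<^bsub>bracket_ring P8\<^esub> Rep_p8_bracket y)"
definition "- x = Abs_p8_bracket (\<ominus>\<^bsub>bracket_ring P8\<^esub> Rep_p8_bracket x)"
definition "x - y = x + - (y :: p8_bracket)"

instance
proof
  interpret cring "bracket_ring P8" by (rule cring_bracket_ring)
  note defs = zero_p8_bracket_def one_p8_bracket_def plus_p8_bracket_def times_p8_bracket_def
    uminus_p8_bracket_def minus_p8_bracket_def
  note rules = Rep_p8_bracket Abs_p8_bracket_inverse Rep_p8_bracket_inverse
  fix x y z :: p8_bracket
  show "x + y + z = x + (y + z)" by (simp add: defs rules a_assoc)
  show "x + y = y + x" by (simp add: defs rules a_comm)
  show "0 + x = x" by (simp add: defs rules)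
  show "- x + x = 0" by (simp add: defs rules l_neg)
  show "x - y = x + - y" by (simp add: defs)
  show "x * y * z = x * (y * z)" by (simp add: defs rules m_assoc)
  show "x * y = y * x" by (simp add: defs rules m_comm)
  show "1 * x = x" by (simp add: defs rules)
  show "(x + y) * z = x * z + y * z" by (simp add: defs rules l_distr)
  \<comment> \<open>The class requires 0 \<noteq> 1: evaluation at the minors of
    \<open>[I A8]\<close> separates the two cosets, so representability over the rationals keeps the
    ring from collapsing.\<close>
  have 0: "bracket_ideal P8 +>\<^bsub>bracket_poly_ring P8\<^esub> 0 = \<zero>\<^bsub>bracket_ring P8\<^esub>"
    using ring.a_rcos_zero[OF cring.axioms(1)[OF cring_bracket_poly_ring] ideal_bracket_ideal]
      additive_subgroup.zero_closed[OF ideal.axioms(1)[OF ideal_bracket_ideal[of P8]]]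
    by (simp add: bracket_poly_ring_eq bracket_ring_def FactRing_def)
  have "coset_eval p8_eval \<zero>\<^bsub>bracket_ring P8\<^esub> = 0"
    using coset_eval_P8[of 0] by (simp add: 0 bracket_polys_closed eval_poly_def)
  moreover have "coset_eval p8_eval \<one>\<^bsub>bracket_ring P8\<^esub> = 1"
    using coset_eval_P8[of 1] bracket_coset_hom(3)[of 0 P8 0]
    by (simp add: bracket_polys_closed eval_poly_one)
  ultimately have "\<zero>\<^bsub>bracket_ring P8\<^esub> \<noteq> \<one>\<^bsub>bracket_ring P8\<^esub>" by auto
  then show "(0 :: p8_bracket) \<noteq> 1" by (simp add: defs rules Abs_p8_bracket_inject)
qed

end

interpretation p8: ring_representation "bracket_ring P8" Rep_p8_bracket
proof (intro ring_representation.intro ring_representation_axioms.intro cring_bracket_ring)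
  interpret cring "bracket_ring P8" by (rule cring_bracket_ring)
  note defs = zero_p8_bracket_def one_p8_bracket_def plus_p8_bracket_def times_p8_bracket_def
  note rules = Rep_p8_bracket Abs_p8_bracket_inverse Rep_p8_bracket_inverse
  show "bij_betw Rep_p8_bracket UNIV (carrier (bracket_ring P8))"
    by (rule bij_betw_imageI) (simp_all add: inj_on_def Rep_p8_bracket_inject
        type_definition.Rep_range[OF type_definition_p8_bracket])
  show "Rep_p8_bracket 0 = \<zero>\<^bsub>bracket_ring P8\<^esub>" "Rep_p8_bracket 1 = \<one>\<^bsub>bracket_ring P8\<^esub>"
    "Rep_p8_bracket (x + y) = Rep_p8_bracket x \<oplus>\<^bsub>bracket_ring P8\<^esub> Rep_p8_bracket y"
    "Rep_p8_bracket (x * y) = Rep_p8_bracket x \<otimes>\<^bsub>bracket_ring P8\<^esub> Rep_p8_bracket y" for x y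
    by (simp_all add: defs rules)
qed

definition p8_coset :: "nat bracket_poly \<Rightarrow> p8_bracket" where
  "p8_coset p = Abs_p8_bracket (bracket_ideal P8 +>\<^bsub>bracket_poly_ring P8\<^esub> p)"

lemma Rep_p8_coset:
  "p \<in> bracket_polys P8 \<Longrightarrow> Rep_p8_bracket (p8_coset p) = bracket_ideal P8 +>\<^bsub>bracket_poly_ring P8\<^esub> p"
  unfolding p8_coset_def by (rule Abs_p8_bracket_inverse[OF bracket_coset_hom(4)])

lemma p8_coset_add:
  assumes "p \<in> bracket_polys P8" "q \<in> bracket_polys P8"
  shows "p8_coset (p + q) = p8_coset p + p8_coset q"
  using assms by (simp add: bracket_polys_closed p8.add Rep_p8_coset bracket_coset_hom flip: p8.eq_iff)

lemma p8_coset_mult: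
  assumes "p \<in> bracket_polys P8" "q \<in> bracket_polys P8"
  shows "p8_coset (p * q) = p8_coset p * p8_coset q"
  using assms by (simp add: bracket_polys_closed p8.mult Rep_p8_coset bracket_coset_hom flip: p8.eq_iff)

lemma p8_coset_one: "p8_coset 1 = 1"
  using bracket_coset_hom(3)[of 0 P8 0]
  by (simp add: bracket_polys_closed p8.one Rep_p8_coset flip: p8.eq_iff)

lemma p8_coset_minus:
  assumes "p \<in> bracket_polys P8" "q \<in> bracket_polys P8"
  shows "p8_coset (p - q) = p8_coset p - p8_coset q"
  using p8_coset_add[of "p - q" q] assms by (simp add: bracket_polys_closed eq_diff_eq)

lemma p8_coset_relation: "p \<in> bracket_relations P8 \<Longrightarrow> p8_coset p = 0"
  by (simp add: p8_coset_def bracket_coset_relation zero_p8_bracket_def)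

text \<open>Needed for the signs in the alternating relations.\<close>

lemma p8_coset_of_int: "p8_coset (of_int a) = of_int a"
proof -
  have 0: "p8_coset 0 = 0" using p8_coset_minus[of 0 0] by (simp add: bracket_polys_closed)
  have n: "p8_coset (of_nat n) = of_nat n" for n
  proof (induction n)
    case (Suc n)
    have "of_nat n \<in> bracket_polys P8" using bracket_polys_closed(3)[of "int n"] by simp
    then show ?case using Suc by (simp add: p8_coset_add p8_coset_one bracket_polys_closed)
  qed (simp add: 0)
  show ?thesis
  proof (cases a)
    case (nonneg n)
    then show ?thesis by (simp add: n)
  next
    case (neg n)
    have "of_nat (Suc n) \<in> bracket_polys P8" using bracket_polys_closed(3)[of "int (Suc n)"] by simp
    then have "p8_coset (0 - of_nat (Suc n)) = 0 - of_nat (Suc n)"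
      by (simp only: p8_coset_minus bracket_polys_closed 0 n)
    then show ?thesis using neg by simp
  qed
qed

definition p8_bracket_value :: "nat list \<Rightarrow> p8_bracket" where
  "p8_bracket_value Z = p8_coset (br Z)"

lemma br_closed: "Z \<in> tuples M \<Longrightarrow> br Z \<in> bracket_polys M"
  by (rule bracket_polys_closed(8)) (simp add: bracket_symbols_def)

lemma br_inv_closed: "Z \<in> basis_tuples M \<Longrightarrow> br_inv Z \<in> bracket_polys M"
  by (rule bracket_polys_closed(8)) (simp add: bracket_symbols_def)

lemma bracket_evaluation_p8: "bracket_evaluation P8 p8_bracket_value"
proof
  show "is_matroid P8" by (rule is_matroid_P8)
next
  fix Z assume "Z \<in> tuples P8" "set Z \<notin> bases P8"
  then have "br Z \<in> bracket_relations P8" unfolding bracket_relations_def by auto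
  then show "p8_bracket_value Z = 0" unfolding p8_bracket_value_def by (rule p8_coset_relation)
next
  fix Z \<sigma> assume Z: "Z \<in> tuples P8" and \<sigma>: "\<sigma> permutes {..<matroid_rank P8}"
  then have "br Z - of_int (sign \<sigma>) * br (permute_list \<sigma> Z) \<in> bracket_relations P8"
    unfolding bracket_relations_def by auto
  then have "p8_coset (br Z - of_int (sign \<sigma>) * br (permute_list \<sigma> Z)) = 0"
    by (rule p8_coset_relation)
  moreover have "permute_list \<sigma> Z \<in> tuples P8" using Z \<sigma> by (simp add: tuples_def)
  ultimately show "p8_bracket_value Z = of_int (sign \<sigma>) * p8_bracket_value (permute_list \<sigma> Z)"
    using Z by (simp add: p8_bracket_value_def p8_coset_minus p8_coset_mult p8_coset_of_int
        br_closed bracket_polys_closed)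
next
  fix x1 x2 y1 y2 W
  assume g: "{x1, x2, y1, y2} \<subseteq> ground P8" "set W \<subseteq> ground P8" "length W + 2 = matroid_rank P8"
  then have rel: "br (x1 # x2 # W) * br (y1 # y2 # W) - br (y1 # x2 # W) * br (x1 # y2 # W)
      - br (y2 # x2 # W) * br (y1 # x1 # W) \<in> bracket_relations P8"
    unfolding bracket_relations_def by blast
  have br: "br (x # y # W) \<in> bracket_polys P8" if "{x, y} \<subseteq> ground P8" for x y
    using that g by (intro br_closed) (simp add: tuples_def)
  show "p8_bracket_value (x1 # x2 # W) * p8_bracket_value (y1 # y2 # W)
      - p8_bracket_value (y1 # x2 # W) * p8_bracket_value (x1 # y2 # W)
      - p8_bracket_value (y2 # x2 # W) * p8_bracket_value (y1 # x1 # W) = 0"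
    using p8_coset_relation[OF rel] g(1)
    by (simp add: p8_bracket_value_def p8_coset_minus p8_coset_mult br bracket_polys_closed)
next
  fix Z assume Z: "Z \<in> basis_tuples P8"
  then have rel: "br Z * br_inv Z - 1 \<in> bracket_relations P8"
    unfolding bracket_relations_def by blast
  have "Z \<in> tuples P8" using Z by (simp add: basis_tuples_def)
  then have "p8_bracket_value Z * p8_coset (br_inv Z) = 1"
    using p8_coset_relation[OF rel] Z
    by (simp add: p8_bracket_value_def p8_coset_minus p8_coset_mult p8_coset_one
        br_closed br_inv_closed bracket_polys_closed)
  then show "p8_bracket_value Z dvd 1" by (metis dvd_triv_left)
qed

interpretation p8: p8_bracket_representation "bracket_ring P8" Rep_p8_bracket p8_bracket_value
  by (intro p8_bracket_representation.intro bracket_representation.intro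
      p8_bracket_evaluation.intro bracket_evaluation_p8 p8.ring_representation_axioms)

lemma Rep_p8_bracket_value:
  "Z \<in> tuples P8 \<Longrightarrow> Rep_p8_bracket (p8_bracket_value Z) = bracket P8 Z"
  by (simp add: p8_bracket_value_def bracket_def Rep_p8_coset br_closed)

text \<open>The common denominator [B] of all entries acts as a row weight \<open>\<beta>\<close>;
  the column weights are 1.\<close>

lemma bracket_matrix_scaled:
  assumes B: "B \<in> basis_tuples P8"
  shows "p8.bracket_scaled B (bracket_matrix P8 B)"
proof -
  obtain \<beta> where \<beta>: "1 = p8_bracket_value B * \<beta>" using p8.basis_unit[OF B] by (rule dvdE)
  then have "\<beta> dvd 1" by (metis dvd_triv_right)
  have tup: "B \<in> tuples P8" using B by (simp add: basis_tuples_def)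
  have inv: "inv\<^bsub>bracket_ring P8\<^esub> (bracket P8 B) = Rep_p8_bracket \<beta>"
    unfolding Rep_p8_bracket_value[OF tup, symmetric] using \<beta> by (intro p8.inv_eq) simp
  show ?thesis
  proof (rule p8.bracket_scaledI[OF B, of _ "\<lambda>_. \<beta>" "\<lambda>_. 1"])
    fix u v assume "u \<in> row_labels (bracket_matrix P8 B)" "v \<in> col_labels (bracket_matrix P8 B)"
    then have "replace u v B \<in> tuples P8"
      using tup by (auto simp: bracket_matrix_def tuples_def)
    then have "bracket P8 (replace u v B) = Rep_p8_bracket (p8_bracket_value (replace u v B))"
      by (simp only: Rep_p8_bracket_value)
    then show "entry (bracket_matrix P8 B) u v
        = Rep_p8_bracket (\<beta> * 1 * p8_bracket_value (replace u v B))"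
      by (simp add: bracket_matrix_def inv mult.commute[of \<beta>] p8.mult)
  qed (use \<open>\<beta> dvd 1\<close> in \<open>simp_all add: bracket_matrix_def\<close>)
qed

theorem theorem4p18:
  shows "universal_partial_field P8 \<cong>\<^sub>p\<^sub>f dyadic"
proof -
  \<comment> \<open>The tuple chosen by \<open>SOME\<close> may differ from
    \<open>[0, 1, 2, 3]\<close>, so only \<open>B \<in> basis_tuples P8\<close> is used of
    it.\<close>
  define B where "B = (SOME B. B \<in> basis_tuples P8)"
  have "[0, 1, 2, 3] \<in> basis_tuples P8"
    using p8_standard_basis by (simp add: basis_tuples_def tuples_P8)
  then have B: "B \<in> basis_tuples P8" unfolding B_def by (rule someI)
  define Cr where "Cr = matrix_cross_ratios (bracket_ring P8) (bracket_matrix P8 B)"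
  obtain h :: p8_bracket where "1 = 2 * h" using p8.two_unit by (rule dvdE)
  then have h: "2 * h = 1" ..
  note scaled = bracket_matrix_scaled[OF B]
  have Cr: "Cr \<subseteq> Rep_p8_bracket ` insert 0 dyadic_units"
    using p8.cross_ratio_dyadic[OF scaled] unfolding Cr_def by blast
  have two: "Rep_p8_bracket 2 \<in> Cr" and half: "Rep_p8_bracket h \<in> Cr"
    using p8.two_cross_ratio[OF scaled _ _ h] unfolding Cr_def by (simp_all add: bracket_matrix_def)
  let ?S = "subring_gen (bracket_ring P8) Cr" and ?C = "Cr \<union> {Rep_p8_bracket (- 1)}"
  have U: "universal_partial_field P8 = (?S, mult_group_gen ?S ?C)"
    by (simp add: universal_partial_field_def cross_ratios_def Let_def p8.uminus p8.one
        flip: B_def Cr_def)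
  have C: "?C \<subseteq> Rep_p8_bracket ` insert 0 dyadic_units"
    using Cr dyadic_units_minus_one by blast
  have pf: "is_partial_field (universal_partial_field P8)"
    "pf_set (universal_partial_field P8) = Rep_p8_bracket ` insert 0 dyadic_units"
    unfolding U by (rule p8.dyadic_partial_field[OF h Cr half C]; use two in simp)+
  let ?D = "subring_gen (class_ring :: rat ring) {1 / 2}"
  \<comment> \<open>With the identity as \<open>\<iota>\<close>, the lemma that described the
    universal partial field describes \<open>dyadic\<close> as well.\<close>
  have q: "ring_representation (class_ring :: rat ring) (\<lambda>x. x)"
    by (intro ring_representation.intro ring_representation_axioms.intro cring_class_ring)
      (simp_all add: bij_id[unfolded id_def])
  have h': "2 * (1 / 2 :: rat) = 1" by simp
  have D: "dyadic = (?D, mult_group_gen ?D {-1, 2})" by (simp add: dyadic_def Let_def)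
  have "is_partial_field (?D, mult_group_gen ?D {-1, 2})"
    "pf_set (?D, mult_group_gen ?D {-1, 2}) = (\<lambda>x. x) ` insert 0 dyadic_units"
    by (rule ring_representation.dyadic_partial_field[OF q h'];
        simp add: dyadic_units_half dyadic_units_two dyadic_units_minus_one)+
  then have D_pf: "is_partial_field dyadic" "pf_set dyadic = insert 0 dyadic_units"
    unfolding D by simp_all
  define \<Phi> where "\<Phi> x = coset_eval p8_eval (Rep_p8_bracket x)" for x
  have \<Phi>: "\<Phi> (p8_coset p) = eval_poly p8_eval p" if "p \<in> bracket_polys P8" for p
    using that by (simp add: \<Phi>_def Rep_p8_coset coset_eval_P8)
  \<comment> \<open>Every element is the coset of a bracket polynomial, where \<open>\<Phi>\<close>
    is \<open>eval_poly p8_eval\<close>; the homomorphism laws are inherited from there.\<close>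
  have surj: "\<exists>p \<in> bracket_polys P8. x = p8_coset p" for x
  proof -
    obtain p where "p \<in> bracket_polys P8"
      "Rep_p8_bracket x = bracket_ideal P8 +>\<^bsub>bracket_poly_ring P8\<^esub> p"
      using Rep_p8_bracket[of x] by (rule bracket_ring_cosetE)
    then show ?thesis by (metis p8.eq_iff Rep_p8_coset)
  qed
  have "dyadic_hom \<Phi> h"
  proof
    fix x y
    obtain p where p: "p \<in> bracket_polys P8" "x = p8_coset p" using surj by blast
    obtain q where q: "q \<in> bracket_polys P8" "y = p8_coset q" using surj by blast
    show "\<Phi> (x + y) = \<Phi> x + \<Phi> y" "\<Phi> (x * y) = \<Phi> x * \<Phi> y"
      using p q
      by (simp_all add: \<Phi> eval_poly_add eval_poly_mult bracket_polys_closed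
          flip: p8_coset_add p8_coset_mult)
    show "\<Phi> 1 = 1"
      using \<Phi>[of 1] by (simp add: p8_coset_one eval_poly_one bracket_polys_closed)
  qed (rule h)
  then have "\<exists>\<phi>. pf_iso (universal_partial_field P8) dyadic \<phi>"
  proof (rule p8.dyadic_pf_iso[OF _ pf(2) _ D_pf(2)])
    show "fst (universal_partial_field P8)
        = bracket_ring P8\<lparr>carrier := generate_ring (bracket_ring P8) Cr\<rparr>"
      by (simp add: U subring_gen_def)
    show "fst dyadic = class_ring\<lparr>carrier := generate_ring class_ring {1 / 2}\<rparr>"
      by (simp add: D subring_gen_def)
  qed
  then show ?thesis using pf(1) D_pf(1) by (simp add: pf_isomorphic_def)
qed

end
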